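(* The amoeba-Sacks forcing $\mathbf{AS}$ satisfies the Laver property.
   Context: A tree is a subset of $2^{<\omega}$ closed under initial segments; $s\unlhd t$ means that $s$ is an initial segment of $t$. A node $t\in T$ is splitting if $t^\frown 0,t^\frown 1\in T$; $\mathrm{Split}(T)$ is the set of splitting nodes of $T$. $T$ is perfect if every node of $T$ extends to a splitting node of $T$. For a finite tree $p$, $\mathrm{Term}(p)$ is the set of its terminal nodes. For a finite subtree $p$ of $T$, $p\sqsubseteq T$ ("$p$ is an initial segment of $T$", "$T$ end-extends $p$") means that for every $t\in T\setminus p$ there is $s\in\mathrm{Term}(p)$ with $s\unlhd t$; $p\sqsubset T$ means $p\sqsubseteq T$ and $p\neq T$. For a perfect tree $T$ let $e:\mathrm{Split}(T)\to 2^{<\omega}$ be the natural $\unlhd$-isomorphism (preserving the lexicographic order), and for $s,t\in\mathrm{Split}(T)$ put $s\preccurlyeq t$ iff $|e(s)|<|e(t)|$, or $|e(s)|=|e(t)|$ and $e(s)\le_{\mathrm{lex}}e(t)$. $T$ is good iff for all $s,t\in\mathrm{Split}(T)$, $s\preccurlyeq t$ implies $|s|\le|t|$. Amoeba-Sacks $\mathbf{AS}$ is the poset of all pairs $(p,T)$ where $T$ is a good perfect tree and $p\sqsubset T$ is a finite subtree, ordered by $(p',T')\le(p,T)$ iff $T'\subseteq T$ and $p'$ end-extends $p$. A forcing $P$ satisfies the Laver property if, for every $P$-generic filter $G$ over the ground model $N$, every $g\in\omega^\omega\cap N$ and every $f\in\omega^\omega\cap N[G]$ with $f(n)\le g(n)$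 for all $n$, there is a function $H\in N$ with domain $\omega$ such that $|H(n)|\le 2^n$ and $f(n)\in H(n)$ for all $n\in\omega$. *)

theory Defs
  imports Complex_Main "HOL-Library.Sublist"
begin

section \<open>Trees on \<open>2\<^sup><\<^sup>\<omega>\<close>\<close>

type_synonym node = "bool list"

definition is_tree :: "node set \<Rightarrow> bool" where
  "is_tree T \<longleftrightarrow> (\<forall>t\<in>T. \<forall>s. prefix s t \<longrightarrow> s \<in> T)"

definition Split :: "node set \<Rightarrow> node set" where
  "Split T = {t \<in> T. t @ [False] \<in> T \<and> t @ [True] \<in> T}"

definition perfect :: "node set \<Rightarrow> bool" where
  "perfect T \<longleftrightarrow> is_tree T \<and> (\<forall>s\<in>T. \<exists>t\<in>Split T. prefix s t)"

definition Term :: "node set \<Rightarrow> node set" where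
  "Term p = {t \<in> p. \<forall>s\<in>p. \<not> strict_prefix t s}"

definition init_seg :: "node set \<Rightarrow> node set \<Rightarrow> bool"  (infix "\<sqsubseteq>\<^sub>e" 50) where
  "p \<sqsubseteq>\<^sub>e T \<longleftrightarrow> finite p \<and> is_tree p \<and> p \<subseteq> T \<and>
     (\<forall>t \<in> T - p. \<exists>s \<in> Term p. prefix s t)"

definition strict_init_seg :: "node set \<Rightarrow> node set \<Rightarrow> bool"  (infix "\<sqsubset>\<^sub>e" 50) where
  "p \<sqsubset>\<^sub>e T \<longleftrightarrow> p \<sqsubseteq>\<^sub>e T \<and> p \<noteq> T"

definition lex_le :: "node \<Rightarrow> node \<Rightarrow> bool" where
  "lex_le s t \<longleftrightarrow> s = t \<or> (s, t) \<in> lexord {(False, True)}"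

text \<open>For a nonempty perfect tree these conditions determine \<open>e\<close> uniquely on \<open>Split T\<close>.\<close>

definition natural_iso :: "node set \<Rightarrow> (node \<Rightarrow> node) \<Rightarrow> bool" where
  "natural_iso T e \<longleftrightarrow> bij_betw e (Split T) UNIV \<and>
     (\<forall>s\<in>Split T. \<forall>t\<in>Split T. prefix s t \<longleftrightarrow> prefix (e s) (e t)) \<and>
     (\<forall>s\<in>Split T. \<forall>t\<in>Split T. lex_le s t \<longleftrightarrow> lex_le (e s) (e t))"

definition split_le :: "(node \<Rightarrow> node) \<Rightarrow> node \<Rightarrow> node \<Rightarrow> bool" where
  "split_le e s t \<longleftrightarrow> length (e s) < length (e t) \<or>
     (length (e s) = length (e t) \<and> lex_le (e s) (e t))"

definition good :: "node set \<Rightarrow> bool" where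
  "good T \<longleftrightarrow> (\<exists>e. natural_iso T e \<and>
     (\<forall>s\<in>Split T. \<forall>t\<in>Split T. split_le e s t \<longrightarrow> length s \<le> length t))"


section \<open>Amoeba-Sacks forcing\<close>

type_synonym as_cond = "node set \<times> node set"

definition AS :: "as_cond set" where
  "AS = {(p, T). perfect T \<and> good T \<and> p \<sqsubset>\<^sub>e T}"

definition AS_le :: "as_cond \<Rightarrow> as_cond \<Rightarrow> bool" where
  "AS_le c' c \<longleftrightarrow> snd c' \<subseteq> snd c \<and> fst c \<sqsubseteq>\<^sub>e fst c'"


section \<open>Forcing and the Laver property\<close>

text \<open>
  The ground model \<open>N\<close> is the universe of HOL, over which an atomless poset has no generic
  filter. As usual when forcing over the universe, "\<open>\<phi>\<close> holds in \<open>N[G]\<close> for every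
  generic \<open>G\<close>" therefore means that every condition forces \<open>\<phi>\<close>.

  A name \<open>\<tau>\<close> for a subset of \<open>\<omega> \<times> \<omega>\<close> is a set of pairs \<open>((n, m), p)\<close> with \<open>p\<close> a condition;
  its value is \<open>\<tau>\<^sub>G = {(n, m). \<exists>p\<in>G. ((n, m), p) \<in> \<tau>}\<close>, and the elements of
  \<open>\<omega>\<^sup>\<omega> \<inter> N[G]\<close> are those values that are total functions.
\<close>

type_synonym 'p name = "((nat \<times> nat) \<times> 'p) set"

text \<open>
  The fragment of the forcing language needed here. \<open>Ground b\<close> is a statement about
  objects of \<open>N\<close>, \<open>Mem x \<tau>\<close> is \<open>x \<in> \<tau>\<^sub>G\<close>, and the two quantifiers range over \<open>\<omega>\<close> and
  over the functions from \<open>\<omega>\<close> to the power set of \<open>\<omega>\<close> that lie in \<open>N\<close>.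
\<close>

datatype 'p sentence =
    Ground bool
  | Mem "nat \<times> nat" "'p name"
  | Neg "'p sentence"
  | Conj "'p sentence" "'p sentence"
  | All_nat "nat \<Rightarrow> 'p sentence"
  | All_fun "(nat \<Rightarrow> nat set) \<Rightarrow> 'p sentence"

definition Imp :: "'p sentence \<Rightarrow> 'p sentence \<Rightarrow> 'p sentence" where
  "Imp \<phi> \<psi> = Neg (Conj \<phi> (Neg \<psi>))"

definition Ex_nat :: "(nat \<Rightarrow> 'p sentence) \<Rightarrow> 'p sentence" where
  "Ex_nat \<phi> = Neg (All_nat (\<lambda>n. Neg (\<phi> n)))"

definition Ex_fun :: "((nat \<Rightarrow> nat set) \<Rightarrow> 'p sentence) \<Rightarrow> 'p sentence" where
  "Ex_fun \<phi> = Neg (All_fun (\<lambda>H. Neg (\<phi> H)))"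

primrec forces ::
  "'p set \<Rightarrow> ('p \<Rightarrow> 'p \<Rightarrow> bool) \<Rightarrow> 'p \<Rightarrow> 'p sentence \<Rightarrow> bool" where
  "forces P le p (Ground b) \<longleftrightarrow> b"
| "forces P le p (Mem x \<tau>) \<longleftrightarrow>
     (\<forall>q\<in>P. le q p \<longrightarrow> (\<exists>r\<in>P. le r q \<and> (\<exists>s\<in>P. (x, s) \<in> \<tau> \<and> le r s)))"
| "forces P le p (Neg \<phi>) \<longleftrightarrow> (\<forall>q\<in>P. le q p \<longrightarrow> \<not> forces P le q \<phi>)"
| "forces P le p (Conj \<phi> \<psi>) \<longleftrightarrow> forces P le p \<phi> \<and> forces P le p \<psi>"
| "forces P le p (All_nat \<Phi>) \<longleftrightarrow> (\<forall>n. forces P le p (\<Phi> n))"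
| "forces P le p (All_fun \<Psi>) \<longleftrightarrow> (\<forall>H. forces P le p (\<Psi> H))"

definition in_Baire :: "'p name \<Rightarrow> 'p sentence" where
  "in_Baire \<tau> = Conj
     (All_nat (\<lambda>n. Ex_nat (\<lambda>m. Mem (n, m) \<tau>)))
     (All_nat (\<lambda>n. All_nat (\<lambda>m. All_nat (\<lambda>m'.
        Imp (Conj (Mem (n, m) \<tau>) (Mem (n, m') \<tau>)) (Ground (m = m'))))))"

definition bounded_by :: "'p name \<Rightarrow> (nat \<Rightarrow> nat) \<Rightarrow> 'p sentence" where
  "bounded_by \<tau> g = All_nat (\<lambda>n. All_nat (\<lambda>m. Imp (Mem (n, m) \<tau>) (Ground (m \<le> g n))))"

definition captured :: "'p name \<Rightarrow> 'p sentence" where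
  "captured \<tau> = Ex_fun (\<lambda>H. Conj
     (Ground (\<forall>n. finite (H n) \<and> card (H n) \<le> 2 ^ n))
     (All_nat (\<lambda>n. All_nat (\<lambda>m. Imp (Mem (n, m) \<tau>) (Ground (m \<in> H n))))))"

definition Laver_property :: "'p set \<Rightarrow> ('p \<Rightarrow> 'p \<Rightarrow> bool) \<Rightarrow> bool" where
  "Laver_property P le \<longleftrightarrow>
     (\<forall>g \<tau>. \<tau> \<subseteq> UNIV \<times> P \<longrightarrow>
        (\<forall>p\<in>P. forces P le p (Imp (Conj (in_Baire \<tau>) (bounded_by \<tau> g)) (captured \<tau>))))"

text \<open>The literal meaning of a sentence in \<open>N[G]\<close>, and of the sentence used above.\<close>

primrec holds :: "'p set \<Rightarrow> 'p sentence \<Rightarrow> bool" where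
  "holds G (Ground b) \<longleftrightarrow> b"
| "holds G (Mem x \<tau>) \<longleftrightarrow> (\<exists>s\<in>G. (x, s) \<in> \<tau>)"
| "holds G (Neg \<phi>) \<longleftrightarrow> \<not> holds G \<phi>"
| "holds G (Conj \<phi> \<psi>) \<longleftrightarrow> holds G \<phi> \<and> holds G \<psi>"
| "holds G (All_nat \<Phi>) \<longleftrightarrow> (\<forall>n. holds G (\<Phi> n))"
| "holds G (All_fun \<Psi>) \<longleftrightarrow> (\<forall>H. holds G (\<Psi> H))"

lemma holds_Laver_sentence:
  assumes "{x. \<exists>s\<in>G. (x, s) \<in> \<tau>} = {(n, f n) | n. True}"
  shows "holds G (Imp (Conj (in_Baire \<tau>) (bounded_by \<tau> g)) (captured \<tau>)) \<longleftrightarrow>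
    ((\<forall>n. f n \<le> g n) \<longrightarrow>
       (\<exists>H. (\<forall>n. finite (H n) \<and> card (H n) \<le> 2 ^ n) \<and> (\<forall>n. f n \<in> H n)))"
proof -
  have m: "holds G (Mem (n, m) \<tau>) \<longleftrightarrow> m = f n" for n m
    using assms by (auto simp: set_eq_iff)
  show ?thesis
    by (auto simp: Imp_def in_Baire_def bounded_by_def captured_def Ex_nat_def Ex_fun_def m
      simp del: holds.simps(2))
qed

end

theory Submission
  imports Defs
begin

text \<open>The forcing behaves like Mathias forcing, with perfect trees in place of infinite sets of integers, and the
proof has the same two layers: pure decision, then a fusion that counts finite approximations.

A condition can always be extended to one of the form \<open>(truncate T h, T)\<close>, whose finite part consists of
all nodes of \<open>T\<close> of length at most \<open>h\<close> (\<open>extend_to_truncate\<close>). Such a condition is determined by \<open>h\<close> and \<open>T\<close>;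
the extensions of this form are the pairs \<open>h'\<close>, \<open>T'\<close> with \<open>h \<le> h'\<close>, \<open>T' \<subseteq> T\<close> and \<open>lev T' h = lev T h\<close>.

\<^bold>\<open>Pure decision\<close> (\<open>pure_decision\<close>): a name for an element of a finite set is decided by shrinking \<open>T\<close>
alone, keeping its level \<open>h\<close>. The one-step version colours the next splitting: in a good tree the leaf of
level \<open>h\<close> above which the next splitting node lies is determined by level \<open>h\<close>, and one has to find a perfect
subtree in which all choices of this splitting node, together with the nodes of its level above the other
leaves, get the same colour. This is a statement of Halpern--Laeuchli type. A simultaneous walk along all leaves through
a perfect tree is a word over the finite alphabet of functions from leaves to bits, so the statement follows
from an infinite variable word all of whose instances are monochromatic just before a variable first occurs
(\<open>infinite_variable_word\<close>). That word is read off from an ultrafilter \<open>q\<close> on words with variables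
such that substituting a letter into \<open>q\<close> and multiplying by \<open>q\<close> gives \<open>q\<close> again (\<open>carlson_ultra\<close>).
Given the one-step version (\<open>one_step\<close>), undecidedness at a level
passes to all later levels of a fusion, which contradicts density of the deciding conditions.

\<^bold>\<open>Fusion\<close> (\<open>fusion\<close>): one can build a good subtree with levels \<open>hs 0 < hs 1 < \<dots>\<close> that splits exactly once
between consecutive levels, so that level \<open>hs a\<close> has \<open>N + a\<close> nodes for \<open>N = card (lev T (hs 0))\<close>, and such
that every set of nodes of level \<open>hs a\<close> that can be the level of an extension purely decides the value
at \<open>N + a\<close> of the given function. There are at most \<open>2 ^ (N + a)\<close> such sets of nodes, hence at most that many values.
The first \<open>N\<close> values are decided beforehand (\<open>capture\<close>).\<close>

section \<open>Ultrafilters on words\<close>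

text \<open>Zorn's lemma for filters, ordered by refinement. Filters stand for closed sets of
ultrafilters, so that compactness arguments about spaces of ultrafilters become statements about minimal filters.\<close>

lemma minimal_filter:
  fixes A :: "'a filter set"
  assumes F0: "F0 \<in> A"
    and ch: "\<And>C. C \<subseteq> A \<Longrightarrow> C \<noteq> {} \<Longrightarrow> (\<forall>F\<in>C. \<forall>G\<in>C. F \<le> G \<or> G \<le> F) \<Longrightarrow> Inf C \<in> A"
  shows "\<exists>M\<in>A. M \<le> F0 \<and> (\<forall>F\<in>A. F \<le> M \<longrightarrow> F = M)"
proof -
  define B where "B = {F \<in> A. F \<le> F0}"
  have "\<exists>m\<in>B. \<forall>a\<in>B. m \<ge> a \<longrightarrow> a = m"
  proof (rule predicate_Zorn)
    show "partial_order_on B (relation_of (\<ge>) B)"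
      by (auto simp: partial_order_on_def preorder_on_def refl_on_def trans_def antisym_def relation_of_def)
    fix C assume C: "C \<in> Chains (relation_of (\<ge>) B)"
    show "\<exists>u\<in>B. \<forall>a\<in>C. a \<ge> u"
    proof (cases "C = {}")
      case True then show ?thesis using F0 by (auto simp: B_def)
    next
      case False
      have "C \<subseteq> B" using C by (auto simp: Chains_def relation_of_def)
      moreover have "\<forall>F\<in>C. \<forall>G\<in>C. F \<le> G \<or> G \<le> F"
        using C by (auto simp: Chains_def relation_of_def)
      ultimately have "Inf C \<in> A" using ch[of C] False by (auto simp: B_def)
      moreover have "Inf C \<le> F0" using False \<open>C \<subseteq> B\<close>
        by (metis (no_types, lifting) B_def Inf_lower2 all_not_in_conv mem_Collect_eq subset_eq)
      ultimately show ?thesis by (intro bexI[of _ "Inf C"]) (auto simp: B_def Inf_lower)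
    qed
  qed
  then obtain M where M: "M \<in> A" "M \<le> F0" "\<And>F. F \<in> A \<Longrightarrow> F \<le> F0 \<Longrightarrow> F \<le> M \<Longrightarrow> F = M"
    unfolding B_def by blast
  have "\<forall>F\<in>A. F \<le> M \<longrightarrow> F = M" using M(3) order_trans[OF _ M(2)] by blast
  then show ?thesis using M(1,2) by blast
qed

lemma eventually_Inf_chain:
  assumes "C \<noteq> {}" "\<forall>F\<in>C. \<forall>G\<in>C. F \<le> G \<or> G \<le> F"
  shows "eventually P (Inf C) \<longleftrightarrow> (\<exists>F\<in>C. eventually P F)"
proof (rule eventually_Inf_base[OF assms(1)])
  fix F G assume "F \<in> C" "G \<in> C"
  then show "\<exists>x\<in>C. x \<le> inf F G" using assms(2) by (metis inf.absorb1 inf.absorb2 order_refl)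
qed

lemma Inf_chain_ne_bot:
  fixes C :: "'a filter set"
  assumes "C \<noteq> {}" "\<forall>F\<in>C. \<forall>G\<in>C. F \<le> G \<or> G \<le> F" "\<forall>F\<in>C. F \<noteq> bot"
  shows "Inf C \<noteq> bot"
proof
  assume "Inf C = bot"
  then have "eventually (\<lambda>_. False) (Inf C)" by simp
  then obtain F where "F \<in> C" "eventually (\<lambda>_. False) F"
    using eventually_Inf_chain[OF assms(1,2)] by blast
  then show False using assms(3) by (simp add: trivial_limit_def)
qed

definition ultra :: "'a filter \<Rightarrow> bool" where
  "ultra U \<longleftrightarrow> U \<noteq> bot \<and> (\<forall>P. eventually P U \<or> eventually (\<lambda>x. \<not> P x) U)"

lemma ultra_not: "ultra U \<Longrightarrow> eventually (\<lambda>x. \<not> P x) U \<longleftrightarrow> \<not> eventually P U"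
proof
  assume U: "ultra U" and *: "eventually (\<lambda>x. \<not> P x) U"
  show "\<not> eventually P U"
  proof
    assume "eventually P U"
    with * have "eventually (\<lambda>_. False) U" by eventually_elim simp
    with U show False by (simp add: ultra_def trivial_limit_def)
  qed
qed (auto simp: ultra_def)

lemma ultra_le_eq:
  assumes "ultra U" "V \<le> U" "V \<noteq> bot" shows "V = U"
proof (rule antisym[OF assms(2)], rule filter_leI)
  fix P assume P: "eventually P V"
  show "eventually P U"
  proof (rule ccontr)
    assume "\<not> eventually P U"
    then have "eventually (\<lambda>x. \<not> P x) V" using assms ultra_not filter_leD by blast
    then have "eventually (\<lambda>_. False) V" using P by eventually_elim simp
    then show False using assms(3) by (simp add: trivial_limit_def)
  qed
qed

lemma ultra_exists:
  assumes "F \<noteq> bot" obtains U where "ultra U" "U \<le> F"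
proof -
  have "\<exists>U\<in>{F. F \<noteq> bot}. U \<le> F \<and> (\<forall>G\<in>{F. F \<noteq> bot}. G \<le> U \<longrightarrow> G = U)"
  proof (rule minimal_filter[of F "{F. F \<noteq> bot}"])
    fix C :: "'a filter set"
    assume C: "C \<subseteq> {F. F \<noteq> bot}" "C \<noteq> {}" "\<forall>F\<in>C. \<forall>G\<in>C. F \<le> G \<or> G \<le> F"
    have "Inf C \<noteq> bot" by (rule Inf_chain_ne_bot[OF C(2,3)]) (use C(1) in auto)
    then show "Inf C \<in> {F. F \<noteq> bot}" by simp
  qed (use assms in simp)
  then obtain U where U: "U \<noteq> bot" "U \<le> F" "\<And>G. G \<noteq> bot \<Longrightarrow> G \<le> U \<Longrightarrow> G = U" by blast
  have "eventually P U \<or> eventually (\<lambda>x. \<not> P x) U" for P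
  proof (cases "inf U (principal {x. P x}) = bot")
    case True
    then have "eventually (\<lambda>_. False) (inf U (principal {x. P x}))" by simp
    then show ?thesis by (simp add: eventually_inf_principal)
  next
    case False
    then have "inf U (principal {x. P x}) = U" by (intro U(3)) simp_all
    moreover have "eventually P (inf U (principal {x. P x}))" by (simp add: eventually_inf_principal)
    ultimately show ?thesis by simp
  qed
  then show ?thesis using that[of U] U(1,2) unfolding ultra_def by blast
qed

lemma ultra_finite_range:
  assumes "ultra U" "finite (range f)"
  obtains j where "eventually (\<lambda>x. f x = j) U"
proof (rule ccontr)
  assume "\<not> thesis"
  then have "\<forall>j\<in>range f. eventually (\<lambda>x. f x \<noteq> j) U" using that assms(1) ultra_not by blast
  then have "eventually (\<lambda>x. \<forall>j\<in>range f. f x \<noteq> j) U"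
    by (rule eventually_ball_finite[OF assms(2)])
  then have "eventually (\<lambda>_. False) U" by eventually_elim auto
  then show False using assms(1) by (simp add: ultra_def trivial_limit_def)
qed

text \<open>On ultrafilters this is the multiplication that makes the space of ultrafilters on words a right
topological semigroup; it makes sense and is associative for arbitrary filters.\<close>

definition conc_filter :: "'a list filter \<Rightarrow> 'a list filter \<Rightarrow> 'a list filter" where
  "conc_filter F G = Abs_filter (\<lambda>P. \<forall>\<^sub>F x in F. \<forall>\<^sub>F y in G. P (x @ y))"

lemma eventually_conc_filter: "eventually P (conc_filter F G) \<longleftrightarrow> (\<forall>\<^sub>F x in F. \<forall>\<^sub>F y in G. P (x @ y))"
proof -
  have "is_filter (\<lambda>P. \<forall>\<^sub>F x in F. \<forall>\<^sub>F y in G. P (x @ y))"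
    apply (rule is_filter.intro)
      apply simp
     apply (simp add: eventually_conj_iff)
    subgoal premises prems for P Q
    proof (rule eventually_mono[OF prems(2)])
      fix x assume *: "\<forall>\<^sub>F y in G. P (x @ y)"
      show "\<forall>\<^sub>F y in G. Q (x @ y)"
        by (rule eventually_mono[OF *]) (rule prems(1)[rule_format])
    qed
    done
  from eventually_Abs_filter[OF this] show ?thesis by (simp only: conc_filter_def)
qed

lemma conc_filter_assoc: "conc_filter (conc_filter F G) H = conc_filter F (conc_filter G H)"
  unfolding filter_eq_iff eventually_conc_filter by simp

lemma conc_filter_mono: "F \<le> F' \<Longrightarrow> G \<le> G' \<Longrightarrow> conc_filter F G \<le> conc_filter F' G'"
proof (rule filter_leI)
  fix P assume le: "F \<le> F'" "G \<le> G'" and "eventually P (conc_filter F' G')"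
  then have "\<forall>\<^sub>F x in F. \<forall>\<^sub>F y in G'. P (x @ y)"
    unfolding eventually_conc_filter by (intro filter_leD[OF le(1)])
  then have "\<forall>\<^sub>F x in F. \<forall>\<^sub>F y in G. P (x @ y)"
    by (rule eventually_mono) (rule filter_leD[OF le(2)])
  then show "eventually P (conc_filter F G)" by (simp add: eventually_conc_filter)
qed

lemma conc_filter_ne_bot: "F \<noteq> bot \<Longrightarrow> G \<noteq> bot \<Longrightarrow> conc_filter F G \<noteq> bot"
  by (simp add: trivial_limit_def eventually_conc_filter)

lemma ultra_conc_filter: "ultra U \<Longrightarrow> ultra V \<Longrightarrow> ultra (conc_filter U V)"
  unfolding ultra_def[of "conc_filter U V"]
  by (simp add: eventually_conc_filter ultra_not conc_filter_ne_bot ultra_def[THEN iffD1, THEN conjunct1])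

lemma ultra_filtermap: "ultra U \<Longrightarrow> ultra (filtermap f U)"
  by (simp add: ultra_def eventually_filtermap filtermap_bot_iff)

lemma filtermap_conc_filter:
  assumes "\<And>x y. f (x @ y) = f x @ f y"
  shows "filtermap f (conc_filter F G) = conc_filter (filtermap f F) (filtermap f G)"
  by (simp add: filter_eq_iff eventually_filtermap eventually_conc_filter assms)

text \<open>The Ellis--Numakura lemma with filters in place of closed subsemigroups. Take a minimal proper
filter \<open>F\<close> with \<open>F F \<le> F\<close> and an ultrafilter \<open>x \<le> F\<close>. Minimality gives \<open>F x = F\<close>; therefore the
filter of solutions \<open>y \<le> F\<close> of \<open>y x = x\<close> is proper. It is again a subsemigroup, so it is all of \<open>F\<close> and \<open>x x = x\<close>.\<close>

lemma idempotent_ultra_exists: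
  assumes "F0 \<noteq> bot" "conc_filter F0 F0 \<le> F0"
  obtains x where "ultra x" "x \<le> F0" "conc_filter x x = x"
proof -
  let ?A = "{F. F \<noteq> bot \<and> conc_filter F F \<le> F}"
  have "\<exists>F\<in>?A. F \<le> F0 \<and> (\<forall>G\<in>?A. G \<le> F \<longrightarrow> G = F)"
  proof (rule minimal_filter[of F0 ?A])
    fix C assume C: "C \<subseteq> ?A" "C \<noteq> {}" "\<forall>F\<in>C. \<forall>G\<in>C. F \<le> G \<or> G \<le> F"
    have "conc_filter (Inf C) (Inf C) \<le> Inf C"
    proof (rule filter_leI)
      fix P assume "eventually P (Inf C)"
      then obtain F where "F \<in> C" "eventually P F" using eventually_Inf_chain[OF C(2,3)] by blast
      then have "eventually P (conc_filter F F)" using C(1) filter_leD by blast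
      then show "eventually P (conc_filter (Inf C) (Inf C))"
        using conc_filter_mono[of "Inf C" F "Inf C" F] \<open>F \<in> C\<close> Inf_lower filter_leD by blast
    qed
    moreover have "Inf C \<noteq> bot" by (rule Inf_chain_ne_bot[OF C(2,3)]) (use C(1) in auto)
    ultimately show "Inf C \<in> ?A" by simp
  qed (use assms in simp)
  then obtain F where F: "F \<in> ?A" "F \<le> F0" and min: "\<And>G. G \<in> ?A \<Longrightarrow> G \<le> F \<Longrightarrow> G = F" by blast
  obtain x where x: "ultra x" "x \<le> F" using F ultra_exists by blast
  have xb: "x \<noteq> bot" using x by (simp add: ultra_def)
  have Fx: "conc_filter F x = F"
  proof (rule min)
    have 1: "conc_filter F x \<le> F" using conc_filter_mono[OF order_refl x(2)] F by (metis (no_types, lifting) mem_Collect_eq order_trans)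
    have "conc_filter (conc_filter F x) (conc_filter F x) \<le> conc_filter F (conc_filter F x)"
      using conc_filter_mono[OF 1 order_refl, of "conc_filter F x"] .
    also have "\<dots> = conc_filter (conc_filter F F) x" by (simp add: conc_filter_assoc)
    also have "\<dots> \<le> conc_filter F x" using F by (intro conc_filter_mono) auto
    finally show "conc_filter F x \<in> ?A" using F xb by (simp add: conc_filter_ne_bot)
    show "conc_filter F x \<le> F" by (rule 1)
  qed
  \<comment> \<open>\<open>K A\<close> is the set of \<open>a\<close> with \<open>A\<close> in \<open>a x\<close>; \<open>G\<close> is the filter of solutions \<open>y \<le> F\<close> of \<open>y x = x\<close>.\<close>
  define K where "K = (\<lambda>A. {a. \<forall>\<^sub>F b in x. A (a @ b)})"
  define G where "G = inf F (INF A\<in>{A. eventually A x}. principal (K A))"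
  have evK: "eventually Q (INF A\<in>{A. eventually A x}. principal (K A)) \<longleftrightarrow> (\<exists>A. eventually A x \<and> (\<forall>a\<in>K A. Q a))" for Q
  proof -
    have "eventually Q (INF A\<in>{A. eventually A x}. principal (K A)) \<longleftrightarrow> (\<exists>b\<in>{A. eventually A x}. eventually Q (principal (K b)))"
    proof (rule eventually_INF_base)
      show "{A. eventually A x} \<noteq> {}" using eventually_True by blast
      fix A B assume "A \<in> {A. eventually A x}" "B \<in> {A. eventually A x}"
      then show "\<exists>C\<in>{A. eventually A x}. principal (K C) \<le> inf (principal (K A)) (principal (K B))"
        by (intro bexI[of _ "\<lambda>b. A b \<and> B b"]) (auto simp: K_def eventually_conj_iff)
    qed
    then show ?thesis by (auto simp: eventually_principal)
  qed
  have evG: "eventually Q G \<longleftrightarrow> (\<exists>A E. eventually A x \<and> eventually E F \<and> (\<forall>a\<in>K A. E a \<longrightarrow> Q a))" for Q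
  proof -
    have "(\<exists>E R. eventually E F \<and> (\<exists>A. eventually A x \<and> (\<forall>a\<in>K A. R a)) \<and> (\<forall>a. E a \<and> R a \<longrightarrow> Q a)) \<longleftrightarrow>
        (\<exists>A E. eventually A x \<and> eventually E F \<and> (\<forall>a\<in>K A. E a \<longrightarrow> Q a))" (is "?l \<longleftrightarrow> ?r")
    proof
      assume ?l
      then obtain E R A where "eventually E F" "eventually A x" "\<forall>a\<in>K A. R a" "\<forall>a. E a \<and> R a \<longrightarrow> Q a" by blast
      then show ?r by (intro exI[of _ A] exI[of _ E]) simp
    next
      assume ?r
      then obtain A E where "eventually A x" "eventually E F" "\<forall>a\<in>K A. E a \<longrightarrow> Q a" by blast
      then show ?l by (intro exI[of _ E] exI[of _ "\<lambda>a. a \<in> K A"]) (simp, blast)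
    qed
    then show ?thesis unfolding G_def eventually_inf evK .
  qed
  have "G = F"
  proof (rule min)
    have "\<not> eventually (\<lambda>_. False) G"
    proof
      assume "eventually (\<lambda>_. False) G"
      then obtain A E where AE: "eventually A x" "eventually E F" "\<And>a. a \<in> K A \<Longrightarrow> \<not> E a" using evG by auto
      have "eventually (\<lambda>z. \<not> A z) (conc_filter F x)" unfolding eventually_conc_filter using AE(2)
        by eventually_elim (use AE(3) in \<open>auto simp: K_def ultra_not[OF x(1)]\<close>)
      then have "eventually (\<lambda>z. \<not> A z) x" using Fx x(2) filter_leD by metis
      then show False using AE(1) by (simp add: ultra_not[OF x(1)])
    qed
    then have "G \<noteq> bot" by (auto simp: trivial_limit_def)
    moreover have "conc_filter G G \<le> G"
    proof (rule filter_leI)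
      fix Q assume "eventually Q G"
      then obtain A E where AE: "eventually A x" "eventually E F" "\<forall>a\<in>K A. E a \<longrightarrow> Q a" using evG by auto
      have GF: "G \<le> F" by (simp add: G_def)
      have 1: "eventually E (conc_filter G G)" using AE(2) F conc_filter_mono[OF GF GF] filter_leD
        by (metis (mono_tags, lifting) mem_Collect_eq)
      have 2: "eventually (\<lambda>a. a \<in> K A) (conc_filter G G)"
        unfolding eventually_conc_filter
      proof -
        have KG: "eventually (\<lambda>a. a \<in> K B) G" if "eventually B x" for B
          using evG that eventually_True by blast
        from KG[OF AE(1)] show "\<forall>\<^sub>F a in G. \<forall>\<^sub>F b in G. a @ b \<in> K A"
        proof eventually_elim
          case (elim a)
          then have "eventually (\<lambda>b. A (a @ b)) x" by (simp add: K_def)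
          from KG[OF this] show ?case by (simp add: K_def)
        qed
      qed
      from 1 2 show "eventually Q (conc_filter G G)" by eventually_elim (use AE(3) in auto)
    qed
    ultimately show "G \<in> ?A" by simp
    show "G \<le> F" by (simp add: G_def)
  qed
  have "conc_filter x x \<le> x"
  proof (rule filter_leI)
    fix A assume "eventually A x"
    then have "eventually (\<lambda>a. a \<in> K A) F" using evG \<open>G = F\<close> eventually_True by blast
    then have "eventually (\<lambda>a. a \<in> K A) x" using x(2) filter_leD by blast
    then show "eventually A (conc_filter x x)" by (simp add: eventually_conc_filter K_def)
  qed
  then have "conc_filter x x = x" using ultra_le_eq x(1) conc_filter_ne_bot[OF xb xb] by blast
  then show ?thesis using that x F(2) by (meson order_trans)
qed

text \<open>An idempotent is a right identity on the left ideal that it generates. Writing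
\<open>y = z x\<close> would give this at once, but needs an ultrafilter \<open>z\<close>; arguing with sets avoids it.\<close>

lemma conc_filter_right_identity:
  assumes x: "ultra x" "conc_filter x x = x" and y: "ultra y" "y \<le> conc_filter G x"
  shows "conc_filter y x = y"
proof -
  have "y \<le> conc_filter y x"
  proof (rule filter_leI, rule ccontr)
    fix A assume A: "eventually A (conc_filter y x)" and "\<not> eventually A y"
    have "eventually (\<lambda>a. A a \<or> \<not> (\<forall>\<^sub>F b in x. A (a @ b))) (conc_filter G x)"
      unfolding eventually_conc_filter
    proof (rule always_eventually, rule allI)
      fix a
      show "\<forall>\<^sub>F b in x. A (a @ b) \<or> \<not> (\<forall>\<^sub>F c in x. A ((a @ b) @ c))"
      proof (cases "\<forall>\<^sub>F b in x. A (a @ b)")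
        case True then show ?thesis by (rule eventually_mono) simp
      next
        case False
        then have "eventually (\<lambda>b. \<not> A (a @ b)) (conc_filter x x)" using x ultra_not by metis
        then have "\<forall>\<^sub>F b in x. \<forall>\<^sub>F c in x. \<not> A (a @ b @ c)" by (simp add: eventually_conc_filter)
        then show ?thesis by eventually_elim (use ultra_not[OF x(1)] in auto)
      qed
    qed
    then have "eventually (\<lambda>a. A a \<or> \<not> (\<forall>\<^sub>F b in x. A (a @ b))) y" using y filter_leD by blast
    moreover have "eventually (\<lambda>a. \<forall>\<^sub>F b in x. A (a @ b)) y" using A by (simp add: eventually_conc_filter)
    ultimately have "eventually A y" by eventually_elim auto
    then show False using \<open>\<not> eventually A y\<close> by simp
  qed
  then show ?thesis
    using ultra_le_eq[OF ultra_conc_filter[OF y(1) x(1)]] y(1) by (metis ultra_def)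
qed

text \<open>Words over \<open>'a option\<close> are words with variable \<open>None\<close>; \<open>fill a w\<close> substitutes \<open>a\<close> for it.\<close>

definition fill :: "'a \<Rightarrow> 'a option list \<Rightarrow> 'a list" where
  "fill a w = map (\<lambda>c. case c of None \<Rightarrow> a | Some b \<Rightarrow> b) w"

text \<open>Let \<open>p\<close> be an idempotent in a minimal left ideal of the ultrafilters on constant words, and \<open>e\<close> an idempotent
on words with a variable such that \<open>e p = e\<close>. Then \<open>q = p e\<close> is an idempotent below \<open>p\<close>. Its image under the
substitution of a letter is again below \<open>p\<close>, because substitution is a homomorphism fixing \<open>p\<close>, and
minimality of \<open>p\<close> makes it equal to \<open>p\<close>. Finally \<open>p q = q\<close>.\<close>

lemma carlson_ultra:
  obtains q :: "'a option list filter" where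
    "ultra q" "eventually (\<lambda>w. None \<in> set w) q"
    "\<And>a. conc_filter (filtermap (\<lambda>w. map Some (fill a w)) q) q = q"
proof -
  define W :: "'a option list set" where "W = {w. None \<notin> set w}"
  define V :: "'a option list set" where "V = {w. None \<in> set w}"
  let ?A = "{F. F \<noteq> bot \<and> F \<le> principal W \<and> (\<forall>a\<in>W. filtermap ((@) a) F \<le> F)}"
  have WW: "a \<in> W \<Longrightarrow> b \<in> W \<Longrightarrow> a @ b \<in> W" for a b by (auto simp: W_def)
  have "[] \<in> W" by (simp add: W_def)
  \<comment> \<open>A minimal invariant filter is a minimal left ideal.\<close>
  have "\<exists>M\<in>?A. M \<le> principal W \<and> (\<forall>F\<in>?A. F \<le> M \<longrightarrow> F = M)"
  proof (rule minimal_filter[of "principal W" ?A])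
    show "principal W \<in> ?A" using WW \<open>[] \<in> W\<close> by (auto simp: principal_eq_bot_iff)
    fix C assume C: "C \<subseteq> ?A" "C \<noteq> {}" "\<forall>F\<in>C. \<forall>G\<in>C. F \<le> G \<or> G \<le> F"
    have "filtermap ((@) a) (Inf C) \<le> Inf C" if "a \<in> W" for a
    proof (rule Inf_greatest)
      fix F assume F: "F \<in> C"
      then have "filtermap ((@) a) (Inf C) \<le> filtermap ((@) a) F" by (intro filtermap_mono Inf_lower)
      also have "\<dots> \<le> F" using F C(1) that by auto
      finally show "filtermap ((@) a) (Inf C) \<le> F" .
    qed
    moreover have "Inf C \<le> principal W" using C(1,2) by (metis (no_types, lifting) Inf_lower2 all_not_in_conv mem_Collect_eq subset_eq)
    moreover have "Inf C \<noteq> bot" by (rule Inf_chain_ne_bot[OF C(2,3)]) (use C(1) in auto)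
    ultimately show "Inf C \<in> ?A" by simp
  qed
  then obtain M where M: "M \<in> ?A" and min: "\<And>F. F \<in> ?A \<Longrightarrow> F \<le> M \<Longrightarrow> F = M" by blast
  have Minv: "\<forall>\<^sub>F y in M. P (a @ y)" if "eventually P M" "a \<in> W" for P a
    using M that filter_leD[of "filtermap ((@) a) M" M P] by (auto simp: eventually_filtermap)
  have evW: "eventually (\<lambda>w. w \<in> W) F" if "F \<le> M" for F
    using M that by (metis (no_types, lifting) eventually_principal filter_leD mem_Collect_eq)
  have left: "conc_filter F G \<le> M" if "F \<le> principal W" "G \<le> M" for F G
  proof (rule filter_leI)
    fix P assume P: "eventually P M"
    have "eventually (\<lambda>w. w \<in> W) F" using that(1) by (metis eventually_principal filter_leD)
    then show "eventually P (conc_filter F G)" unfolding eventually_conc_filter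
      by eventually_elim (use Minv[OF P] that(2) filter_leD in blast)
  qed
  have MW: "M \<le> principal W" using M by simp
  obtain p where p: "ultra p" "p \<le> M" "conc_filter p p = p"
    using idempotent_ultra_exists[of M] M left[OF MW] by auto
  define N where "N = conc_filter (principal V) p"
  have "[None] \<in> V" by (simp add: V_def)
  have "N \<noteq> bot" unfolding N_def using p(1) \<open>[None] \<in> V\<close>
    by (intro conc_filter_ne_bot) (auto simp: principal_eq_bot_iff ultra_def)
  moreover have "conc_filter N N \<le> N"
  proof (rule filter_leI)
    fix P assume "eventually P N"
    then have "\<forall>w\<in>V. \<forall>\<^sub>F b in p. P (w @ b)" by (simp add: N_def eventually_conc_filter eventually_principal)
    moreover have "w @ a @ w' \<in> V" if "w \<in> V" for w a w' using that by (auto simp: V_def)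
    ultimately have "\<forall>w\<in>V. \<forall>a. \<forall>w'\<in>V. \<forall>\<^sub>F b in p. P ((w @ a @ w') @ b)" by blast
    then show "eventually P (conc_filter N N)" by (simp add: N_def eventually_conc_filter eventually_principal)
  qed
  ultimately obtain e where e: "ultra e" "e \<le> N" "conc_filter e e = e" using idempotent_ultra_exists by blast
  have ep: "conc_filter e p = e" using conc_filter_right_identity[OF p(1,3) e(1)] e(2) N_def by blast
  define q where "q = conc_filter p e"
  have uq: "ultra q" unfolding q_def using p e by (simp add: ultra_conc_filter)
  have "eventually (\<lambda>w. w \<in> V) N" by (auto simp: N_def eventually_conc_filter eventually_principal V_def)
  then have "eventually (\<lambda>w. w \<in> V) e" using e(2) filter_leD by blast
  then have "\<forall>\<^sub>F y in e. x @ y \<in> V" for x by eventually_elim (simp add: V_def)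
  then have "eventually (\<lambda>w. w \<in> V) q" by (simp add: q_def eventually_conc_filter)
  moreover have "conc_filter (filtermap (\<lambda>w. map Some (fill a w)) q) q = q" for a
  proof -
    define s where "s = (\<lambda>w. map Some (fill a w))"
    have hom: "s (x @ y) = s x @ s y" for x y by (simp add: s_def fill_def)
    have sW: "s w \<in> W" for w by (auto simp: s_def W_def)
    have sid: "s w = w" if "w \<in> W" for w
      unfolding s_def fill_def map_map
    proof (rule map_idI)
      fix c assume "c \<in> set w"
      then have "c \<noteq> None" using that by (intro notI) (simp add: W_def)
      then show "(Some \<circ> case_option a (\<lambda>b. b)) c = c" by auto
    qed
    have sp: "filtermap s p = p"
    proof -
      have "eventually P (filtermap s p) \<longleftrightarrow> eventually P p" for P
        unfolding eventually_filtermap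
      proof (rule eventually_subst)
        show "\<forall>\<^sub>F w in p. P (s w) \<longleftrightarrow> P w"
          using evW[OF p(2)] by eventually_elim (simp add: sid)
      qed
      then show ?thesis unfolding filter_eq_iff by blast
    qed
    define e' where "e' = filtermap s e"
    have ue': "ultra e'" unfolding e'_def using e by (simp add: ultra_filtermap)
    have e'p: "conc_filter e' p = e'" using filtermap_conc_filter[of s e p, OF hom] ep sp by (simp add: e'_def)
    have e'e': "conc_filter e' e' = e'" using filtermap_conc_filter[of s e e, OF hom] e(3) by (simp add: e'_def)
    define x where "x = conc_filter p e'"
    have xq: "filtermap s q = x" unfolding q_def x_def e'_def using filtermap_conc_filter[of s p e, OF hom] sp by simp
    have ux: "ultra x" unfolding x_def using p ue' by (simp add: ultra_conc_filter)
    have xx: "conc_filter x x = x" unfolding x_def by (metis e'e' e'p conc_filter_assoc)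
    have xp: "conc_filter x p = x" unfolding x_def by (metis e'p conc_filter_assoc)
    have "x \<le> principal W" unfolding xq[symmetric] by (simp add: le_principal eventually_filtermap sW)
    then have xM: "x \<le> M" using left[OF _ p(2)] xp by metis
    have "conc_filter (principal W) x = M"
    proof (rule min)
      have "conc_filter (principal W) x \<noteq> bot" using ux \<open>[] \<in> W\<close>
        by (intro conc_filter_ne_bot) (auto simp: principal_eq_bot_iff ultra_def)
      moreover have "conc_filter (principal W) x \<le> principal W"
        unfolding le_principal eventually_conc_filter eventually_principal
      proof
        fix a assume "a \<in> W"
        have "eventually (\<lambda>w. w \<in> W) x" using \<open>x \<le> principal W\<close> by (simp add: le_principal)
        then show "\<forall>\<^sub>F w in x. a @ w \<in> W" by eventually_elim (use WW \<open>a \<in> W\<close> in blast)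
      qed
      moreover have "filtermap ((@) a) (conc_filter (principal W) x) \<le> conc_filter (principal W) x" if "a \<in> W" for a
        using that WW by (auto simp: le_filter_def eventually_filtermap eventually_conc_filter eventually_principal simp flip: append_assoc)
      ultimately show "conc_filter (principal W) x \<in> ?A" by blast
      show "conc_filter (principal W) x \<le> M" using left[OF order_refl xM] .
    qed
    then have "conc_filter p x = p" using conc_filter_right_identity[OF ux xx p(1), of "principal W"] p(2) by simp
    moreover have "conc_filter p x = x" unfolding x_def by (metis p(3) conc_filter_assoc)
    ultimately have "filtermap s q = p" using xq by simp
    moreover have "conc_filter p q = q" unfolding q_def by (metis p(3) conc_filter_assoc)
    ultimately show ?thesis by (simp add: s_def)
  qed
  ultimately show ?thesis using that[OF uq] by (auto simp: V_def)
qed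

section \<open>A Carlson--Simpson theorem for infinite variable words\<close>

text \<open>Letters are \<open>Inl c\<close>, the \<open>n\<close>-th variable is \<open>Inr n\<close>.\<close>

definition inst :: "(nat \<Rightarrow> 'a) \<Rightarrow> ('a + nat) list \<Rightarrow> 'a list" where
  "inst lam U = map (case_sum id lam) U"

text \<open>Give a constant word \<open>z\<close> the colour that \<open>z\<close> followed by the prefix before the first variable of \<open>w\<close>
has for \<open>q\<close>-almost all \<open>w\<close>. The invariance of \<open>q\<close> says that this limit colour is inherited by \<open>z\<close>
followed by an instance of \<open>w\<close>, for almost all \<open>w\<close>; so finite words can be appended for ever
while the finitely many instances of the word built so far keep the same limit colour. Finiteness of the
alphabet is what makes these instances finite in number.\<close>

theorem infinite_variable_word:
  fixes chi :: "'a list \<Rightarrow> 'c"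
  assumes fin: "finite (range chi)" and L: "finite L" "L \<noteq> {}"
  obtains D :: "nat \<Rightarrow> 'a + nat" and j where
    "\<And>n. \<exists>l. D l = Inr n"
    "\<And>n l lam. D l = Inr n \<Longrightarrow> (\<And>i. i < l \<Longrightarrow> D i \<noteq> Inr n) \<Longrightarrow> range lam \<subseteq> L \<Longrightarrow>
       chi (inst lam (map D [0..<l])) = j"
proof -
  obtain q :: "'a option list filter" where q: "ultra q" "eventually (\<lambda>w. None \<in> set w) q"
    "\<And>a. conc_filter (filtermap (\<lambda>w. map Some (fill a w)) q) q = q" by (rule carlson_ultra) (rule that)
  define pre where "pre = (\<lambda>w :: 'a option list. map the (takeWhile (\<lambda>c. c \<noteq> None) w))"
  \<comment> \<open>the limit colour of \<open>z\<close>\<close>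
  define C where "C = (\<lambda>z j. \<forall>\<^sub>F w in q. chi (z @ pre w) = j)"
  have "finite (range (\<lambda>w. chi ([] @ pre w)))" by (rule finite_subset[OF _ fin]) auto
  then obtain j where j: "C [] j" using ultra_finite_range[OF q(1)] unfolding C_def by blast
  have pre_app: "pre (map Some y @ w) = y @ pre w" for y w
    unfolding pre_def by (induction y) auto
  have Cstep: "\<forall>\<^sub>F w in q. C (z @ fill a w) j" if "C z j" for z a
  proof -
    have "\<forall>\<^sub>F w in conc_filter (filtermap (\<lambda>w. map Some (fill a w)) q) q. chi (z @ pre w) = j"
      using that by (simp add: q(3) C_def)
    then show ?thesis by (simp add: eventually_conc_filter eventually_filtermap pre_app C_def)
  qed
  define ok where "ok = (\<lambda>n U. (\<forall>lam. range lam \<subseteq> L \<longrightarrow> C (inst lam U) j) \<and> (\<forall>m. Inr m \<in> set U \<longrightarrow> m < n))"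
  define nx where "nx = (\<lambda>n U U'. \<exists>u v. U' = U @ u @ Inr n # v \<and> Inr n \<notin> set u \<and>
     (\<forall>lam. range lam \<subseteq> L \<longrightarrow> chi (inst lam (U @ u)) = j))"
  have "\<exists>U. \<forall>n. ok n (U n) \<and> nx n (U n) (U (Suc n))"
  proof (rule dependent_nat_choice)
    show "\<exists>U. ok 0 U" by (rule exI[of _ "[]"]) (simp add: ok_def inst_def j)
    fix U n assume U: "ok n U"
    define I where "I = (\<lambda>lam. inst lam U) ` {lam. range lam \<subseteq> L}"
    have "I \<subseteq> {xs. set xs \<subseteq> L \<union> (Inl -` set U) \<and> length xs = length U}"
      by (force simp: I_def inst_def split: sum.splits)
    moreover have "finite (Inl -` set U :: 'a set)" by (rule finite_vimageI) auto
    ultimately have finI: "finite I" using finite_lists_length_eq[of "L \<union> (Inl -` set U)"] L(1) finite_subset by fastforce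
    have "\<forall>z\<in>I. \<forall>\<^sub>F w in q. chi (z @ pre w) = j" using U by (auto simp: ok_def I_def C_def)
    then have 1: "\<forall>\<^sub>F w in q. \<forall>z\<in>I. chi (z @ pre w) = j" by (rule eventually_ball_finite[OF finI])
    have "\<forall>z\<in>I. \<forall>\<^sub>F w in q. \<forall>a\<in>L. C (z @ fill a w) j"
      using U Cstep by (intro ballI eventually_ball_finite[OF L(1)]) (auto simp: ok_def I_def)
    then have 2: "\<forall>\<^sub>F w in q. \<forall>z\<in>I. \<forall>a\<in>L. C (z @ fill a w) j" by (rule eventually_ball_finite[OF finI])
    have "\<forall>\<^sub>F w in q. None \<in> set w \<and> (\<forall>z\<in>I. chi (z @ pre w) = j) \<and> (\<forall>z\<in>I. \<forall>a\<in>L. C (z @ fill a w) j)"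
      using q(2) 1 2 by (simp add: eventually_conj_iff)
    from eventually_happens'[OF _ this] q(1) obtain w where w: "None \<in> set w" "\<forall>z\<in>I. chi (z @ pre w) = j" "\<forall>z\<in>I. \<forall>a\<in>L. C (z @ fill a w) j"
      unfolding ultra_def by blast
    define mk where "mk = (\<lambda>c :: 'a option. case c of None \<Rightarrow> Inr n | Some b \<Rightarrow> Inl b)"
    define u where "u = map (Inl :: 'a \<Rightarrow> 'a + nat) (pre w)"
    obtain v where wv: "w = map Some (pre w) @ None # v"
    proof -
      have "dropWhile (\<lambda>c. c \<noteq> None) w \<noteq> []" using w(1) by (auto simp: dropWhile_eq_Nil_conv)
      then obtain c v where cv: "dropWhile (\<lambda>c. c \<noteq> None) w = c # v" by (cases "dropWhile (\<lambda>c. c \<noteq> None) w") auto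
      then have "c = None" using hd_dropWhile[of "\<lambda>c. c \<noteq> None" w] by auto
      moreover have "map Some (pre w) = takeWhile (\<lambda>c. c \<noteq> None) w"
        unfolding pre_def map_map by (rule map_idI) (auto dest: set_takeWhileD)
      ultimately show ?thesis using that takeWhile_dropWhile_id[of "\<lambda>c. c \<noteq> None" w] cv by metis
    qed
    have mkw: "map mk w = u @ Inr n # map mk v" by (subst wv) (simp add: mk_def u_def)
    have instw: "inst lam (U @ map mk w) = inst lam U @ fill (lam n) w" for lam
      by (auto simp: inst_def fill_def mk_def split: option.splits)
    have "ok (Suc n) (U @ map mk w)"
      unfolding ok_def instw
    proof (intro conjI allI impI)
      fix lam :: "nat \<Rightarrow> 'a" assume "range lam \<subseteq> L"
      then show "C (inst lam U @ fill (lam n) w) j" using w(3) by (auto simp: I_def)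
    next
      fix m assume "Inr m \<in> set (U @ map mk w)"
      then show "m < Suc n" using U by (auto simp: ok_def mk_def less_Suc_eq split: option.splits)
    qed
    moreover have "nx n U (U @ map mk w)" unfolding nx_def
    proof (intro exI conjI allI impI)
      show "U @ map mk w = U @ u @ Inr n # map mk v" by (simp add: mkw)
      show "Inr n \<notin> set u" by (auto simp: u_def)
      fix lam :: "nat \<Rightarrow> 'a" assume "range lam \<subseteq> L"
      moreover have "inst lam (U @ u) = inst lam U @ pre w" by (simp add: inst_def u_def comp_def)
      ultimately show "chi (inst lam (U @ u)) = j" using w(2) by (auto simp: I_def)
    qed
    ultimately show "\<exists>U'. ok (Suc n) U' \<and> nx n U U'" by blast
  qed
  then obtain U where ok: "\<And>n. ok n (U n)" and nx: "\<And>n. nx n (U n) (U (Suc n))" by blast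
  have pf: "prefix (U n) (U (n + d))" for n d
  proof (induction d)
    case (Suc d)
    have "prefix (U (n + d)) (U (Suc (n + d)))" using nx[of "n + d"] by (auto simp: nx_def prefix_def)
    then show ?case using Suc by (simp add: prefix_order.trans)
  qed simp
  have len: "n \<le> length (U n)" for n
  proof (induction n)
    case (Suc n) then show ?case using nx[of n] by (auto simp: nx_def)
  qed simp
  define D where "D = (\<lambda>l. U (Suc l) ! l)"
  have D: "D l = U n ! l" if "l < length (U n)" for l n
  proof -
    have "l < length (U (Suc l))" using len[of "Suc l"] by simp
    moreover have "prefix (U n) (U (Suc l)) \<or> prefix (U (Suc l)) (U n)"
      using pf[of n "Suc l - n"] pf[of "Suc l" "n - Suc l"] by (cases "n \<le> Suc l") auto
    ultimately show ?thesis using that by (auto simp: D_def prefix_def nth_append)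
  qed
  have mapD: "map D [0..<l] = take l (U n)" if "l \<le> length (U n)" for l n
    using that by (intro nth_equalityI) (auto simp: D)
  have first: "\<exists>u. map D [0..<length (U n @ u)] = U n @ u \<and> D (length (U n @ u)) = Inr n \<and> Inr n \<notin> set (U n @ u)
     \<and> (\<forall>lam. range lam \<subseteq> L \<longrightarrow> chi (inst lam (U n @ u)) = j)" for n
  proof -
    obtain u v where uv: "U (Suc n) = U n @ u @ Inr n # v" "Inr n \<notin> set u"
      "\<forall>lam. range lam \<subseteq> L \<longrightarrow> chi (inst lam (U n @ u)) = j" using nx[of n] unfolding nx_def by blast
    have "map D [0..<length (U n @ u)] = U n @ u"
      using mapD[of "length (U n @ u)" "Suc n"] uv(1) by simp
    moreover have "D (length (U n @ u)) = Inr n"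
      using D[of "length (U n @ u)" "Suc n"] uv(1) by (simp add: nth_append)
    moreover have "Inr n \<notin> set (U n)" using ok[of n] by (auto simp: ok_def)
    ultimately show ?thesis using uv by (intro exI[of _ u]) auto
  qed
  show ?thesis
  proof (rule that[of D j])
    show "\<exists>l. D l = Inr n" for n using first[of n] by blast
    fix n l and lam :: "nat \<Rightarrow> 'a" assume l: "D l = Inr n" "\<And>i. i < l \<Longrightarrow> D i \<noteq> Inr n" and lam: "range lam \<subseteq> L"
    obtain u where u: "map D [0..<length (U n @ u)] = U n @ u" "D (length (U n @ u)) = Inr n" "Inr n \<notin> set (U n @ u)"
      "\<forall>lam. range lam \<subseteq> L \<longrightarrow> chi (inst lam (U n @ u)) = j" using first[of n] by blast
    have "\<not> length (U n @ u) < l" using l(2) u(2) by blast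
    moreover have "\<not> l < length (U n @ u)"
    proof
      assume lt: "l < length (U n @ u)"
      then have "D l = (U n @ u) ! l" using arg_cong[OF u(1), of "\<lambda>xs. xs ! l"] by simp
      then show False using u(3) l(1) lt by (metis nth_mem)
    qed
    ultimately have "l = length (U n @ u)" by simp
    then show "chi (inst lam (map D [0..<l])) = j" using u(1,4) lam by simp
  qed
qed

section \<open>Levels, cones and splitting codes of perfect trees\<close>

definition lev :: "node set \<Rightarrow> nat \<Rightarrow> node set" where
  "lev T h = {t \<in> T. length t = h}"

definition cone :: "node set \<Rightarrow> node set \<Rightarrow> node set" where
  "cone T Z = {t \<in> T. \<exists>z\<in>Z. prefix t z \<or> prefix z t}"

lemma lev_iff [simp]: "t \<in> lev T h \<longleftrightarrow> t \<in> T \<and> length t = h" by (simp add: lev_def)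
lemma finite_lev: "finite (lev T h)"
  using finite_lists_length_eq[of "UNIV :: bool set" h] by (auto intro: finite_subset[of _ "{xs. set xs \<subseteq> UNIV \<and> length xs = h}"])
lemma lev_mono: "S \<subseteq> T \<Longrightarrow> lev S h \<subseteq> lev T h" by auto

lemma Split_iff: "t \<in> Split T \<longleftrightarrow> t \<in> T \<and> t @ [False] \<in> T \<and> t @ [True] \<in> T" by (simp add: Split_def)
lemma Split_mono: "S \<subseteq> T \<Longrightarrow> Split S \<subseteq> Split T" by (auto simp: Split_def)

lemma prefix_take_iff: "prefix s t \<longleftrightarrow> length s \<le> length t \<and> s = take (length s) t"
  by (metis prefix_def append_eq_conv_conj prefix_length_le take_is_prefix)

lemma prefix_same_length: "prefix s t \<Longrightarrow> length s = length t \<Longrightarrow> s = t"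
  by (auto simp: prefix_def)

lemma tree_take: "is_tree T \<Longrightarrow> t \<in> T \<Longrightarrow> take n t \<in> T"
  unfolding is_tree_def using take_is_prefix by blast

lemma perfect_tree: "perfect T \<Longrightarrow> is_tree T" by (simp add: perfect_def)
lemma perfect_take: "perfect T \<Longrightarrow> t \<in> T \<Longrightarrow> take n t \<in> T" using perfect_tree tree_take by blast
lemma perfect_prefix: "perfect T \<Longrightarrow> t \<in> T \<Longrightarrow> prefix s t \<Longrightarrow> s \<in> T"
  unfolding perfect_def is_tree_def by blast

lemma perfect_split: "perfect T \<Longrightarrow> t \<in> T \<Longrightarrow> \<exists>s\<in>Split T. prefix t s" by (auto simp: perfect_def)

lemma perfect_step:
  assumes "perfect T" "t \<in> T" shows "\<exists>b. t @ [b] \<in> T"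
proof -
  obtain s where s: "s \<in> Split T" "prefix t s" using perfect_split assms by blast
  show ?thesis
  proof (cases "t = s")
    case True then show ?thesis using s by (auto simp: Split_iff)
  next
    case False
    then obtain b r where "s = t @ b # r" using s(2) by (metis append_Nil2 neq_Nil_conv prefixE)
    then show ?thesis using perfect_prefix[OF assms(1), of s "t @ [b]"] s(1) by (auto simp: Split_iff)
  qed
qed

lemma perfect_ext:
  assumes "perfect T" "t \<in> T" "length t \<le> h"
  shows "\<exists>y\<in>lev T h. prefix t y"
  using assms(3)
proof (induction h)
  case 0 then show ?case using assms(2) by auto
next
  case (Suc h)
  show ?case
  proof (cases "length t = Suc h")
    case True then show ?thesis using assms(2) by auto
  next
    case False
    then obtain y where y: "y \<in> lev T h" "prefix t y" using Suc by auto
    then obtain b where "y @ [b] \<in> T" using perfect_step[OF assms(1)] by auto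
    then show ?thesis using y by (intro bexI[of _ "y @ [b]"]) auto
  qed
qed

lemma perfect_root: "perfect T \<Longrightarrow> T \<noteq> {} \<Longrightarrow> [] \<in> T"
  using perfect_prefix[of T _ "[]"] by auto

lemma lev_nonempty: "perfect T \<Longrightarrow> T \<noteq> {} \<Longrightarrow> lev T h \<noteq> {}"
  using perfect_ext[of T "[]" h] perfect_root by auto

lemma below_iff:
  assumes "perfect T" "length t \<le> h"
  shows "t \<in> T \<longleftrightarrow> (\<exists>y\<in>lev T h. prefix t y)"
  using perfect_ext[OF assms(1) _ assms(2)] perfect_prefix[OF assms(1)] by auto

lemma below_cong:
  assumes "perfect S" "perfect T" "lev S h = lev T h" "length t \<le> h"
  shows "t \<in> S \<longleftrightarrow> t \<in> T"
  using below_iff[OF assms(1,4)] below_iff[OF assms(2,4)] assms(3) by simp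

lemma lev_cong_le:
  assumes "perfect S" "perfect T" "lev S h = lev T h" "k \<le> h"
  shows "lev S k = lev T k"
  using below_cong[OF assms(1,2,3)] assms(4) by auto

lemma Split_cong:
  assumes "perfect S" "perfect T" "lev S h = lev T h" "length t < h"
  shows "t \<in> Split S \<longleftrightarrow> t \<in> Split T"
  using below_cong[OF assms(1,2,3)] assms(4) by (simp add: Split_iff)

lemma cone_perfect:
  assumes T: "perfect T" and Z: "Z \<subseteq> lev T h"
  shows "perfect (cone T Z)" and "lev (cone T Z) h = Z"
proof -
  show "perfect (cone T Z)" unfolding perfect_def
  proof (intro conjI ballI)
    show "is_tree (cone T Z)" unfolding is_tree_def
    proof (intro ballI allI impI)
      fix t s assume t: "t \<in> cone T Z" and st: "prefix s t"
      then obtain z where z: "z \<in> Z" "prefix t z \<or> prefix z t" by (auto simp: cone_def)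
      have "prefix s z \<or> prefix z s" using z(2) st prefix_same_cases prefix_order.trans by blast
      then show "s \<in> cone T Z" using t st z perfect_prefix[OF T] by (auto simp: cone_def)
    qed
    fix t assume t: "t \<in> cone T Z"
    then obtain z where z: "z \<in> Z" "prefix t z \<or> prefix z t" by (auto simp: cone_def)
    define u where "u = (if prefix t z then z else t)"
    have u: "u \<in> T" "prefix z u" "prefix t u" using z t Z by (auto simp: u_def cone_def)
    obtain s where s: "s \<in> Split T" "prefix u s" using perfect_split[OF T u(1)] by blast
    then have "s \<in> Split (cone T Z)" using z u unfolding Split_iff cone_def
      by (auto intro!: bexI[of _ z] simp: prefix_def)
    then show "\<exists>s\<in>Split (cone T Z). prefix t s" using s u prefix_order.trans by blast
  qed
  show "lev (cone T Z) h = Z"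
  proof (intro equalityI subsetI)
    fix t assume "t \<in> lev (cone T Z) h"
    then obtain z where z: "z \<in> Z" "prefix t z \<or> prefix z t" "length t = h" by (auto simp: cone_def)
    then show "t \<in> Z" using Z by (metis lev_iff prefix_same_length subsetD) 
  next
    fix t assume "t \<in> Z" then show "t \<in> lev (cone T Z) h" using Z by (auto simp: cone_def)
  qed
qed

lemma cone_subset: "cone T Z \<subseteq> T" by (auto simp: cone_def)
lemma cone_mono: "S \<subseteq> T \<Longrightarrow> Y \<subseteq> Z \<Longrightarrow> cone S Y \<subseteq> cone T Z" by (auto simp: cone_def)

lemma subset_cone:
  assumes "perfect R" "R \<subseteq> T" "lev R h \<subseteq> Z" shows "R \<subseteq> cone T Z"
proof
  fix t assume t: "t \<in> R"
  show "t \<in> cone T Z"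
  proof (cases "length t \<le> h")
    case True
    then obtain y where "y \<in> lev R h" "prefix t y" using perfect_ext[OF assms(1) t] by blast
    then show ?thesis using assms t by (auto simp: cone_def)
  next
    case False
    have "take h t \<in> Z" using assms(3) perfect_take[OF assms(1) t] False by auto
    moreover have "prefix (take h t) t" by (rule take_is_prefix)
    ultimately show ?thesis using assms t unfolding cone_def by blast
  qed
qed

text \<open>The directions taken at the splitting nodes below \<open>s\<close>. On splitting nodes this is the natural isomorphism
onto the full binary tree, and its length is the rank of a node; unlike the isomorphism it is defined for
all nodes, in particular for the leaves of a level.\<close>

definition code :: "node set \<Rightarrow> node \<Rightarrow> node" where
  "code T s = map (\<lambda>i. s ! i) (filter (\<lambda>i. take i s \<in> Split T) [0..<length s])"

lemma code_Nil [simp]: "code T [] = []" by (simp add: code_def)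

lemma code_snoc: "code T (s @ [b]) = code T s @ (if s \<in> Split T then [b] else [])"
proof -
  have "filter (\<lambda>i. take i (s @ [b]) \<in> Split T) [0..<length s] = filter (\<lambda>i. take i s \<in> Split T) [0..<length s]"
    by (rule filter_cong) auto
  then show ?thesis by (auto simp: code_def nth_append)
qed

lemma code_prefix: assumes "prefix s t" shows "prefix (code T s) (code T t)"
proof -
  have "prefix (code T s) (code T (s @ r))" for r
  proof (induction r rule: rev_induct)
    case (snoc b r)
    then show ?case by (simp add: code_snoc flip: append_assoc)
  qed simp
  then show ?thesis using assms by (auto simp: prefix_def)
qed

lemma code_cong:
  assumes "\<And>r. strict_prefix r s \<Longrightarrow> r \<in> Split S \<longleftrightarrow> r \<in> Split T"
  shows "code S s = code T s"
  using assms
proof (induction s rule: rev_induct)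
  case (snoc b s)
  have "code S s = code T s" by (rule snoc.IH) (use snoc.prems in \<open>auto simp: strict_prefix_def prefix_def\<close>)
  then show ?case using snoc.prems[of s] by (simp add: code_snoc strict_prefix_def)
qed simp

lemma code_cong_lev:
  assumes "perfect S" "perfect T" "lev S h = lev T h" "length s \<le> h"
  shows "code S s = code T s"
proof (rule code_cong)
  fix r assume "strict_prefix r s"
  then have "length r < h" using assms(4) prefix_length_less by fastforce
  then show "r \<in> Split S \<longleftrightarrow> r \<in> Split T" using Split_cong[OF assms(1-3)] by blast
qed

lemma code_strict:
  assumes "s \<in> Split T" "strict_prefix s t"
  obtains b where "prefix (s @ [b]) t" "prefix (code T s @ [b]) (code T t)"
proof -
  obtain b r where "t = s @ b # r" using assms(2) by (metis append_Nil2 neq_Nil_conv prefixE strict_prefixE')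
  then have "prefix (s @ [b]) t" by simp
  then show ?thesis using that[of b] code_prefix[of "s @ [b]" t T] assms(1) by (simp add: code_snoc)
qed

lemma tree_diverge:
  assumes "is_tree T" "s \<in> T" "t \<in> T" "\<not> prefix s t" "\<not> prefix t s"
  obtains c b where "c \<in> Split T" "prefix (c @ [b]) s" "prefix (c @ [\<not> b]) t"
proof -
  obtain as b bs c cs where "b \<noteq> c" "s = as @ b # bs" "t = as @ c # cs"
    using parallel_decomp[of s t] assms(4,5) by blast
  then have *: "prefix (as @ [b]) s" "prefix (as @ [\<not> b]) t" by auto
  then have "as @ [b] \<in> T" "as @ [\<not> b] \<in> T" "as \<in> T" using assms unfolding is_tree_def
    by (meson prefix_order.trans prefixI)+
  then show ?thesis using * by (intro that[of as b]) (cases b; auto simp: Split_iff)+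
qed

lemma lex_le_diverge:
  assumes "prefix (c @ [b]) s" "prefix (c @ [\<not> b]) t"
  shows "lex_le s t \<longleftrightarrow> \<not> b"
proof -
  obtain r r' where "s = c @ b # r" "t = c @ (\<not> b) # r'" using assms by (auto simp: prefix_def)
  then show ?thesis by (cases b) (auto simp: lex_le_def lexord_append_leftI lexord_same_pref_iff)
qed

lemma lex_le_prefix: "prefix s t \<Longrightarrow> lex_le s t"
proof (cases "s = t")
  case False
  assume "prefix s t"
  with False obtain b r where "t = s @ b # r" by (metis append_Nil2 neq_Nil_conv prefixE)
  then show ?thesis using lexord_append_rightI[of "b # r" s "{(False, True)}"] by (simp add: lex_le_def)
qed (simp add: lex_le_def)

lemma lex_le_not_strict_prefix: "strict_prefix t s \<Longrightarrow> \<not> lex_le s t"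
proof -
  assume "strict_prefix t s"
  then obtain b r where s: "s = t @ b # r" by (metis append_Nil2 neq_Nil_conv prefixE strict_prefixE')
  have "(t @ b # r, t @ []) \<notin> lexord {(False, True)}" unfolding lexord_same_pref_iff by simp
  then show ?thesis by (simp add: lex_le_def s)
qed

lemma diverge_not_prefix:
  assumes "prefix (c @ [b]) s" "prefix (c @ [\<not> b]) t"
  shows "\<not> prefix s t" "\<not> prefix t s" "s \<noteq> t"
proof -
  obtain r r' where rr: "s = c @ b # r" "t = c @ (\<not> b) # r'" using assms by (auto simp: prefix_def)
  show "\<not> prefix s t" "\<not> prefix t s" "s \<noteq> t" unfolding rr by (cases b; simp)+
qed

lemma code_cases:
  assumes T: "is_tree T" and s: "s \<in> Split T" and t: "t \<in> Split T"
  obtains "s = t" | "strict_prefix s t" "strict_prefix (code T s) (code T t)"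
  | "strict_prefix t s" "strict_prefix (code T t) (code T s)"
  | c d b where "prefix (c @ [b]) s" "prefix (c @ [\<not> b]) t" "prefix (d @ [b]) (code T s)" "prefix (d @ [\<not> b]) (code T t)"
proof -
  consider "s = t" | "strict_prefix s t" | "strict_prefix t s" | "\<not> prefix s t" "\<not> prefix t s"
    by (auto simp: strict_prefix_def)
  then show ?thesis
  proof cases
    case 2
    then obtain b where "prefix (code T s @ [b]) (code T t)" using code_strict[OF s] by metis
    then have "strict_prefix (code T s) (code T t)" by (auto simp: prefix_def strict_prefix_def)
    then show ?thesis using that 2 by blast
  next
    case 3
    then obtain b where "prefix (code T t @ [b]) (code T s)" using code_strict[OF t] by metis
    then have "strict_prefix (code T t) (code T s)" by (auto simp: prefix_def strict_prefix_def)
    then show ?thesis using that 3 by blast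
  next
    case 4
    then obtain c b where c: "c \<in> Split T" "prefix (c @ [b]) s" "prefix (c @ [\<not> b]) t"
      using tree_diverge[OF T] s t by (metis Split_iff)
    show ?thesis
      using that(4)[of c b "code T c"] c code_prefix[OF c(2), of T] code_prefix[OF c(3), of T] by (simp add: code_snoc)
  qed (use that in blast)
qed

lemma code_iso:
  assumes T: "is_tree T" and s: "s \<in> Split T" and t: "t \<in> Split T"
  shows "prefix s t \<longleftrightarrow> prefix (code T s) (code T t)"
    "lex_le s t \<longleftrightarrow> lex_le (code T s) (code T t)"
    "code T s = code T t \<longleftrightarrow> s = t"
proof -
  have "(prefix s t \<longleftrightarrow> prefix (code T s) (code T t)) \<and> (lex_le s t \<longleftrightarrow> lex_le (code T s) (code T t))
     \<and> (code T s = code T t \<longleftrightarrow> s = t)"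
  proof (cases rule: code_cases[OF T s t])
    case 1 then show ?thesis by (simp add: lex_le_def)
  next
    case 2
    then show ?thesis using lex_le_prefix[of s t] lex_le_prefix[of "code T s" "code T t"] by (auto simp: strict_prefix_def)
  next
    case 3
    then show ?thesis using lex_le_not_strict_prefix[OF 3(1)] lex_le_not_strict_prefix[OF 3(2)]
      3 by (auto simp: strict_prefix_def)
  next
    case (4 c d b)
    then show ?thesis
      using diverge_not_prefix[OF 4(1,2)] diverge_not_prefix[OF 4(3,4)] lex_le_diverge[OF 4(1,2)] lex_le_diverge[OF 4(3,4)] by simp
  qed
  then show "prefix s t \<longleftrightarrow> prefix (code T s) (code T t)"
    "lex_le s t \<longleftrightarrow> lex_le (code T s) (code T t)"
    "code T s = code T t \<longleftrightarrow> s = t" by blast+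
qed

text \<open>The unique shortest splitting node above \<open>u\<close>.\<close>

lemma next_split:
  assumes T: "perfect T" and u: "u \<in> T"
  obtains s where "s \<in> Split T" "prefix u s" "code T s = code T u" "\<And>r. r \<in> Split T \<Longrightarrow> prefix u r \<Longrightarrow> prefix s r"
proof -
  obtain s0 where s0: "s0 \<in> Split T" "prefix u s0" using perfect_split[OF T u] by blast
  define P where "P = (\<lambda>n. \<exists>s. s \<in> Split T \<and> prefix u s \<and> length s = n)"
  have "P (length s0)" using s0 by (auto simp: P_def)
  then have "P (Least P)" by (rule LeastI)
  then obtain s where s: "s \<in> Split T" "prefix u s" "length s = Least P" by (auto simp: P_def)
  have min: "length s \<le> length r" if "r \<in> Split T" "prefix u r" for r
    using that Least_le[of P "length r"] s(3) by (auto simp: P_def)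
  have c: "code T (take n s) = code T u" if "length u \<le> n" "n \<le> length s" for n
    using that
  proof (induction n rule: dec_induct)
    case base then show ?case using s(2) prefix_take_iff by metis
  next
    case (step n)
    then have lt: "n < length s" by simp
    have "prefix u (take n s)" using s(2) step(1) by (metis prefix_order.trans prefix_same_cases prefix_length_prefix take_is_prefix length_take min.absorb2 lt less_imp_le)
    then have "take n s \<notin> Split T" using min[of "take n s"] lt by auto
    then show ?case using step lt by (simp add: take_Suc_conv_app_nth code_snoc)
  qed
  have "code T s = code T u" using c[of "length s"] prefix_length_le[OF s(2)] by simp
  moreover have "prefix s r" if r: "r \<in> Split T" "prefix u r" for r
  proof (rule ccontr)
    assume "\<not> prefix s r"
    moreover have "\<not> prefix r s" using min[OF r] calculation prefix_length_le prefix_same_length by fastforce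
    ultimately obtain c b where cb: "c \<in> Split T" "prefix (c @ [b]) s" "prefix (c @ [\<not> b]) r"
      using tree_diverge[OF perfect_tree[OF T], of s r] s(1) r(1) by (metis Split_iff)
    have "prefix u c"
    proof (rule ccontr)
      assume "\<not> prefix u c"
      moreover have "prefix u (c @ [b]) \<or> prefix (c @ [b]) u" using s(2) cb(2) prefix_same_cases by blast
      moreover have "prefix u (c @ [\<not> b]) \<or> prefix (c @ [\<not> b]) u" using r(2) cb(3) prefix_same_cases by blast
      ultimately show False by (cases b) (auto simp: prefix_def append_eq_append_conv2 append_eq_Cons_conv Cons_eq_append_conv)
    qed
    then have "length s \<le> length c" using min cb(1) by blast
    then show False using prefix_length_le[OF cb(2)] by simp
  qed
  ultimately show ?thesis using that s(1,2) by blast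
qed

lemma code_surj:
  assumes T: "perfect T" "T \<noteq> {}"
  shows "\<exists>s\<in>Split T. code T s = x"
proof (induction x rule: rev_induct)
  case Nil
  obtain s where "s \<in> Split T" "code T s = code T []" using next_split[OF T(1) perfect_root[OF T]] by metis
  then show ?case by auto
next
  case (snoc b x)
  then obtain s where s: "s \<in> Split T" "code T s = x" by blast
  then have "s @ [b] \<in> T" by (cases b) (auto simp: Split_iff)
  then obtain r where "r \<in> Split T" "code T r = code T (s @ [b])" using next_split[OF T(1)] by metis
  then show ?case using s by (auto simp: code_snoc)
qed

definition level_good :: "node set \<Rightarrow> bool" where
  "level_good T \<longleftrightarrow> (\<forall>s\<in>Split T. \<forall>t\<in>Split T.
     length (code T s) < length (code T t) \<or> (length (code T s) = length (code T t) \<and> lex_le s t) \<longrightarrow> length s \<le> length t)"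

lemma natural_iso_code: "perfect T \<Longrightarrow> T \<noteq> {} \<Longrightarrow> natural_iso T (code T)"
proof -
  assume T: "perfect T" "T \<noteq> {}"
  note iso = code_iso[OF perfect_tree[OF T(1)]]
  have "inj_on (code T) (Split T)" using iso(3) by (simp add: inj_on_def)
  moreover have "code T ` Split T = UNIV" using code_surj[OF T] by (metis UNIV_eq_I image_eqI)
  ultimately show ?thesis using iso(1,2) by (simp add: natural_iso_def bij_betw_def)
qed

lemma length_code: "length (code T s) = card {r \<in> Split T. strict_prefix r s}"
proof -
  have "inj_on (\<lambda>i. take i s) {i. i < length s}"
    by (rule inj_onI) (metis (mono_tags) length_take mem_Collect_eq min.absorb4)
  then have inj: "inj_on (\<lambda>i. take i s) {i. i < length s \<and> take i s \<in> Split T}" by (rule inj_on_subset) auto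
  have "{r \<in> Split T. strict_prefix r s} = (\<lambda>i. take i s) ` {i. i < length s \<and> take i s \<in> Split T}"
  proof (intro equalityI subsetI)
    fix r assume r: "r \<in> {r \<in> Split T. strict_prefix r s}"
    then have "length r < length s" "r = take (length r) s"
      using prefix_length_less prefix_take_iff by (auto simp: strict_prefix_def)
    then show "r \<in> (\<lambda>i. take i s) ` {i. i < length s \<and> take i s \<in> Split T}" using r by auto
  next
    fix r assume "r \<in> (\<lambda>i. take i s) ` {i. i < length s \<and> take i s \<in> Split T}"
    then show "r \<in> {r \<in> Split T. strict_prefix r s}" by (auto simp: strict_prefix_def take_is_prefix)
  qed
  then have "card {r \<in> Split T. strict_prefix r s} = card {i. i < length s \<and> take i s \<in> Split T}"
    using card_image[OF inj] by simp
  also have "\<dots> = length (filter (\<lambda>i. take i s \<in> Split T) [0..<length s])"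
    by (subst distinct_card[symmetric]) (auto simp: Collect_conj_eq intro!: arg_cong[of _ _ card])
  finally show ?thesis by (simp add: code_def)
qed

text \<open>Isomorphisms preserve the number of predecessors, so the rank of a splitting node does not depend on the
isomorphism that witnesses goodness.\<close>

lemma natural_iso_length:
  assumes e: "natural_iso T e" and s: "s \<in> Split T"
  shows "length (e s) = length (code T s)"
proof -
  have bij: "bij_betw e (Split T) UNIV" and pre: "\<And>r t. r \<in> Split T \<Longrightarrow> t \<in> Split T \<Longrightarrow> prefix r t \<longleftrightarrow> prefix (e r) (e t)"
    using e by (auto simp: natural_iso_def)
  have eq: "e r = e t \<longleftrightarrow> r = t" if "r \<in> Split T" "t \<in> Split T" for r t
    using bij that by (auto simp: bij_betw_def inj_on_def)
  have "e ` {r \<in> Split T. strict_prefix r s} = {x. strict_prefix x (e s)}"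
  proof (intro equalityI subsetI)
    fix x assume "x \<in> {x. strict_prefix x (e s)}"
    moreover obtain r where "r \<in> Split T" "x = e r" using bij by (metis UNIV_I bij_betw_def imageE)
    ultimately show "x \<in> e ` {r \<in> Split T. strict_prefix r s}" using pre[of r s] s by (auto simp: strict_prefix_def)
  qed (use pre eq s in \<open>auto simp: strict_prefix_def\<close>)
  moreover have "inj_on e {r \<in> Split T. strict_prefix r s}" using bij by (auto simp: bij_betw_def inj_on_def)
  ultimately have "card {r \<in> Split T. strict_prefix r s} = card {x. strict_prefix x (e s)}" using card_image by metis
  moreover have "card {x. strict_prefix x y} = length y" for y :: node
  proof -
    have "{x. strict_prefix x y} = (\<lambda>i. take i y) ` {..<length y}"
    proof (intro equalityI subsetI)
      fix x assume x: "x \<in> {x. strict_prefix x y}"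
      then have "length x < length y" "x = take (length x) y"
        using prefix_length_less prefix_take_iff by (auto simp: strict_prefix_def)
      then show "x \<in> (\<lambda>i. take i y) ` {..<length y}" by auto
    qed (auto simp: strict_prefix_def take_is_prefix)
    moreover have "inj_on (\<lambda>i. take i y) {..<length y}"
      by (rule inj_onI) (metis length_take lessThan_iff min.absorb4)
    ultimately show ?thesis by (simp add: card_image)
  qed
  ultimately show ?thesis by (simp add: length_code)
qed

lemma good_iff:
  assumes "perfect T" shows "good T \<longleftrightarrow> T \<noteq> {} \<and> level_good T"
proof
  assume "good T"
  then obtain e where e: "natural_iso T e" and g: "\<forall>s\<in>Split T. \<forall>t\<in>Split T. split_le e s t \<longrightarrow> length s \<le> length t"
    by (auto simp: good_def)
  have "Split T \<noteq> {}" using e by (auto simp: natural_iso_def bij_betw_def)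
  then have "T \<noteq> {}" by (auto simp: Split_iff)
  moreover have "level_good T" unfolding level_good_def
  proof (intro ballI impI)
    fix s t assume st: "s \<in> Split T" "t \<in> Split T"
      "length (code T s) < length (code T t) \<or> (length (code T s) = length (code T t) \<and> lex_le s t)"
    have "lex_le s t \<longleftrightarrow> lex_le (e s) (e t)" using e st by (auto simp: natural_iso_def)
    then have "split_le e s t" using st natural_iso_length[OF e] by (auto simp: split_le_def)
    then show "length s \<le> length t" using g st by blast
  qed
  ultimately show "T \<noteq> {} \<and> level_good T" ..
next
  assume T: "T \<noteq> {} \<and> level_good T"
  show "good T" unfolding good_def
  proof (intro exI conjI ballI impI)
    show "natural_iso T (code T)" using natural_iso_code assms T by blast
    fix s t assume "s \<in> Split T" "t \<in> Split T" "split_le (code T) s t"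
    then show "length s \<le> length t"
      using T code_iso(2)[OF perfect_tree[OF assms]] unfolding level_good_def split_le_def by blast
  qed
qed

section \<open>Fusion of perfect trees\<close>

text \<open>In a good tree the first splitting node of length at least \<open>h\<close> lies above this leaf (see \<open>first_split\<close>): the
leaf of least rank, and leftmost among those. It depends only on level \<open>h\<close>.\<close>

definition next_leaf :: "node set \<Rightarrow> nat \<Rightarrow> node \<Rightarrow> bool" where
  "next_leaf T h k \<longleftrightarrow> k \<in> lev T h \<and> (\<forall>x\<in>lev T h. length (code T k) < length (code T x) \<or>
     (length (code T k) = length (code T x) \<and> lex_le k x))"

lemma lex_le_linear: "lex_le s t \<or> lex_le t s"
  using lexord_linear[of "{(False, True)}" s t] by (auto simp: lex_le_def)

lemma lex_le_trans: "lex_le r s \<Longrightarrow> lex_le s t \<Longrightarrow> lex_le r t"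
  using lexord_trans[of r s "{(False, True)}" t] by (auto simp: lex_le_def trans_def)

lemma lex_min_exists:
  assumes "finite A" "A \<noteq> {}" shows "\<exists>k\<in>A. \<forall>x\<in>A. lex_le k x"
  using assms
proof (induction rule: finite_ne_induct)
  case (singleton x) then show ?case by (simp add: lex_le_def)
next
  case (insert x F)
  then obtain k where k: "k \<in> F" "\<forall>y\<in>F. lex_le k y" by blast
  show ?case
  proof (cases "lex_le k x")
    case True then show ?thesis using k by auto
  next
    case False
    then have "lex_le x k" using lex_le_linear by blast
    then have "\<forall>y\<in>insert x F. lex_le x y" using k lex_le_trans by (auto simp: lex_le_def)
    then show ?thesis by blast
  qed
qed

lemma next_leaf_exists:
  assumes "lev T h \<noteq> {}" shows "\<exists>k. next_leaf T h k"
proof -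
  let ?f = "\<lambda>x. length (code T x)"
  define A where "A = {x \<in> lev T h. ?f x = Min (?f ` lev T h)}"
  have fin: "finite (?f ` lev T h)" using finite_lev by blast
  have "Min (?f ` lev T h) \<in> ?f ` lev T h" using Min_in[OF fin] assms by blast
  then have "A \<noteq> {}" unfolding A_def by force
  moreover have "finite A" by (rule finite_subset[OF _ finite_lev[of T h]]) (auto simp: A_def)
  ultimately obtain k where k: "k \<in> A" "\<forall>x\<in>A. lex_le k x" using lex_min_exists by blast
  have "?f k < ?f x \<or> ?f k = ?f x \<and> lex_le k x" if x: "x \<in> lev T h" for x
  proof -
    have "?f k \<le> ?f x" using k(1) Min_le[OF fin] x unfolding A_def by auto
    then show ?thesis using k x unfolding A_def by force
  qed
  then show ?thesis using k(1) unfolding next_leaf_def A_def by blast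
qed

lemma next_leaf_cong:
  assumes "perfect S" "perfect T" "lev S h = lev T h"
  shows "next_leaf S h k \<longleftrightarrow> next_leaf T h k"
proof -
  have "code S x = code T x" if "x \<in> lev T h" for x
    using code_cong_lev[OF assms, of x] that by simp
  then show ?thesis unfolding next_leaf_def assms(3) by (metis (no_types, lifting))
qed

lemma prefix_take_eq: "prefix z t \<Longrightarrow> length z = h \<Longrightarrow> take h t = z"
  by (auto simp: prefix_def)

text \<open>Shrinking the part of \<open>T\<close> above \<open>Z\<close> without changing the part above other nodes of the same level.\<close>

lemma replace_cone:
  assumes T: "perfect T" and Z: "Z \<subseteq> lev T h" and S: "perfect S" "S \<subseteq> T" "lev S h = Z"
  obtains T' where "perfect T'" "T' \<subseteq> T" "lev T' h = lev T h" "cone T' Z \<subseteq> S"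
proof -
  define T' where "T' = {t \<in> T. length t \<le> h \<or> take h t \<notin> Z \<or> t \<in> S}"
  have sub: "T' \<subseteq> T" by (auto simp: T'_def)
  have lv: "lev T' h = lev T h" by (auto simp: T'_def)
  have "is_tree T'" unfolding is_tree_def
  proof (intro ballI allI impI)
    fix t s assume t: "t \<in> T'" and st: "prefix s t"
    have sT: "s \<in> T" using t st perfect_prefix[OF T] by (auto simp: T'_def)
    show "s \<in> T'"
    proof (cases "length s \<le> h")
      case False
      then have "take h s = take h t" "\<not> length t \<le> h" using st by (auto simp: prefix_def)
      then show ?thesis using t sT perfect_prefix[OF S(1) _ st] by (auto simp: T'_def)
    qed (use sT in \<open>simp add: T'_def\<close>)
  qed
  moreover have "\<exists>s\<in>Split T'. prefix t s" if t: "t \<in> T'" for t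
  proof -
    have "t \<in> T" using t sub by blast
    obtain u where u: "u \<in> T'" "prefix t u" "h \<le> length u"
    proof (cases "length t \<le> h")
      case True
      then obtain y where "y \<in> lev T h" "prefix t y" using perfect_ext[OF T \<open>t \<in> T\<close>] by blast
      moreover from this have "y \<in> lev T' h" using lv by blast
      ultimately show ?thesis using that[of y] by simp
    qed (use that[of t] t in simp)
    have tk: "take h v = take h u" if "prefix u v" for v using that u(3) by (auto simp: prefix_def)
    show ?thesis
    proof (cases "take h u \<in> Z")
      case True
      have "u \<in> S"
      proof (cases "length u = h")
        case True then show ?thesis using \<open>take h u \<in> Z\<close> S(3) by auto
      next
        case False then show ?thesis using u True by (auto simp: T'_def)
      qed
      then obtain s where s: "s \<in> Split S" "prefix u s" using perfect_split[OF S(1)] by blast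
      then have "s \<in> Split T'" using S(2) by (auto simp: T'_def Split_iff)
      then show ?thesis using s u(2) prefix_order.trans by blast
    next
      case False
      obtain s where s: "s \<in> Split T" "prefix u s" using perfect_split[OF T] u(1) sub by blast
      have nz: "take h v \<notin> Z" if "prefix s v" for v using tk[of v] False s(2) that prefix_order.trans by metis
      have "take h s \<notin> Z" "take h (s @ [False]) \<notin> Z" "take h (s @ [True]) \<notin> Z" by (intro nz; simp)+
      then have "s \<in> Split T'" using s(1) by (simp add: T'_def Split_iff del: take_append)
      then show ?thesis using s u(2) prefix_order.trans by blast
    qed
  qed
  ultimately have "perfect T'" by (simp add: perfect_def)
  moreover have "cone T' Z \<subseteq> S"
  proof
    fix t assume "t \<in> cone T' Z"
    then obtain z where z: "z \<in> Z" "prefix t z \<or> prefix z t" and t: "t \<in> T'" by (auto simp: cone_def)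
    have zS: "z \<in> S" "length z = h" using z(1) S(3) by auto
    show "t \<in> S"
    proof (cases "prefix t z")
      case True then show ?thesis using perfect_prefix[OF S(1) zS(1)] by blast
    next
      case False
      then have zt: "prefix z t" using z by blast
      then have "take h t = z" "\<not> length t \<le> h"
        using zS(2) prefix_take_eq False prefix_same_length prefix_length_le by (blast, force)
      then show ?thesis using t z(1) by (auto simp: T'_def)
    qed
  qed
  ultimately show ?thesis using that sub lv by blast
qed

text \<open>The properties arranged by a fusion: \<open>c\<close> is a counter (the size of the current level), \<open>h\<close> the level, and
the property survives shrinking that keeps level \<open>h\<close>.\<close>

definition hereditary :: "(nat \<Rightarrow> nat \<Rightarrow> node set \<Rightarrow> bool) \<Rightarrow> bool" where
  "hereditary R \<longleftrightarrow> (\<forall>c h S S'. R c h S \<longrightarrow> perfect S' \<longrightarrow> S' \<subseteq> S \<longrightarrow> lev S' h = lev S h \<longrightarrow> R c h S')"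

text \<open>A level is finite, so its subsets can be treated one after the other; earlier successes are hereditary.\<close>

lemma thin_all_cones:
  assumes R: "hereditary R" and T: "perfect T"
    and dense: "\<And>S. perfect S \<Longrightarrow> S \<noteq> {} \<Longrightarrow> S \<subseteq> T \<Longrightarrow> \<exists>S'. perfect S' \<and> S' \<subseteq> S \<and> lev S' h = lev S h \<and> R c h S'"
  shows "\<exists>T'. perfect T' \<and> T' \<subseteq> T \<and> lev T' h = lev T h \<and> (\<forall>Z. Z \<subseteq> lev T h \<longrightarrow> Z \<noteq> {} \<longrightarrow> R c h (cone T' Z))"
proof -
  have "\<exists>T'. perfect T' \<and> T' \<subseteq> T \<and> lev T' h = lev T h \<and> (\<forall>Z\<in>F. R c h (cone T' Z))"
    if "finite F" "\<forall>Z\<in>F. Z \<subseteq> lev T h \<and> Z \<noteq> {}" for F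
    using that
  proof (induction F)
    case empty then show ?case using T by blast
  next
    case (insert Z F)
    then obtain T1 where T1: "perfect T1" "T1 \<subseteq> T" "lev T1 h = lev T h" "\<forall>Z\<in>F. R c h (cone T1 Z)" by auto
    have Z: "Z \<subseteq> lev T1 h" "Z \<noteq> {}" using insert T1 by auto
    note cZ = cone_perfect[OF T1(1) Z(1)]
    have "cone T1 Z \<noteq> {}" using cZ(2) Z(2) by auto
    then obtain S where S: "perfect S" "S \<subseteq> cone T1 Z" "lev S h = Z" "R c h S"
      using dense[OF cZ(1)] cone_subset T1(2) cZ(2) by (metis order_trans)
    obtain T' where T': "perfect T'" "T' \<subseteq> T1" "lev T' h = lev T1 h" "cone T' Z \<subseteq> S"
      using replace_cone[OF T1(1) Z(1) S(1) _ S(3)] S(2) cone_subset by (metis order_trans)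
    have her: "R c h (cone T' Y)" if "R c h S'" "cone T' Y \<subseteq> S'" "lev S' h = Y" "Y \<subseteq> lev T h" for Y S'
      using R that cone_perfect[OF T'(1), of Y h] T'(3) T1(3) unfolding hereditary_def by metis
    have "R c h (cone T' Y)" if Y: "Y \<in> insert Z F" for Y
    proof (cases "Y = Z")
      case True then show ?thesis using her[OF S(4), of Z] T'(4) S(3) insert.prems by auto
    next
      case False
      then have Y: "Y \<in> F" using Y by simp
      then have "Y \<subseteq> lev T h" using insert.prems by blast
      then show ?thesis using her[of "cone T1 Y" Y] T1 Y cone_mono[OF T'(2), of Y Y] cone_perfect(2)[OF T1(1), of Y h] by auto
    qed
    then show ?case using T' T1 by (intro exI[of _ T']) auto
  qed
  note * = this
  have "finite {Z. Z \<subseteq> lev T h \<and> Z \<noteq> {}}"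
    by (rule finite_subset[of _ "Pow (lev T h)"]) (use finite_lev[of T h] in \<open>simp_all add: Collect_mono_iff Pow_def\<close>)
  moreover have "\<forall>Z\<in>{Z. Z \<subseteq> lev T h \<and> Z \<noteq> {}}. Z \<subseteq> lev T h \<and> Z \<noteq> {}" by simp
  ultimately have "\<exists>T'. perfect T' \<and> T' \<subseteq> T \<and> lev T' h = lev T h \<and> (\<forall>Z\<in>{Z. Z \<subseteq> lev T h \<and> Z \<noteq> {}}. R c h (cone T' Z))"
    by (rule *)
  then show ?thesis unfolding Ball_def mem_Collect_eq imp_conjL .
qed

definition window :: "node set \<Rightarrow> nat \<Rightarrow> nat \<Rightarrow> node set" where
  "window T h h' = {r \<in> Split T. h \<le> length r \<and> length r < h'}"

text \<open>A single splitting node is kept above the leaf that goodness prescribes, and every other leaf is prolonged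
without splitting.\<close>

lemma split_one:
  assumes T: "perfect T" "T \<noteq> {}"
  obtains T' h' k s where "perfect T'" "T' \<subseteq> T" "lev T' h = lev T h" "h < h'" "next_leaf T h k" "prefix k s"
    "window T' h h' = {s}" "card (lev T' h') = Suc (card (lev T h))"
proof -
  obtain k where k: "next_leaf T h k" using next_leaf_exists lev_nonempty[OF T] by blast
  then have kl: "k \<in> lev T h" by (simp add: next_leaf_def)
  obtain s where s: "s \<in> Split T" "prefix k s" using perfect_split[OF T(1), of k] kl by auto
  define h' where "h' = Suc (length s)"
  have hs: "h \<le> length s" using prefix_length_le[OF s(2)] kl by simp
  have "\<exists>y. y \<in> lev T h' \<and> prefix x y" if "x \<in> lev T h" for x
    using perfect_ext[OF T(1), of x h'] that hs unfolding h'_def by auto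
  then obtain y where y: "\<And>x. x \<in> lev T h \<Longrightarrow> y x \<in> lev T h'" "\<And>x. x \<in> lev T h \<Longrightarrow> prefix x (y x)" by metis
  define X where "X = y ` (lev T h - {k}) \<union> {s @ [False], s @ [True]}"
  have X: "X \<subseteq> lev T h'" using y s(1) by (auto simp: X_def h'_def Split_iff)
  define T' where "T' = cone T X"
  have pT': "perfect T'" and lX: "lev T' h' = X" unfolding T'_def using cone_perfect[OF T(1) X] by auto
  have ty: "take h (y x) = x" if "x \<in> lev T h" for x using y(2)[OF that] that by (auto intro: prefix_take_eq)
  have ts: "take h (s @ [b]) = k" for b 
  proof (rule prefix_take_eq)
    show "prefix k (s @ [b])" using s(2) by simp
  qed (use kl in simp)
  have lh: "lev T' h = lev T h"
  proof (intro equalityI subsetI)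
    fix x assume x: "x \<in> lev T h"
    have "\<exists>u\<in>X. prefix x u"
    proof (cases "x = k")
      case True then show ?thesis using s(2) by (auto simp: X_def)
    next
      case False
      then have "y x \<in> X" using x by (simp add: X_def)
      then show ?thesis using x y(2) by blast
    qed
    then show "x \<in> lev T' h" using x unfolding T'_def cone_def by auto
  qed (auto simp: T'_def cone_def)
  have "window T' h h' = {s}"
  proof (intro equalityI subsetI)
    fix r assume "r \<in> window T' h h'"
    then have r: "r \<in> Split T'" "h \<le> length r" "length r < h'" by (auto simp: window_def)
    have ex: "\<exists>u\<in>X. prefix (r @ [b]) u" for b
    proof -
      have "r @ [b] \<in> T'" using r(1) by (cases b) (auto simp: Split_iff)
      then show ?thesis using perfect_ext[OF pT', of "r @ [b]" h'] r(3) lX by auto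
    qed
    obtain u v where u: "u \<in> X" "prefix (r @ [False]) u" and v: "v \<in> X" "prefix (r @ [True]) v" using ex by blast
    have "take h u = take h r" "take h v = take h r" using u(2) v(2) r(2) by (auto simp: prefix_def)
    moreover have "u \<noteq> v" using u v diverge_not_prefix(3)[of r False u v] by auto
    ultimately have "{u, v} = {s @ [False], s @ [True]}"
      using u(1) v(1) ty ts unfolding X_def by (auto; force)
    then have "r = s" using u(2) v(2) \<open>u \<noteq> v\<close> diverge_not_prefix(3)[of r False s s] by (auto simp: doubleton_eq_iff)
    then show "r \<in> {s}" by simp
  next
    fix r assume "r \<in> {s}"
    moreover have "s @ [b] \<in> T'" for b using lX X_def by (cases b) auto
    then have "s \<in> Split T'" using perfect_prefix[OF pT', of "s @ [False]" s] by (auto simp: Split_iff)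
    ultimately show "r \<in> window T' h h'" using hs by (auto simp: window_def h'_def)
  qed
  moreover have "card X = Suc (card (lev T h))"
  proof -
    have "inj_on y (lev T h - {k})" by (rule inj_onI) (metis Diff_iff ty)
    then have "card (y ` (lev T h - {k})) = card (lev T h) - 1"
      using card_Diff_singleton[OF kl] by (simp only: card_image)
    moreover have "y ` (lev T h - {k}) \<inter> {s @ [False], s @ [True]} = {}" using ty ts by fastforce
    moreover have "card (lev T h) > 0" using kl finite_lev card_gt_0_iff by blast
    ultimately show ?thesis unfolding X_def by (subst card_Un_disjoint) (auto simp: finite_lev)
  qed
  ultimately show ?thesis
    using that[of T' h' k s] pT' lh lX k s hs by (simp add: T'_def cone_subset h'_def)
qed

lemma code_no_split:
  assumes "prefix x y" "\<And>s. s \<in> Split T \<Longrightarrow> prefix x s \<Longrightarrow> \<not> strict_prefix s y"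
  shows "code T y = code T x"
proof -
  have "code T (x @ r) = code T x" if "\<And>s. s \<in> Split T \<Longrightarrow> prefix x s \<Longrightarrow> \<not> strict_prefix s (x @ r)" for r
    using that
  proof (induction r rule: rev_induct)
    case (snoc b r)
    have "code T (x @ r) = code T x"
    proof (rule snoc.IH)
      fix s assume "s \<in> Split T" "prefix x s"
      then show "\<not> strict_prefix s (x @ r)" using snoc.prems[of s] by (auto simp: strict_prefix_def prefix_def)
    qed
    moreover have "x @ r \<notin> Split T" using snoc.prems[of "x @ r"] by (auto simp: strict_prefix_def)
    ultimately show ?case by (simp add: code_snoc flip: append_assoc)
  qed simp
  then show ?thesis using assms by (auto simp: prefix_def)
qed

definition windowed :: "node set \<Rightarrow> (nat \<Rightarrow> nat) \<Rightarrow> bool" where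
  "windowed T hs \<longleftrightarrow> strict_mono hs \<and> (\<forall>a. \<exists>k s. next_leaf T (hs a) k \<and> prefix k s \<and> window T (hs a) (hs (Suc a)) = {s})"

text \<open>The limit is perfect because splitting at the leaf of least rank is fair: if nothing split above a node \<open>x\<close>
of the limit, its rank would bound the ranks of all later splitting nodes, but there are only finitely many
nodes of bounded rank since \<open>code\<close> is injective on splitting nodes.\<close>

lemma fusion:
  assumes R: "hereditary R" and T0: "perfect T0" "T0 \<noteq> {}"
    and dense: "\<And>c h S. perfect S \<Longrightarrow> S \<noteq> {} \<Longrightarrow> S \<subseteq> T0 \<Longrightarrow>
        \<exists>S'. perfect S' \<and> S' \<subseteq> S \<and> lev S' h = lev S h \<and> R c h S'"
  obtains T hs where "perfect T" "T \<subseteq> T0" "hs 0 = m" "lev T m = lev T0 m" "windowed T hs"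
    "\<And>a. card (lev T (hs a)) = card (lev T0 m) + a"
    "\<And>a Z. Z \<subseteq> lev T (hs a) \<Longrightarrow> Z \<noteq> {} \<Longrightarrow> R (card (lev T0 m) + a) (hs a) (cone T Z)"
proof -
  let ?N = "card (lev T0 m)"
  define P where "P = (\<lambda>n st. perfect (fst st) \<and> fst st \<noteq> {} \<and> fst st \<subseteq> T0 \<and> card (lev (fst st) (snd st)) = ?N + n
    \<and> (n = 0 \<longrightarrow> st = (T0, m)))"
  define Q where "Q = (\<lambda>n st st'. fst st' \<subseteq> fst st \<and> snd st < snd st' \<and> lev (fst st') (snd st) = lev (fst st) (snd st)
    \<and> (\<exists>k s. next_leaf (fst st) (snd st) k \<and> prefix k s \<and> window (fst st') (snd st) (snd st') = {s})
    \<and> (\<forall>Z. Z \<subseteq> lev (fst st) (snd st) \<longrightarrow> Z \<noteq> {} \<longrightarrow> R (?N + n) (snd st) (cone (fst st') Z)))"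
  have "\<exists>f. \<forall>n. P n (f n) \<and> Q n (f n) (f (Suc n))"
  proof (rule dependent_nat_choice)
    show "\<exists>st. P 0 st" using T0 by (intro exI[of _ "(T0, m)"]) (simp add: P_def)
    fix st n assume Pn: "P n st"
    obtain T h where st: "st = (T, h)" by (cases st)
    have T: "perfect T" "T \<noteq> {}" "T \<subseteq> T0" "card (lev T h) = ?N + n" using Pn by (auto simp: P_def st)
    obtain T1 where T1: "perfect T1" "T1 \<subseteq> T" "lev T1 h = lev T h"
      "\<forall>Z. Z \<subseteq> lev T h \<longrightarrow> Z \<noteq> {} \<longrightarrow> R (?N + n) h (cone T1 Z)"
    proof -
      have d: "\<exists>S'. perfect S' \<and> S' \<subseteq> S \<and> lev S' h = lev S h \<and> R (?N + n) h S'"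
        if "perfect S" "S \<noteq> {}" "S \<subseteq> T" for S
        by (rule dense) (use that T(3) in auto)
      show ?thesis using thin_all_cones[OF R T(1), of h "?N + n", OF d] that by blast
    qed
    have ne: "T1 \<noteq> {}" using lev_nonempty[OF T(1,2), of h] T1(3) by auto
    obtain T' h' k s where T': "perfect T'" "T' \<subseteq> T1" "lev T' h = lev T1 h" "h < h'" "next_leaf T1 h k" "prefix k s"
      "window T' h h' = {s}" "card (lev T' h') = Suc (card (lev T1 h))"
      using split_one[OF T1(1) ne] by metis
    have "T' \<noteq> {}" using lev_nonempty[OF T(1,2), of h] T1(3) T'(3) by auto
    then have "P (Suc n) (T', h')" using T' T1 T by (auto simp: P_def)
    moreover have "Q n st (T', h')" unfolding Q_def st fst_conv snd_conv
    proof (intro conjI allI impI)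
      show "T' \<subseteq> T" "h < h'" "lev T' h = lev T h" using T' T1 by auto
      show "\<exists>k s. next_leaf T h k \<and> prefix k s \<and> window T' h h' = {s}"
        using T' next_leaf_cong[OF T1(1) T(1) T1(3)] by blast
      fix Z assume Z: "Z \<subseteq> lev T h" "Z \<noteq> {}"
      have "lev (cone T' Z) h = lev (cone T1 Z) h"
        using cone_perfect(2)[OF T'(1), of Z h] cone_perfect(2)[OF T1(1), of Z h] Z T'(3) T1(3) by simp
      then show "R (?N + n) h (cone T' Z)"
        using R T1(4) Z cone_perfect(1)[OF T'(1), of Z h] T'(3) T1(3) cone_mono[OF T'(2), of Z Z] unfolding hereditary_def
        by (metis order_refl)
    qed
    ultimately show "\<exists>st'. P (Suc n) st' \<and> Q n st st'" by blast
  qed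
  then obtain f where f: "\<And>n. P n (f n)" "\<And>n. Q n (f n) (f (Suc n))" by blast
  define Ts where "Ts = (\<lambda>n. fst (f n))"
  define hs where "hs = (\<lambda>n. snd (f n))"
  have p: "perfect (Ts n)" "Ts n \<noteq> {}" "Ts n \<subseteq> T0" "card (lev (Ts n) (hs n)) = ?N + n" for n
    using f(1)[of n] by (auto simp: P_def Ts_def hs_def)
  have 0: "Ts 0 = T0" "hs 0 = m" using f(1)[of 0] by (auto simp: P_def Ts_def hs_def)
  have dec: "Ts (Suc n) \<subseteq> Ts n" and inc: "hs n < hs (Suc n)" and lv: "lev (Ts (Suc n)) (hs n) = lev (Ts n) (hs n)"
    and wn: "\<exists>k s. next_leaf (Ts n) (hs n) k \<and> prefix k s \<and> window (Ts (Suc n)) (hs n) (hs (Suc n)) = {s}"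
    and RR: "\<And>Z. Z \<subseteq> lev (Ts n) (hs n) \<Longrightarrow> Z \<noteq> {} \<Longrightarrow> R (?N + n) (hs n) (cone (Ts (Suc n)) Z)" for n
    using f(2)[of n] by (auto simp: Q_def Ts_def hs_def)
  have mono: "strict_mono hs" using inc by (simp add: strict_mono_Suc_iff)
  have hn: "n \<le> hs n" for n using mono by (rule strict_mono_imp_increasing)
  define L where "L = (\<Inter>n. Ts n)"
  have decr: "Ts (n + d) \<subseteq> Ts n" for n d by (induction d) (use dec in auto)
  have stay: "t \<in> Ts n \<longleftrightarrow> t \<in> Ts (n + d)" if "length t \<le> hs n" for t n d
  proof (induction d)
    case (Suc d)
    have "hs n \<le> hs (n + d)" using mono by (simp add: strict_mono_less_eq)
    then have "t \<in> Ts (Suc (n + d)) \<longleftrightarrow> t \<in> Ts (n + d)"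
      using below_cong[OF p(1) p(1) lv] that by simp
    then show ?case using Suc by simp
  qed simp
  have inL: "t \<in> L \<longleftrightarrow> t \<in> Ts n" if "length t \<le> hs n" for t n
  proof
    assume t: "t \<in> Ts n"
    have "t \<in> Ts k" for k
    proof (cases "n \<le> k")
      case True then show ?thesis using stay[OF that, of "k - n"] t by simp
    next
      case False then show ?thesis using decr[of k "n - k"] t by auto
    qed
    then show "t \<in> L" by (simp add: L_def)
  qed (simp add: L_def)
  have splitL: "t \<in> Split L \<longleftrightarrow> t \<in> Split (Ts n)" if "length t < hs n" for t n
    using inL[of _ n] that by (simp add: Split_iff)
  have levL: "lev L (hs n) = lev (Ts n) (hs n)" for n using inL[of _ n] by auto
  have winL: "window L (hs n) (hs (Suc n)) = window (Ts (Suc n)) (hs n) (hs (Suc n))" for n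
    using splitL[of _ "Suc n"] by (auto simp: window_def)
  have codeL: "code L t = code (Ts n) t" if "length t \<le> hs n" for t n
  proof (rule code_cong)
    fix r assume "strict_prefix r t"
    then have "length r < hs n" using that prefix_length_less by fastforce
    then show "r \<in> Split L \<longleftrightarrow> r \<in> Split (Ts n)" using splitL by blast
  qed
  have treeL: "is_tree L" using perfect_tree[OF p(1)] unfolding L_def is_tree_def by blast
  have split_above: "\<exists>s\<in>Split L. prefix x s" if x: "x \<in> lev L (hs n)" for x n
  proof (rule ccontr)
    assume no: "\<not> ?thesis"
    obtain ks ss where ks: "\<And>b. next_leaf (Ts b) (hs b) (ks b)" "\<And>b. prefix (ks b) (ss b)"
      "\<And>b. window (Ts (Suc b)) (hs b) (hs (Suc b)) = {ss b}" using wn by metis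
    have ssL: "ss b \<in> Split L \<and> hs b \<le> length (ss b) \<and> length (ss b) < hs (Suc b)" for b
      using ks(3)[of b] winL[of b] by (auto simp: window_def)
    have "length (code L (ss b)) \<le> length (code L x)" if "n \<le> b" for b
    proof -
      have hb: "hs n \<le> hs b" using mono that by (simp add: strict_mono_less_eq)
      have "x \<in> Ts b" using x by (auto simp: L_def)
      then obtain y where y: "y \<in> lev (Ts b) (hs b)" "prefix x y" using perfect_ext[OF p(1)] x hb by (metis lev_iff)
      have "code L y = code L x" using code_no_split[OF y(2)] no by blast
      moreover have "code L (ss b) = code L (ks b)"
      proof (rule code_no_split[OF ks(2)], rule notI)
        fix r assume r: "r \<in> Split L" "prefix (ks b) r" "strict_prefix r (ss b)"
        have "hs b \<le> length r" using ks(1)[of b] prefix_length_le[OF r(2)] by (simp add: next_leaf_def)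
        moreover have "length r < length (ss b)" using r(3) prefix_length_less by blast
        ultimately have "r \<in> window L (hs b) (hs (Suc b))" using r(1) ssL[of b] by (simp add: window_def)
        then show False using ks(3)[of b] winL[of b] r(3) by simp
      qed
      moreover have "length (code (Ts b) (ks b)) \<le> length (code (Ts b) y)"
      proof -
        have "length (code (Ts b) (ks b)) < length (code (Ts b) y) \<or> length (code (Ts b) (ks b)) = length (code (Ts b) y)"
          using ks(1)[of b] y(1) unfolding next_leaf_def by blast
        then show ?thesis by linarith
      qed
      moreover have "code L y = code (Ts b) y" "code L (ks b) = code (Ts b) (ks b)"
        using codeL[of _ b] y(1) ks(1)[of b] by (auto simp: next_leaf_def)
      ultimately show ?thesis by simp
    qed
    then have sub: "ss ` {n..} \<subseteq> {s \<in> Split L. length (code L s) \<le> length (code L x)}" using ssL by auto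
    have "inj_on (code L) {s \<in> Split L. length (code L s) \<le> length (code L x)}"
      using code_iso(3)[OF treeL] by (auto simp: inj_on_def)
    moreover have "finite (code L ` {s \<in> Split L. length (code L s) \<le> length (code L x)})"
      by (rule finite_subset[OF _ finite_lists_length_le[of "UNIV :: bool set" "length (code L x)"]]) auto
    ultimately have "finite (ss ` {n..})" using sub finite_imageD finite_subset by blast
    moreover have "inj ss"
    proof (rule injI, rule ccontr)
      fix a b assume "ss a = ss b" "a \<noteq> b"
      moreover have False if "a < b" "ss a = ss b" for a b
      proof -
        have "hs (Suc a) \<le> hs b" using mono that(1) by (simp add: strict_mono_less_eq)
        then show False using ssL[of a] ssL[of b] that(2) by simp
      qed
      ultimately show False by (metis nat_neq_iff)
    qed
    ultimately show False using finite_imageD[of ss "{n..}"] inj_on_subset[of ss UNIV "{n..}"] infinite_Ici[of n] by blast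
  qed
  have perfL: "perfect L" unfolding perfect_def
  proof (intro conjI ballI treeL)
    fix t assume t: "t \<in> L"
    define n where "n = length t"
    have "t \<in> Ts n" "length t \<le> hs n" using t hn by (auto simp: L_def n_def)
    then obtain x where x: "x \<in> lev (Ts n) (hs n)" "prefix t x" using perfect_ext[OF p(1)] by blast
    then obtain s where "s \<in> Split L" "prefix x s" using split_above[of x n] levL by blast
    then show "\<exists>s\<in>Split L. prefix t s" using x prefix_order.trans by blast
  qed
  show ?thesis
  proof (rule that[of L hs])
    show "perfect L" by fact
    show "L \<subseteq> T0" using p(3)[of 0] by (auto simp: L_def)
    show "hs 0 = m" "lev L m = lev T0 m" using 0 levL[of 0] by auto
    show "windowed L hs" unfolding windowed_def
    proof (intro conjI allI mono)
      fix a
      show "\<exists>k s. next_leaf L (hs a) k \<and> prefix k s \<and> window L (hs a) (hs (Suc a)) = {s}"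
        using wn[of a] winL[of a] next_leaf_cong[OF perfL p(1) levL] by auto
    qed
    show "card (lev L (hs a)) = ?N + a" for a using levL p(4) by simp
    fix a Z assume Z: "Z \<subseteq> lev L (hs a)" "Z \<noteq> {}"
    have "lev (cone L Z) (hs a) = Z" "perfect (cone L Z)" using cone_perfect[OF perfL Z(1)] by auto
    moreover have "lev (cone (Ts (Suc a)) Z) (hs a) = Z" using cone_perfect(2)[OF p(1), of Z "Suc a" "hs a"] Z levL lv by simp
    moreover have "cone L Z \<subseteq> cone (Ts (Suc a)) Z" by (rule cone_mono) (auto simp: L_def)
    ultimately show "R (?N + a) (hs a) (cone L Z)" using R RR[of Z a] Z levL unfolding hereditary_def by metis
  qed
qed


lemma lex_le_ext:
  assumes "length k = length x" "k \<noteq> x" "prefix k t" "prefix x s"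
  shows "lex_le t s \<longleftrightarrow> lex_le k x" "lex_le s t \<longleftrightarrow> \<not> lex_le k x"
proof -
  have "\<not> prefix k x" "\<not> prefix x k" using assms(1,2) prefix_same_length[of k x] prefix_same_length[of x k] by auto
  then obtain as b bs c cs where "b \<noteq> c" "k = as @ b # bs" "x = as @ c # cs"
    using parallel_decomp[of k x] by blast
  then have "prefix (as @ [b]) k" "prefix (as @ [\<not> b]) x" by auto
  moreover from this have "prefix (as @ [b]) t" "prefix (as @ [\<not> b]) s" using assms prefix_order.trans by blast+
  moreover from this have "prefix (as @ [\<not> b]) s" "prefix (as @ [\<not> \<not> b]) t" by simp_all
  ultimately show "lex_le t s \<longleftrightarrow> lex_le k x" "lex_le s t \<longleftrightarrow> \<not> lex_le k x"
    using lex_le_diverge[of as b k x] lex_le_diverge[of as b t s] lex_le_diverge[of as "\<not> b" s t] by simp_all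
qed

text \<open>If the next splitting always happens above the leaf of least rank then splitting nodes appear in the
prescribed order. For nodes below the first level the order is inherited from a good tree \<open>U\<close> with the same
first level.\<close>

lemma level_good_windowed:
  assumes L: "perfect L" "windowed L hs" and U: "perfect U" "level_good U" and lv: "lev L (hs 0) = lev U (hs 0)"
  shows "level_good L"
  unfolding level_good_def
proof (intro ballI impI, rule ccontr)
  fix s t assume s: "s \<in> Split L" and t: "t \<in> Split L"
    and le: "length (code L s) < length (code L t) \<or> (length (code L s) = length (code L t) \<and> lex_le s t)"
    and "\<not> length s \<le> length t"
  then have lt: "length t < length s" by simp
  have mono: "strict_mono hs" using L(2) by (simp add: windowed_def)
  have codele: "length (code L x) \<le> length (code L s)" if "prefix x s" for x
    using code_prefix[OF that] prefix_length_le by blast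
  have sL: "s \<in> L" using s by (simp add: Split_iff)
  show False
  proof (cases "hs 0 \<le> length t")
    case True
    define a where "a = (GREATEST a. hs a \<le> length t)"
    have bd: "\<forall>y. hs y \<le> length t \<longrightarrow> y \<le> length t" using strict_mono_imp_increasing[OF mono] order_trans by blast
    have ha: "hs a \<le> length t" unfolding a_def by (rule GreatestI_nat[where P = "\<lambda>a. hs a \<le> length t", OF True]) (use bd in blast)
    have hsa: "length t < hs (Suc a)"
    proof (rule ccontr)
      assume "\<not> length t < hs (Suc a)"
      then have "Suc a \<le> a" unfolding a_def by (intro Greatest_le_nat[where P = "\<lambda>a. hs a \<le> length t"]) (use bd in auto)
      then show False by simp
    qed
    obtain k s0 where k: "next_leaf L (hs a) k" "prefix k s0" "window L (hs a) (hs (Suc a)) = {s0}"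
      using L(2) unfolding windowed_def by blast
    have "t \<in> window L (hs a) (hs (Suc a))" using t ha hsa by (simp add: window_def)
    then have kt: "prefix k t" and win: "window L (hs a) (hs (Suc a)) = {t}" using k by auto
    have kl: "k \<in> L" "length k = hs a" using k(1) by (auto simp: next_leaf_def)
    have ck: "code L t = code L k"
    proof (rule code_no_split[OF kt], rule notI)
      fix r assume r: "r \<in> Split L" "prefix k r" "strict_prefix r t"
      then have "r \<in> window L (hs a) (hs (Suc a))"
        using kl(2) hsa prefix_length_le[OF r(2)] prefix_length_less[OF r(3)] by (simp add: window_def)
      then show False using win r(3) by simp
    qed
    define x where "x = take (hs a) s"
    have x: "x \<in> lev L (hs a)" "prefix x s" using perfect_take[OF L(1) sL] lt ha by (auto simp: x_def take_is_prefix)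
    show False
    proof (cases "x = k")
      case True
      obtain s1 where s1: "s1 \<in> Split L" "prefix k s1" "\<And>r. r \<in> Split L \<Longrightarrow> prefix k r \<Longrightarrow> prefix s1 r"
        using next_split[OF L(1) kl(1)] by metis
      have "s1 \<in> window L (hs a) (hs (Suc a))"
        using s1(1) kl(2) prefix_length_le[OF s1(2)] prefix_length_le[OF s1(3)[OF t kt]] hsa by (simp add: window_def)
      then have "s1 = t" using win by simp
      then have "strict_prefix t s" using s1(3)[OF s] x(2) True lt by (auto simp: strict_prefix_def)
      then obtain b where "prefix (code L t @ [b]) (code L s)" using code_strict[OF t] by metis
      then show False using le prefix_length_le by fastforce
    next
      case False
      have "length (code L k) < length (code L x) \<or> length (code L k) = length (code L x) \<and> lex_le k x"
        using k(1) x(1) unfolding next_leaf_def by blast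
      moreover have "lex_le s t \<longleftrightarrow> \<not> lex_le k x" using lex_le_ext(2)[OF _ _ kt x(2)] False x(1) kl(2) by auto
      ultimately show False using codele[OF x(2)] le ck by auto
    qed
  next
    case False
    then have t0: "length t < hs 0" by simp
    note cc = code_cong_lev[OF L(1) U(1) lv]
    have tU: "t \<in> Split U" using t Split_cong[OF L(1) U(1) lv t0] by simp
    have ct: "code L t = code U t" using cc t0 by simp
    show False
    proof (cases "length s < hs 0")
      case True
      then have "s \<in> Split U" "code L s = code U s" using s Split_cong[OF L(1) U(1) lv True] cc by auto
      then show False using U(2) tU ct le lt unfolding level_good_def by fastforce
    next
      case False
      define x where "x = take (hs 0) s"
      have x: "x \<in> lev L (hs 0)" "prefix x s" using perfect_take[OF L(1) sL] False by (auto simp: x_def take_is_prefix)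
      then have xU: "x \<in> U" "length x = hs 0" using lv by auto
      obtain s' where s': "s' \<in> Split U" "prefix x s'" "code U s' = code U x" using next_split[OF U(1) xU(1)] by metis
      have cx: "code L x = code U x" using cc xU(2) by simp
      have "length t < length s'" using prefix_length_le[OF s'(2)] xU(2) t0 by simp
      then have n: "\<not> (length (code U s') < length (code U t) \<or> (length (code U s') = length (code U t) \<and> lex_le s' t))"
        using U(2) s'(1) tU unfolding level_good_def by fastforce
      then have eq: "length (code L s) = length (code L t)" "lex_le s t" "length (code U x) = length (code U t)"
        using le codele[OF x(2)] cx ct s'(3) by auto
      have "\<not> prefix t x"
      proof
        assume "prefix t x"
        then have "strict_prefix t x" using xU(2) t0 by (auto simp: strict_prefix_def)
        then obtain b where "prefix (code U t @ [b]) (code U x)" using code_strict[OF tU] by metis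
        then show False using eq(3) prefix_length_le by fastforce
      qed
      moreover have "\<not> prefix x t" using prefix_length_le[of x t] xU(2) t0 by auto
      ultimately obtain c b where c: "prefix (c @ [b]) x" "prefix (c @ [\<not> b]) t"
        using tree_diverge[OF perfect_tree[OF U(1)] xU(1), of t] tU by (metis Split_iff)
      have "lex_le s t \<longleftrightarrow> \<not> b" using lex_le_diverge[of c b s t] c x(2) prefix_order.trans by blast
      moreover have "lex_le s' t \<longleftrightarrow> \<not> b" using lex_le_diverge[of c b s' t] c s'(2) prefix_order.trans by blast
      ultimately show False using eq n s'(3) by simp
    qed
  qed
qed

lemma first_split:
  assumes R: "perfect R" "level_good R" and k: "next_leaf R h k"
  obtains s where "s \<in> Split R" "prefix k s" "\<And>t. t \<in> Split R \<Longrightarrow> h \<le> length t \<Longrightarrow> length s \<le> length t"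
proof -
  have kl: "k \<in> R" "length k = h" using k by (auto simp: next_leaf_def)
  obtain s where s: "s \<in> Split R" "prefix k s" "code R s = code R k" "\<And>r. r \<in> Split R \<Longrightarrow> prefix k r \<Longrightarrow> prefix s r"
    using next_split[OF R(1) kl(1)] by metis
  have "length s \<le> length t" if t: "t \<in> Split R" "h \<le> length t" for t
  proof -
    define x where "x = take h t"
    have x: "x \<in> lev R h" "prefix x t" using perfect_take[OF R(1), of t h] t by (auto simp: x_def take_is_prefix Split_iff)
    show ?thesis
    proof (cases "x = k")
      case True then show ?thesis using s(4)[OF t(1)] x(2) prefix_length_le by blast
    next
      case False
      have 1: "length (code R k) < length (code R x) \<or> length (code R k) = length (code R x) \<and> lex_le k x"
        using k x(1) unfolding next_leaf_def by blast
      have 2: "lex_le s t \<longleftrightarrow> lex_le k x" using lex_le_ext(1)[OF _ _ s(2) x(2)] False x(1) kl(2) by auto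
      have 3: "length (code R x) \<le> length (code R t)" using code_prefix[OF x(2)] prefix_length_le by blast
      have "length (code R s) < length (code R t) \<or> length (code R s) = length (code R t) \<and> lex_le s t"
        using 1 2 3 s(3) by auto
      then show ?thesis using R(2) s(1) t(1) unfolding level_good_def by blast
    qed
  qed
  then show ?thesis using that s by blast
qed

section \<open>Acceptance of a value, and coded subtrees\<close>

definition good_perfect :: "node set \<Rightarrow> bool" where
  "good_perfect R \<longleftrightarrow> perfect R \<and> R \<noteq> {} \<and> level_good R"

text \<open>For \<open>D h R\<close> meaning that the condition given by \<open>h\<close> and \<open>R\<close> forces a statement, this says that the pair
\<open>h\<close>, \<open>S\<close> forces it, where \<open>S\<close> need only be perfect. For a level that no good tree has, it holds vacuously.\<close>

definition accepts :: "(nat \<Rightarrow> node set \<Rightarrow> bool) \<Rightarrow> nat \<Rightarrow> node set \<Rightarrow> bool" where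
  "accepts D h S \<longleftrightarrow> (\<forall>R h'. good_perfect R \<longrightarrow> R \<subseteq> S \<longrightarrow> lev R h = lev S h \<longrightarrow> h \<le> h' \<longrightarrow>
     (\<exists>R' h''. good_perfect R' \<and> R' \<subseteq> R \<and> h' \<le> h'' \<and> lev R' h' = lev R h' \<and> D h'' R'))"

text \<open>No shrinking that keeps level \<open>n\<close> accepts any of the alternatives.\<close>

definition undecided :: "'i set \<Rightarrow> ('i \<Rightarrow> nat \<Rightarrow> node set \<Rightarrow> bool) \<Rightarrow> nat \<Rightarrow> node set \<Rightarrow> bool" where
  "undecided I D n R \<longleftrightarrow> (\<forall>S. perfect S \<longrightarrow> S \<subseteq> R \<longrightarrow> lev S n = lev R n \<longrightarrow> (\<forall>i\<in>I. \<not> accepts (D i) n S))"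

lemma accepts_subset: "accepts D h S \<Longrightarrow> S' \<subseteq> S \<Longrightarrow> lev S' h = lev S h \<Longrightarrow> accepts D h S'"
  unfolding accepts_def by (metis subset_trans)

lemma accepts_up:
  assumes "accepts D h S" "perfect S" "h \<le> h2" shows "accepts D h2 S"
  unfolding accepts_def
proof (intro allI impI)
  fix R h' assume R: "good_perfect R" "R \<subseteq> S" "lev R h2 = lev S h2" "h2 \<le> h'"
  have "lev R h = lev S h" using lev_cong_le[of R S h2 h] R assms by (simp add: good_perfect_def)
  then show "\<exists>R' h''. good_perfect R' \<and> R' \<subseteq> R \<and> h' \<le> h'' \<and> lev R' h' = lev R h' \<and> D h'' R'"
    using assms(1,3) R unfolding accepts_def by (meson order_trans)
qed

text \<open>Between levels without splitting nothing can be removed, so acceptance and undecidedness pass up and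
down between such levels.\<close>

lemma lev_no_split:
  assumes S: "perfect S" and R: "perfect R" "R \<subseteq> S" "lev R h = lev S h" and w: "window S h h2 = {}" "h \<le> h2"
  shows "lev R h2 = lev S h2"
proof
  show "lev R h2 \<subseteq> lev S h2" using R(2) lev_mono by blast
  show "lev S h2 \<subseteq> lev R h2"
  proof
    fix y assume y: "y \<in> lev S h2"
    then have "take h y \<in> lev S h" using w(2) perfect_take[OF S] by auto
    then have "take h y \<in> lev R h" using R(3) by simp
    then have "take h y \<in> R" "length (take h y) = h" by auto
    then obtain z where z: "z \<in> lev R h2" "prefix (take h y) z" using perfect_ext[OF R(1)] w(2) by metis
    have "y = z"
    proof (rule ccontr)
      assume "y \<noteq> z"
      then have np: "\<not> prefix y z" "\<not> prefix z y" using y z prefix_same_length[of y z] prefix_same_length[of z y] by auto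
      have "y \<in> S" "z \<in> S" using y z R(2) by auto
      then obtain c b where c: "c \<in> Split S" "prefix (c @ [b]) y" "prefix (c @ [\<not> b]) z"
        using tree_diverge[OF perfect_tree[OF S] _ _ np] by metis
      have "length c < h2" using prefix_length_le[OF c(2)] y by simp
      then have "\<not> h \<le> length c" using c(1) w(1) by (auto simp: window_def)
      then have "length c < h" by simp
      then have "prefix (c @ [b]) (take h y)" using c(2) \<open>length (take h y) = h\<close>
        by (metis Suc_leI length_append_singleton prefix_length_prefix take_is_prefix)
      then have "prefix (c @ [b]) z" using z(2) prefix_order.trans by blast
      then show False using diverge_not_prefix(3)[OF _ c(3)] by blast
    qed
    then show "y \<in> lev R h2" using z by simp
  qed
qed

lemma accepts_down:
  assumes a: "accepts D h2 S" and S: "perfect S" and h: "h \<le> h2" and w: "window S h h2 = {}"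
  shows "accepts D h S"
  unfolding accepts_def
proof (intro allI impI)
  fix R h' assume R: "good_perfect R" "R \<subseteq> S" "lev R h = lev S h" "h \<le> h'"
  have pR: "perfect R" using R by (simp add: good_perfect_def)
  have "lev R h2 = lev S h2" using lev_no_split[OF S pR R(2,3) w h] .
  then obtain R' h'' where R': "good_perfect R'" "R' \<subseteq> R" "max h' h2 \<le> h''" "lev R' (max h' h2) = lev R (max h' h2)" "D h'' R'"
    using a R unfolding accepts_def by (meson max.cobounded2)
  have "lev R' h' = lev R h'"
    using lev_cong_le[OF _ pR R'(4), of h'] R'(1) by (simp add: good_perfect_def)
  then show "\<exists>R' h''. good_perfect R' \<and> R' \<subseteq> R \<and> h' \<le> h'' \<and> lev R' h' = lev R h' \<and> D h'' R'"
    using R' by (meson max.boundedE)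
qed

lemma undecided_subset: "undecided I D n R \<Longrightarrow> R' \<subseteq> R \<Longrightarrow> lev R' n = lev R n \<Longrightarrow> undecided I D n R'"
  unfolding undecided_def by (metis subset_trans)

lemma window_mono: "S \<subseteq> R \<Longrightarrow> window S h h' \<subseteq> window R h h'"
  using Split_mono by (auto simp: window_def)

lemma undecided_up:
  assumes u: "undecided I D n R" and R: "perfect R" and h: "n \<le> h" and w: "window R n h = {}"
  shows "undecided I D h R"
  unfolding undecided_def
proof (intro allI impI ballI notI)
  fix S i assume S: "perfect S" "S \<subseteq> R" "lev S h = lev R h" and i: "i \<in> I" "accepts (D i) h S"
  have "lev S n = lev R n" using lev_cong_le[OF S(1) R S(3) h] .
  moreover have "accepts (D i) n S" using accepts_down[OF i(2) S(1) h] window_mono[OF S(2)] w by blast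
  ultimately show False using u S i(1) unfolding undecided_def by blast
qed

lemma undecided_down:
  assumes u: "undecided I D h R" and R: "perfect R" and h: "n \<le> h" and w: "window R n h = {}"
  shows "undecided I D n R"
  unfolding undecided_def
proof (intro allI impI ballI notI)
  fix S i assume S: "perfect S" "S \<subseteq> R" "lev S n = lev R n" and i: "i \<in> I" "accepts (D i) n S"
  have "lev S h = lev R h" using lev_no_split[OF R S w h] .
  moreover have "accepts (D i) h S" using accepts_up[OF i(2) S(1) h] .
  ultimately show False using u S i(1) unfolding undecided_def by blast
qed

lemma next_leaf_unique:
  assumes "next_leaf T h k" "next_leaf T h k'" shows "k = k'"
proof (rule ccontr)
  assume ne: "k \<noteq> k'"
  have l: "k \<in> lev T h" "k' \<in> lev T h" using assms by (auto simp: next_leaf_def)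
  then have "lex_le k k'" "lex_le k' k" using assms unfolding next_leaf_def by (metis less_asym less_irrefl)+
  then show False using lex_le_ext(2)[of k k' k k'] ne l by auto
qed

text \<open>Levels \<open>g 0 < g 1 < \<dots>\<close> such that every node of level \<open>g l\<close> splits before level \<open>g (Suc l)\<close>. A list of bits
describes a walk from a node of level \<open>g 0\<close>, one bit for each level.\<close>

locale coded_tree =
  fixes T :: "node set" and g :: "nat \<Rightarrow> nat"
  assumes T: "perfect T" and g: "strict_mono g"
    and split_window: "y \<in> lev T (g l) \<Longrightarrow> \<exists>s\<in>Split T. prefix y s \<and> length s < g (Suc l)"
begin

definition branching :: "node \<Rightarrow> node" where
  "branching y = (SOME s. s \<in> Split T \<and> prefix y s \<and> (\<forall>r\<in>Split T. prefix y r \<longrightarrow> prefix s r))"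

lemma branching:
  assumes "y \<in> lev T (g l)"
  shows "branching y \<in> Split T" "prefix y (branching y)" "g l \<le> length (branching y)" "length (branching y) < g (Suc l)"
proof -
  have "\<exists>s. s \<in> Split T \<and> prefix y s \<and> (\<forall>r\<in>Split T. prefix y r \<longrightarrow> prefix s r)"
    using next_split[OF T, of y] assms by (metis lev_iff)
  then have s: "branching y \<in> Split T \<and> prefix y (branching y) \<and> (\<forall>r\<in>Split T. prefix y r \<longrightarrow> prefix (branching y) r)"
    unfolding branching_def by (rule someI_ex)
  then show "branching y \<in> Split T" "prefix y (branching y)" by auto
  then show "g l \<le> length (branching y)" using assms prefix_length_le by fastforce
  obtain r where "r \<in> Split T" "prefix y r" "length r < g (Suc l)" using split_window[OF assms] by blast
  then show "length (branching y) < g (Suc l)" using s prefix_length_le by fastforce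
qed

definition child :: "node \<Rightarrow> bool \<Rightarrow> node" where
  "child y b = (SOME z. \<exists>l. length y = g l \<and> z \<in> lev T (g (Suc l)) \<and> prefix (branching y @ [b]) z)"

lemma child:
  assumes "y \<in> lev T (g l)"
  shows "child y b \<in> lev T (g (Suc l))" "prefix (branching y @ [b]) (child y b)"
proof -
  have "branching y @ [b] \<in> T" using branching(1)[OF assms] by (cases b) (auto simp: Split_iff)
  then obtain z where "z \<in> lev T (g (Suc l))" "prefix (branching y @ [b]) z"
    using perfect_ext[OF T, of "branching y @ [b]" "g (Suc l)"] branching(4)[OF assms] by auto
  then have "\<exists>z l. length y = g l \<and> z \<in> lev T (g (Suc l)) \<and> prefix (branching y @ [b]) z" using assms by auto
  then have "\<exists>l. length y = g l \<and> child y b \<in> lev T (g (Suc l)) \<and> prefix (branching y @ [b]) (child y b)"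
    unfolding child_def by (rule someI_ex)
  then obtain l' where "length y = g l'" "child y b \<in> lev T (g (Suc l'))" "prefix (branching y @ [b]) (child y b)" by blast
  moreover from this(1) have "l' = l" using assms g by (simp add: strict_mono_eq)
  ultimately show "child y b \<in> lev T (g (Suc l))" "prefix (branching y @ [b]) (child y b)" by auto
qed

definition walk :: "node \<Rightarrow> bool list \<Rightarrow> node" where "walk x bs = foldl child x bs"

lemma walk_Nil [simp]: "walk x [] = x" and walk_snoc: "walk x (bs @ [b]) = child (walk x bs) b"
  by (simp_all add: walk_def)

lemma walk_lev: "x \<in> lev T (g 0) \<Longrightarrow> walk x bs \<in> lev T (g (length bs))"
proof (induction bs rule: rev_induct)
  case (snoc b bs)
  then have "walk x bs \<in> lev T (g (length bs))" by blast
  from child(1)[OF this, of b] show ?case by (simp add: walk_snoc)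
qed simp

lemma walk_step:
  assumes "x \<in> lev T (g 0)"
  shows "prefix (branching (walk x bs) @ [b]) (walk x (bs @ [b]))" "prefix (walk x bs) (walk x (bs @ [b]))"
proof -
  note y = walk_lev[OF assms, of bs]
  show 1: "prefix (branching (walk x bs) @ [b]) (walk x (bs @ [b]))" using child(2)[OF y] by (simp add: walk_snoc)
  have "prefix (walk x bs) (branching (walk x bs))" using branching(2)[OF y] .
  then show "prefix (walk x bs) (walk x (bs @ [b]))" using 1 by (metis prefix_order.trans prefixI)
qed

lemma walk_prefix:
  assumes "x \<in> lev T (g 0)" "prefix bs bs'" shows "prefix (walk x bs) (walk x bs')"
proof -
  have "prefix (walk x bs) (walk x (bs @ r))" for r
  proof (induction r rule: rev_induct)
    case (snoc b r)
    then show ?case using walk_step(2)[OF assms(1), of "bs @ r" b] prefix_order.trans by fastforce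
  qed simp
  then show ?thesis using assms(2) by (auto simp: prefix_def)
qed

end

lemma diverge_unique:
  assumes "prefix (c @ [b]) s" "prefix (c @ [\<not> b]) t" "prefix (d @ [e]) s" "prefix (d @ [\<not> e]) t"
  shows "c = d"
proof -
  have False if "length d < length c" "prefix (c @ [b]) s" "prefix (c @ [\<not> b]) t" "prefix (d @ [e]) s" "prefix (d @ [\<not> e]) t"
    for c d :: node and b e
  proof -
    have "prefix (d @ [e]) c" "prefix (d @ [\<not> e]) c"
      using that prefix_length_prefix[of "d @ [e]" s c] prefix_length_prefix[of "d @ [\<not> e]" t c]
      by (simp_all add: append_prefixD)
    then show False using diverge_not_prefix(3) by blast
  qed
  from this[of d c b e] this[of c d e b] have "length c = length d" using assms by (metis nat_neq_iff)
  moreover have "prefix c s" "prefix d s" using assms append_prefixD by blast+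
  ultimately show ?thesis by (metis prefix_same_cases prefix_same_length)
qed

text \<open>The infinite variable word \<open>W\<close> describes a perfect subtree: all leaves walk simultaneously, at a
letter \<open>c\<close> the walk of leaf \<open>x\<close> takes direction \<open>c x\<close>, at a variable the direction is free. Variables with an even
index are free only for the leaf \<open>k\<close>, those with an odd index only for the other leaves, and elsewhere the direction
is \<open>False\<close>. Therefore all other leaves move in a known direction whenever the cone of \<open>k\<close> splits.\<close>

locale coded_subtree = coded_tree +
  fixes k :: node and W :: "nat \<Rightarrow> (node \<Rightarrow> bool) + nat"
  assumes k: "k \<in> lev T (g 0)" and W: "\<And>n. \<exists>l. W l = Inr n"
begin

definition bit :: "node \<Rightarrow> (nat \<Rightarrow> bool) \<Rightarrow> nat \<Rightarrow> bool" where
  "bit x beta l = (case W l of Inl c \<Rightarrow> c x | Inr n \<Rightarrow> beta n)"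

definition node_at :: "node \<Rightarrow> (nat \<Rightarrow> bool) \<Rightarrow> nat \<Rightarrow> node" where
  "node_at x beta l = walk x (map (bit x beta) [0..<l])"

definition admissible :: "node \<Rightarrow> (nat \<Rightarrow> bool) set" where
  "admissible x = {beta. \<forall>n. beta n \<longrightarrow> (even n \<longleftrightarrow> x = k)}"

definition subtree :: "node set" where
  "subtree = {u. \<exists>x\<in>lev T (g 0). \<exists>beta\<in>admissible x. \<exists>l. prefix u (node_at x beta l)}"

lemma node_at_0 [simp]: "node_at x beta 0 = x" by (simp add: node_at_def)

lemma node_at_Suc: "node_at x beta (Suc l) = child (node_at x beta l) (bit x beta l)"
  by (simp add: node_at_def walk_snoc)

lemma node_at_lev: "x \<in> lev T (g 0) \<Longrightarrow> node_at x beta l \<in> lev T (g l)"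
  using walk_lev[of x "map (bit x beta) [0..<l]"] by (simp add: node_at_def)

lemma node_at_mono: assumes "x \<in> lev T (g 0)" "l \<le> l'" shows "prefix (node_at x beta l) (node_at x beta l')"
proof -
  have "[0..<l'] = [0..<l] @ [l..<l']" using assms(2) by (metis le_add_diff_inverse upt_add_eq_append zero_le)
  then have "prefix (map (bit x beta) [0..<l]) (map (bit x beta) [0..<l'])" by simp
  then show ?thesis unfolding node_at_def by (rule walk_prefix[OF assms(1)])
qed

lemma node_at_branching: "x \<in> lev T (g 0) \<Longrightarrow> prefix (branching (node_at x beta l) @ [bit x beta l]) (node_at x beta (Suc l))"
  using child(2)[OF node_at_lev] by (simp add: node_at_Suc)

lemma node_at_cong: "(\<And>i. i < l \<Longrightarrow> bit x beta i = bit x gam i) \<Longrightarrow> node_at x beta l = node_at x gam l"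
  unfolding node_at_def by (rule arg_cong[of _ _ "walk x"]) auto

lemma g_le: "l \<le> l' \<Longrightarrow> g l \<le> g l'" using g by (simp add: strict_mono_less_eq)

lemma subtree_subset: "subtree \<subseteq> T"
proof
  fix u assume "u \<in> subtree"
  then obtain x beta l where "x \<in> lev T (g 0)" "prefix u (node_at x beta l)" by (auto simp: subtree_def)
  then show "u \<in> T" using perfect_prefix[OF T, of "node_at x beta l" u] node_at_lev[of x beta l] by simp
qed

lemma take_node_at: assumes "x \<in> lev T (g 0)" "prefix u (node_at x beta l)" "g 0 \<le> length u" shows "take (g 0) u = x"
proof -
  have "prefix x (node_at x beta l)" using node_at_mono[OF assms(1), of 0 l] by simp
  then have "prefix x u" using assms prefix_length_prefix[of x "node_at x beta l" u] by simp
  then show ?thesis using assms(1) prefix_take_eq[of x u "g 0"] by simp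
qed

lemma lev_subtree: "lev subtree (g l) = {node_at x beta l |x beta. x \<in> lev T (g 0) \<and> beta \<in> admissible x}"
proof (intro equalityI subsetI)
  fix u assume u: "u \<in> lev subtree (g l)"
  then obtain x beta l' where x: "x \<in> lev T (g 0)" "beta \<in> admissible x" "prefix u (node_at x beta l')" "length u = g l" by (auto simp: subtree_def)
  have len: "length (node_at x beta i) = g i" for i using node_at_lev[OF x(1)] by simp
  have "l \<le> l'" using prefix_length_le[OF x(3)] x(4) len g by (simp add: strict_mono_less_eq)
  then have "prefix (node_at x beta l) (node_at x beta l')" using node_at_mono[OF x(1)] by blast
  then have "u = node_at x beta l" using x(3,4) len by (metis prefix_same_cases prefix_same_length)
  then show "u \<in> {node_at x beta l |x beta. x \<in> lev T (g 0) \<and> beta \<in> admissible x}" using x by blast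
next
  fix u assume "u \<in> {node_at x beta l |x beta. x \<in> lev T (g 0) \<and> beta \<in> admissible x}"
  then obtain x beta where x: "u = node_at x beta l" "x \<in> lev T (g 0)" "beta \<in> admissible x" by blast
  then have "u \<in> subtree" unfolding subtree_def by blast
  then show "u \<in> lev subtree (g l)" using node_at_lev[OF x(2)] x(1) by simp
qed

lemma lev_subtree_0: "lev subtree (g 0) = lev T (g 0)"
proof -
  have "(\<lambda>_. False) \<in> admissible x" for x by (simp add: admissible_def)
  then show ?thesis unfolding lev_subtree by auto
qed

text \<open>Every node splits because some variable with an index of the right parity has not occurred yet.\<close>

lemma perfect_subtree: "perfect subtree" unfolding perfect_def
proof (intro conjI ballI)
  show "is_tree subtree" unfolding is_tree_def subtree_def using prefix_order.trans by blast
  fix u assume "u \<in> subtree"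
  then obtain x beta l where x: "x \<in> lev T (g 0)" "beta \<in> admissible x" "prefix u (node_at x beta l)" by (auto simp: subtree_def)
  have "finite {n. \<exists>i<l. W i = Inr n}"
    by (rule finite_subset[of _ "(\<lambda>i. projr (W i)) ` {..<l}"]) force+
  then obtain m where m: "\<And>n. (\<exists>i<l. W i = Inr n) \<Longrightarrow> n \<le> m" using finite_nat_set_iff_bounded_le by auto
  \<comment> \<open>an index beyond those seen so far, of the parity that is free for \<open>x\<close>\<close>
  define n where "n = (if x = k then 2 * m + 2 else 2 * m + 3)"
  have n: "m < n" "even n \<longleftrightarrow> x = k" by (auto simp: n_def)
  define l0 where "l0 = (LEAST i. W i = Inr n)"
  have l0: "W l0 = Inr n" unfolding l0_def using W by (rule LeastI_ex)
  have first: "W i \<noteq> Inr n" if "i < l0" for i using that not_less_Least unfolding l0_def by blast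
  have "l \<le> l0" using m l0 n(1) by (meson leD leI)
  have inB: "beta(n := b) \<in> admissible x" for b using x(2) n by (auto simp: admissible_def)
  have bits: "bit x (beta(n := b)) i = bit x beta i" if "i < l0" for b i
    using first[OF that] by (auto simp: bit_def split: sum.splits)
  have same: "node_at x (beta(n := b)) l0 = node_at x beta l0" for b by (rule node_at_cong) (rule bits)
  define s where "s = branching (node_at x beta l0)"
  have up: "prefix (s @ [b]) (node_at x (beta(n := b)) (Suc l0))" for b
    using node_at_branching[OF x(1), of "beta(n := b)" l0] same[of b] by (simp add: bit_def l0 s_def)
  then have sb: "s @ [b] \<in> subtree" for b unfolding subtree_def using x(1) inB[of b] by blast
  have "s \<in> subtree" using sb[of True] \<open>is_tree subtree\<close> unfolding is_tree_def by (meson prefixI)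
  then have "s \<in> Split subtree" using sb by (simp add: Split_iff)
  moreover have "prefix u s"
    using x(3) node_at_mono[OF x(1) \<open>l \<le> l0\<close>, of beta] branching(2)[OF node_at_lev[OF x(1), of beta l0]] unfolding s_def by (meson prefix_order.trans)
  ultimately show "\<exists>s\<in>Split subtree. prefix u s" by blast
qed

text \<open>Two walks from the same leaf separate at the first position where their directions differ, and there a
variable occurs for the first time.\<close>

lemma Split_subtree:
  assumes s: "s \<in> Split subtree" "g 0 \<le> length s"
  obtains x beta l n where "x \<in> lev T (g 0)" "beta \<in> admissible x" "W l = Inr n" "\<And>i. i < l \<Longrightarrow> W i \<noteq> Inr n"
    "even n \<longleftrightarrow> x = k" "s = branching (node_at x beta l)"
proof -
  obtain x beta l1 where x: "x \<in> lev T (g 0)" "beta \<in> admissible x" "prefix (s @ [False]) (node_at x beta l1)"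
    using s(1) by (auto simp: Split_iff subtree_def)
  obtain x' gam l2 where x': "x' \<in> lev T (g 0)" "gam \<in> admissible x'" "prefix (s @ [True]) (node_at x' gam l2)"
    using s(1) by (auto simp: Split_iff subtree_def)
  have "take (g 0) s = x" "take (g 0) s = x'"
    using take_node_at[OF x(1), of s] take_node_at[OF x'(1), of s] x(3) x'(3) s(2) append_prefixD by blast+
  then have [simp]: "x' = x" by simp
  define L where "L = max l1 l2"
  have p: "prefix (s @ [False]) (node_at x beta L)" "prefix (s @ [True]) (node_at x gam L)"
    using x(3) x'(3) node_at_mono[OF x(1), of l1 L] node_at_mono[OF x(1), of l2 L] unfolding L_def
    by (auto intro: prefix_order.trans)
  have ex: "\<exists>i. bit x beta i \<noteq> bit x gam i"
  proof (rule ccontr)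
    assume "\<not> ?thesis"
    then have "node_at x beta L = node_at x gam L" by (intro node_at_cong) auto
    then show False using diverge_not_prefix(3)[of s False "node_at x beta L" "node_at x gam L"] p by simp
  qed
  define l where "l = (LEAST i. bit x beta i \<noteq> bit x gam i)"
  have l: "bit x beta l \<noteq> bit x gam l" unfolding l_def using ex by (rule LeastI_ex)
  have less: "bit x beta i = bit x gam i" if "i < l" for i using that not_less_Least unfolding l_def by blast
  have eq: "node_at x beta l = node_at x gam l" by (rule node_at_cong) (rule less)
  have "l < L"
  proof (rule ccontr)
    assume "\<not> l < L"
    then have "node_at x beta L = node_at x gam L" by (intro node_at_cong less) simp
    then show False using diverge_not_prefix(3)[of s False "node_at x beta L" "node_at x gam L"] p by simp
  qed
  define b where "b = bit x beta l"
  have nb: "bit x gam l = (\<not> b)" using l by (auto simp: b_def)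
  have q: "prefix (branching (node_at x beta l) @ [b]) (node_at x beta L)" "prefix (branching (node_at x beta l) @ [\<not> b]) (node_at x gam L)"
    using node_at_branching[OF x(1), of beta l] node_at_branching[OF x(1), of gam l] node_at_mono[OF x(1), of "Suc l" L] \<open>l < L\<close> nb
    unfolding eq b_def by (auto intro: prefix_order.trans)
  have "s = branching (node_at x beta l)" using diverge_unique[of s False _ _ "branching (node_at x beta l)" b] p q by auto
  moreover obtain n where n: "W l = Inr n" using l by (cases "W l") (auto simp: bit_def)
  moreover have "W i \<noteq> Inr n" if "i < l" for i using less[OF that] l n by (auto simp: bit_def)
  moreover have "beta n \<or> gam n" using l n by (auto simp: bit_def)
  then have "even n \<longleftrightarrow> x = k" using x(2) x'(2) by (auto simp: admissible_def)
  ultimately show ?thesis using that x by blast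
qed

text \<open>The nodes right after the next splitting, when \<open>w\<close> describes the walks up to it: the walk of \<open>k\<close> continues
in both directions, all others continue with \<open>False\<close>.\<close>

definition front :: "(node \<Rightarrow> bool) list \<Rightarrow> node set" where
  "front w = (\<lambda>x. walk x (map (\<lambda>c. c x) w @ [False])) ` lev T (g 0) \<union> {walk k (map (\<lambda>c. c k) w @ [True])}"

lemma front_subset: "front w \<subseteq> lev T (g (Suc (length w)))"
  using walk_lev[of _ "map (\<lambda>c. c _) w @ [_]"] k unfolding front_def by fastforce

text \<open>Before the first splitting of \<open>R\<close>, only one walk from each leaf survives in \<open>R\<close>. As the walk from \<open>x\<close> depends only
on the values at \<open>x\<close> of the letters, these walks are described by a single word, an instance of \<open>W\<close> cut off where a
variable occurs for the first time; that is where \<open>W\<close> is monochromatic.\<close>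

lemma first_step:
  assumes R: "perfect R" "R \<subseteq> subtree" "lev R (g 0) = lev T (g 0)"
    and s: "s \<in> Split R" "prefix k s" "window R (g 0) (length s) = {}"
  obtains l n lam where "W l = Inr n" "\<And>i. i < l \<Longrightarrow> W i \<noteq> Inr n" "\<And>i. {x. lam i x} \<subseteq> lev T (g 0)"
    "Suc (length s) \<le> g (Suc l)" "lev R (g (Suc l)) = front (inst lam (map W [0..<l]))"
    "window R (Suc (length s)) (g (Suc l)) = {}"
proof -
  have hs: "g 0 \<le> length s" using prefix_length_le[OF s(2)] k by simp
  obtain x beta l n where x: "x \<in> lev T (g 0)" "beta \<in> admissible x" "W l = Inr n" "\<And>i. i < l \<Longrightarrow> W i \<noteq> Inr n"
    "even n \<longleftrightarrow> x = k" "s = branching (node_at x beta l)"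
    using Split_subtree[OF _ hs] s(1) Split_mono[OF R(2)] by blast
  note spx = branching[OF node_at_lev[OF x(1), of beta l]]
  have "x = k"
  proof -
    have "prefix x s" using node_at_mono[OF x(1), of 0 l beta] spx(2) x(6) by (auto intro: prefix_order.trans)
    then show ?thesis using s(2) x(1) k prefix_take_eq[of x s "g 0"] prefix_take_eq[of k s "g 0"] by simp
  qed
  then have en: "even n" using x by simp
  have sR: "s \<in> R" using s(1) by (simp add: Split_iff)
  have gl: "g l \<le> length s" "length s < g (Suc l)" using spx x(6) by auto
  have ext: "\<exists>gam. gam \<in> admissible z \<and> node_at z gam l \<in> R" if z: "z \<in> lev T (g 0)" for z
  proof -
    have "z \<in> R" "length z \<le> g l" using z R(3) g_le[of 0 l] by auto
    then obtain v where v: "v \<in> lev R (g l)" "prefix z v" using perfect_ext[OF R(1)] by blast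
    then have "v \<in> lev subtree (g l)" using R(2) by auto
    then obtain z' gam where z': "v = node_at z' gam l" "z' \<in> lev T (g 0)" "gam \<in> admissible z'" unfolding lev_subtree by blast
    have "z' = z" using node_at_mono[OF z'(2), of 0 l gam] v(2) z z'(1,2) prefix_take_eq[of z v "g 0"] prefix_take_eq[of z' v "g 0"] by simp
    then show ?thesis using z' v by auto
  qed
  \<comment> \<open>the walks that survive in \<open>R\<close>; above \<open>k\<close> the one leading to \<open>s\<close>\<close>
  define gm where "gm = (\<lambda>z. if z = k then beta else (SOME gam. gam \<in> admissible z \<and> node_at z gam l \<in> R))"
  have gm: "gm z \<in> admissible z" "node_at z (gm z) l \<in> R" if z: "z \<in> lev T (g 0)" for z
  proof -
    have "gm z \<in> admissible z \<and> node_at z (gm z) l \<in> R"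
    proof (cases "z = k")
      case True
      have "node_at x beta l \<in> R" using perfect_prefix[OF R(1) sR] spx(2) x(6) by simp
      then show ?thesis using True x(2) \<open>x = k\<close> by (simp add: gm_def)
    next
      case False then show ?thesis using someI_ex[OF ext[OF z]] by (simp add: gm_def)
    qed
    then show "gm z \<in> admissible z" "node_at z (gm z) l \<in> R" by auto
  qed
  have uniq: "v = node_at z (gm z) l" if z: "z \<in> lev T (g 0)" and v: "v \<in> lev R (g l)" "prefix z v" for z v
  proof (rule ccontr)
    assume ne: "v \<noteq> node_at z (gm z) l"
    have B: "length (node_at z (gm z) l) = g l" "prefix z (node_at z (gm z) l)" using node_at_lev[OF z] node_at_mono[OF z, of 0 l] by auto
    have np: "\<not> prefix v (node_at z (gm z) l)" "\<not> prefix (node_at z (gm z) l) v"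
      using ne prefix_same_length[of v "node_at z (gm z) l"] prefix_same_length[of "node_at z (gm z) l" v] v(1) B(1) by auto
    have "v \<in> R" using v by simp
    then obtain c b where c: "c \<in> Split R" "prefix (c @ [b]) v" "prefix (c @ [\<not> b]) (node_at z (gm z) l)"
      using tree_diverge[OF perfect_tree[OF R(1)] _ gm(2)[OF z] np] by metis
    have "length c < g l" using prefix_length_le[OF c(2)] v(1) by simp
    moreover have "g 0 \<le> length c"
    proof (rule ccontr)
      assume "\<not> g 0 \<le> length c"
      then have "length (c @ [b]) \<le> length z" "length (c @ [\<not> b]) \<le> length z" using z by auto
      then have "prefix (c @ [b]) z" "prefix (c @ [\<not> b]) z"
        using c v(2) B(2) prefix_length_prefix by blast+
      then show False using diverge_not_prefix(3) by blast
    qed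
    ultimately have "c \<in> window R (g 0) (length s)" using c(1) gl by (simp add: window_def)
    then show False using s(3) by simp
  qed
  \<comment> \<open>one assignment of letters that describes all surviving walks\<close>
  define lam where "lam = (\<lambda>i z. z \<in> lev T (g 0) \<and> gm z i)"
  define w where "w = inst lam (map W [0..<l])"
  have lw: "length w = l" by (simp add: w_def inst_def)
  have bw: "map (\<lambda>c. c z) w = map (bit z (gm z)) [0..<l]" if "z \<in> lev T (g 0)" for z
    unfolding w_def inst_def map_map using that by (auto simp: bit_def lam_def split: sum.splits)
  have posw: "walk z (map (\<lambda>c. c z) w @ [b]) = child (node_at z (gm z) l) b" if "z \<in> lev T (g 0)" for z b
    using bw[OF that] by (simp add: walk_snoc node_at_def)
  have frontw: "front w = (\<lambda>z. child (node_at z (gm z) l) False) ` lev T (g 0) \<union> {child (node_at k (gm k) l) True}"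
    unfolding front_def using posw k by auto
  have above: "\<exists>b. v = child (node_at z (gm z) l) b \<and> (b \<longrightarrow> z = k)"
    if z: "z \<in> lev T (g 0)" and v: "v \<in> lev R (g (Suc l))" "prefix z v" for v z
  proof -
    have "v \<in> lev subtree (g (Suc l))" using v R(2) by auto
    then obtain z' gam where z': "v = node_at z' gam (Suc l)" "z' \<in> lev T (g 0)" "gam \<in> admissible z'" unfolding lev_subtree by blast
    have "z' = z" using node_at_mono[OF z'(2), of 0 "Suc l" gam] v(2) z z'(1,2) prefix_take_eq[of z v "g 0"] prefix_take_eq[of z' v "g 0"] by simp
    have pv: "prefix (node_at z gam l) v" using node_at_mono[OF z, of l "Suc l" gam] z'(1) \<open>z' = z\<close> by simp
    have "node_at z gam l \<in> lev R (g l)" using perfect_prefix[OF R(1) _ pv] v(1) node_at_lev[OF z, of gam l] by simp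
    then have "node_at z gam l = node_at z (gm z) l" using uniq[OF z] node_at_mono[OF z, of 0 l gam] by simp
    then have "v = child (node_at z (gm z) l) (gam n)" using z'(1) \<open>z' = z\<close> x(3) by (simp add: node_at_Suc bit_def)
    moreover have "gam n \<longrightarrow> z = k" using z'(3) en \<open>z' = z\<close> by (auto simp: admissible_def)
    ultimately show ?thesis by blast
  qed
  have spk: "s = branching (node_at k (gm k) l)" using x(6) \<open>x = k\<close> by (simp add: gm_def)
  have "lev R (g (Suc l)) = front w"
  proof (intro equalityI subsetI)
    fix v assume v: "v \<in> lev R (g (Suc l))"
    define z where "z = take (g 0) v"
    have "z \<in> lev T (g 0)" using perfect_take[OF R(1), of v] v R(3) g_le[of 0 "Suc l"] unfolding z_def by auto
    moreover have "prefix z v" by (simp add: z_def take_is_prefix)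
    ultimately obtain b where "v = child (node_at z (gm z) l) b" "b \<longrightarrow> z = k" using above[OF _ v] by blast
    then show "v \<in> front w" unfolding frontw using \<open>z \<in> lev T (g 0)\<close> by (cases b) auto
  next
    fix v assume "v \<in> front w"
    then consider z where "z \<in> lev T (g 0)" "z \<noteq> k" "v = child (node_at z (gm z) l) False"
      | b where "v = child (node_at k (gm k) l) b" unfolding frontw by blast
    then show "v \<in> lev R (g (Suc l))"
    proof cases
      case 1
      have "length (node_at z (gm z) l) \<le> g (Suc l)" using node_at_lev[OF 1(1)] g_le[of l "Suc l"] by simp
      then obtain v' where v': "v' \<in> lev R (g (Suc l))" "prefix (node_at z (gm z) l) v'"
        using perfect_ext[OF R(1) gm(2)[OF 1(1)]] by blast
      have "prefix z v'" using node_at_mono[OF 1(1), of 0 l "gm z"] v'(2) by (auto intro: prefix_order.trans)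
      then have "v' = v" using above[OF 1(1) v'(1)] 1 by auto
      then show ?thesis using v' by simp
    next
      case (2 b)
      have "s @ [b] \<in> R" using s(1) by (cases b) (auto simp: Split_iff)
      then obtain v' where v': "v' \<in> lev R (g (Suc l))" "prefix (s @ [b]) v'"
        using perfect_ext[OF R(1), of "s @ [b]" "g (Suc l)"] gl by auto
      have "prefix k v'" using s(2) v'(2) by (metis append_prefixD prefix_order.trans)
      then obtain b' where b': "v' = child (node_at k (gm k) l) b'" using above[OF k v'(1)] by blast
      have "prefix (s @ [b']) v'" using child(2)[OF node_at_lev[OF k, of "gm k"], of l b'] spk b' by simp
      then have "b' = b" using v'(2) diverge_not_prefix(3)[of s b v' v'] by (cases b; cases b') auto
      then show ?thesis using v' b' 2 by simp
    qed
  qed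
  moreover have "window R (Suc (length s)) (g (Suc l)) = {}"
  proof (rule ccontr)
    assume "\<not> ?thesis"
    then obtain r where r: "r \<in> Split R" "length s < length r" "length r < g (Suc l)" by (auto simp: window_def)
    have "r \<in> Split subtree" "g 0 \<le> length r" using r hs Split_mono[OF R(2)] by auto
    then obtain x' beta' l' n' where x': "x' \<in> lev T (g 0)" "beta' \<in> admissible x'" "W l' = Inr n'"
      "even n' \<longleftrightarrow> x' = k" "r = branching (node_at x' beta' l')"
      using Split_subtree[of r] by metis
    note spr = branching[OF node_at_lev[OF x'(1), of beta' l']]
    have "g l' < g (Suc l)" "g l < g (Suc l')" using spr x'(5) r gl by auto
    then have "l' = l" using g by (simp add: strict_mono_less)
    then have "x' = k" using x' x(3) en by simp
    have pr: "prefix (node_at k beta' l) r" using spr(2) x'(5) \<open>l' = l\<close> \<open>x' = k\<close> by simp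
    then have "node_at k beta' l \<in> lev R (g l)" using perfect_prefix[OF R(1) _ pr] r(1) node_at_lev[OF k, of beta' l] by (simp add: Split_iff)
    then have "node_at k beta' l = node_at k (gm k) l" using uniq[OF k] node_at_mono[OF k, of 0 l beta'] by simp
    then have "r = s" using x'(5) spk \<open>l' = l\<close> \<open>x' = k\<close> by simp
    then show False using r by simp
  qed
  moreover have "{z. lam i z} \<subseteq> lev T (g 0)" for i by (auto simp: lam_def)
  moreover have "Suc (length s) \<le> g (Suc l)" using gl by simp
  ultimately show ?thesis using that[of l n lam, OF x(3,4)] unfolding w_def by blast
qed

end

section \<open>Pure decision\<close>

lemma acceptsE:
  assumes "accepts D h S" "good_perfect R" "R \<subseteq> S" "lev R h = lev S h" "h \<le> h'"
  obtains R' h'' where "good_perfect R'" "R' \<subseteq> R" "h' \<le> h''" "lev R' h' = lev R h'" "D h'' R'"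
  using assms unfolding accepts_def by blast

lemma hereditary_accepts: "hereditary (\<lambda>c h S. (\<exists>i\<in>I. accepts (D i) h S) \<or> undecided I D h S)"
  unfolding hereditary_def using accepts_subset undecided_subset by metis

lemma split_windows_exist:
  fixes hs :: "nat \<Rightarrow> nat"
  assumes T: "perfect T" and hs: "strict_mono hs"
  obtains g :: "nat \<Rightarrow> nat" where "strict_mono g" "g 0 = hs 0" "range g \<subseteq> range hs" "coded_tree T g"
proof -
  have "\<exists>b>a. \<forall>y\<in>lev T (hs a). \<exists>s\<in>Split T. prefix y s \<and> length s < hs b" for a :: nat
  proof -
    have "\<forall>y. \<exists>s. y \<in> lev T (hs a) \<longrightarrow> s \<in> Split T \<and> prefix y s" using perfect_split[OF T] by auto
    then obtain sg where sg: "\<And>y. y \<in> lev T (hs a) \<Longrightarrow> sg y \<in> Split T \<and> prefix y (sg y)" by metis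
    define m where "m = Max (insert 0 ((\<lambda>y. length (sg y)) ` lev T (hs a)))"
    have m: "length (sg y) \<le> m" if "y \<in> lev T (hs a)" for y
      unfolding m_def by (rule Max_ge) (use that finite_lev[of T "hs a"] in auto)
    define b where "b = Suc (a + m)"
    have "m < hs b" using strict_mono_imp_increasing[OF hs, of b] by (simp add: b_def)
    then have "\<forall>y\<in>lev T (hs a). \<exists>s\<in>Split T. prefix y s \<and> length s < hs b"
      using sg m by (meson le_less_trans)
    moreover have "a < b" by (simp add: b_def)
    ultimately show ?thesis by blast
  qed
  then obtain N where N: "\<And>a. a < N a" "\<And>a. \<forall>y\<in>lev T (hs a). \<exists>s\<in>Split T. prefix y s \<and> length s < hs (N a)" by metis
  define g where "g = (\<lambda>j. hs ((N ^^ j) 0))"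
  have mono: "strict_mono g" unfolding strict_mono_Suc_iff g_def using N(1) hs by (simp add: strict_mono_less)
  moreover have "coded_tree T g"
  proof
    fix y l assume "y \<in> lev T (g l)"
    then show "\<exists>s\<in>Split T. prefix y s \<and> length s < g (Suc l)"
      using N(2)[of "(N ^^ l) 0"] unfolding g_def by (simp only: funpow.simps comp_apply)
  qed (fact T mono)+
  ultimately show ?thesis using that[of g] by (auto simp: g_def)
qed

text \<open>First a fusion makes every set of nodes of the chosen levels either accepting or stably undecided, then the
fronts are coloured by the accepted alternative. If the common colour is an alternative, the subtree accepts it,
because every good subtree passes through some front; otherwise all next steps are undecided.\<close>

lemma one_step:
  fixes I :: "'i set"
  assumes I: "finite I" and T: "perfect T" "T \<noteq> {}"
  obtains S where "perfect S" "S \<subseteq> T" "lev S h = lev T h"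
    "(\<exists>i\<in>I. accepts (D i) h S) \<or>
     (\<forall>R k s. good_perfect R \<longrightarrow> R \<subseteq> S \<longrightarrow> lev R h = lev S h \<longrightarrow> next_leaf R h k \<longrightarrow> s \<in> Split R \<longrightarrow> prefix k s
        \<longrightarrow> window R h (length s) = {} \<longrightarrow> undecided I D (Suc (length s)) R)"
proof -
  define dec where "dec = (\<lambda>(c::nat) h S. (\<exists>i\<in>I. accepts (D i) h S) \<or> undecided I D h S)"
  have her: "hereditary dec" unfolding dec_def by (rule hereditary_accepts)
  have dense: "\<exists>S'. perfect S' \<and> S' \<subseteq> S \<and> lev S' h = lev S h \<and> dec c h S'" if "perfect S" for S h and c :: nat
    using that unfolding dec_def undecided_def by blast
  obtain T1 hs where T1: "perfect T1" "T1 \<subseteq> T" "hs 0 = h" "lev T1 h = lev T h" "windowed T1 hs"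
    and dec: "\<And>a Z. Z \<subseteq> lev T1 (hs a) \<Longrightarrow> Z \<noteq> {} \<Longrightarrow> dec (card (lev T h) + a) (hs a) (cone T1 Z)"
    using fusion[OF her T, of h] dense by metis
  have "strict_mono hs" using T1(5) by (simp add: windowed_def)
  then obtain g where gg: "strict_mono g" "g 0 = h" "range g \<subseteq> range hs" "coded_tree T1 g"
    using split_windows_exist[OF T1(1)] T1(3) by metis
  have decg: "(\<exists>i\<in>I. accepts (D i) (g l) (cone T1 Z)) \<or> undecided I D (g l) (cone T1 Z)"
    if "Z \<subseteq> lev T1 (g l)" "Z \<noteq> {}" for Z l
  proof -
    obtain a where "g l = hs a" using gg(3) by blast
    then show ?thesis using dec[of Z a] that unfolding dec_def by simp
  qed
  have ne: "lev T h \<noteq> {}" by (rule lev_nonempty[OF T])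
  then obtain k where kn: "next_leaf T1 h k" using next_leaf_exists T1(4) by metis
  then have kl: "k \<in> lev T1 (g 0)" using gg(2) by (simp add: next_leaf_def)
  interpret coded_tree T1 g by (rule gg(4))
  define Y where "Y = (\<lambda>w :: (node \<Rightarrow> bool) list.
    (\<lambda>x. walk x (map (\<lambda>c. c x) w @ [False])) ` lev T1 (g 0) \<union> {walk k (map (\<lambda>c. c k) w @ [True])})"
  define chi where "chi = (\<lambda>w :: (node \<Rightarrow> bool) list.
    if \<exists>i\<in>I. accepts (D i) (g (Suc (length w))) (cone T1 (Y w))
    then Some (SOME i. i \<in> I \<and> accepts (D i) (g (Suc (length w))) (cone T1 (Y w))) else None)"
  have chi_Some: "i \<in> I \<and> accepts (D i) (g (Suc (length w))) (cone T1 (Y w))" if "chi w = Some i" for w i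
  proof -
    have ex: "\<exists>i. i \<in> I \<and> accepts (D i) (g (Suc (length w))) (cone T1 (Y w))"
      using that by (auto simp: chi_def split: if_splits)
    moreover have "i = (SOME i. i \<in> I \<and> accepts (D i) (g (Suc (length w))) (cone T1 (Y w)))"
      using that by (auto simp: chi_def split: if_splits)
    ultimately show ?thesis using someI_ex[OF ex] by simp
  qed
  have "range chi \<subseteq> insert None (Some ` I)"
  proof
    fix v assume "v \<in> range chi"
    then obtain w where "v = chi w" by blast
    then show "v \<in> insert None (Some ` I)" using chi_Some[of w] by (cases v) auto
  qed
  then have fin: "finite (range chi)" using I finite_subset by blast
  \<comment> \<open>the finite alphabet: functions to bits that vanish outside the leaves\<close>
  define Lt where "Lt = (\<lambda>A x. x \<in> A) ` Pow (lev T1 (g 0))"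
  have Lt: "finite Lt" "Lt \<noteq> {}" using finite_lev[of T1 "g 0"] by (auto simp: Lt_def)
  have inLt: "c \<in> Lt" if "{x. c x} \<subseteq> lev T1 (g 0)" for c
  proof -
    have "c = (\<lambda>A x. x \<in> A) {x. c x}" by simp
    then show ?thesis unfolding Lt_def using that by blast
  qed
  obtain W j where W: "\<And>n. \<exists>l. W l = Inr n"
    and mono: "\<And>n l lam. W l = Inr n \<Longrightarrow> (\<And>i. i < l \<Longrightarrow> W i \<noteq> Inr n) \<Longrightarrow> range lam \<subseteq> Lt \<Longrightarrow>
       chi (inst lam (map W [0..<l])) = j"
    using infinite_variable_word[OF fin Lt] by metis
  interpret coded_subtree T1 g k W by unfold_locales (rule kl, rule W)
  have Yf: "Y = front" by (simp add: Y_def front_def fun_eq_iff)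
  have key: "\<exists>w h2. Suc (length s) \<le> h2 \<and> h2 = g (Suc (length w)) \<and> lev R h2 = front w \<and> window R (Suc (length s)) h2 = {} \<and> chi w = j"
    if R: "good_perfect R" "R \<subseteq> subtree" "lev R h = lev subtree h" and s: "s \<in> Split R" "prefix k s" "window R h (length s) = {}" for R s
  proof -
    have R': "perfect R" "lev R (g 0) = lev T1 (g 0)" "window R (g 0) (length s) = {}"
      using R s(3) lev_subtree_0 gg(2) by (simp_all add: good_perfect_def)
    obtain l n lam where l: "W l = Inr n" "\<And>i. i < l \<Longrightarrow> W i \<noteq> Inr n" "\<And>i. {x. lam i x} \<subseteq> lev T1 (g 0)"
      "Suc (length s) \<le> g (Suc l)" "lev R (g (Suc l)) = front (inst lam (map W [0..<l]))"
      "window R (Suc (length s)) (g (Suc l)) = {}"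
      using first_step[OF R'(1) R(2) R'(2) s(1,2) R'(3)] by metis
    have "range lam \<subseteq> Lt" using inLt l(3) by blast
    then have "chi (inst lam (map W [0..<l])) = j" using mono[OF l(1,2)] by blast
    moreover have "length (inst lam (map W [0..<l])) = l" by (simp add: inst_def)
    ultimately show ?thesis using l(4-6) by (intro exI[of _ "inst lam (map W [0..<l])"]) simp
  qed
  have front_cone: "R \<subseteq> cone T1 (front w)" "lev R (g (Suc (length w))) = lev (cone T1 (front w)) (g (Suc (length w)))"
    if "perfect R" "R \<subseteq> subtree" "lev R (g (Suc (length w))) = front w" for R w
  proof -
    show "R \<subseteq> cone T1 (front w)" using subset_cone[OF that(1), of T1 "g (Suc (length w))"] that subtree_subset by auto
    show "lev R (g (Suc (length w))) = lev (cone T1 (front w)) (g (Suc (length w)))"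
      using cone_perfect(2)[OF T1(1) front_subset] that(3) by simp
  qed
  have lev_subtree_h: "lev subtree h = lev T1 h" using lev_subtree_0 gg(2) by simp
  show ?thesis
  proof (rule that[of subtree])
    show "perfect subtree" by (rule perfect_subtree)
    show "subtree \<subseteq> T" using subtree_subset T1(2) by blast
    show "lev subtree h = lev T h" using lev_subtree_h T1(4) by simp
    show "(\<exists>i\<in>I. accepts (D i) h subtree) \<or>
     (\<forall>R k s. good_perfect R \<longrightarrow> R \<subseteq> subtree \<longrightarrow> lev R h = lev subtree h \<longrightarrow> next_leaf R h k \<longrightarrow> s \<in> Split R \<longrightarrow> prefix k s
        \<longrightarrow> window R h (length s) = {} \<longrightarrow> undecided I D (Suc (length s)) R)"
    proof (cases j)
      case None
      have "undecided I D (Suc (length s)) R" if R: "good_perfect R" "R \<subseteq> subtree" "lev R h = lev subtree h"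
        and k': "next_leaf R h k'" and s: "s \<in> Split R" "prefix k' s" "window R h (length s) = {}" for R k' s
      proof -
        have pR: "perfect R" using R by (simp add: good_perfect_def)
        have "next_leaf T1 h k'" using next_leaf_cong[OF pR T1(1)] R(3) lev_subtree_h k' by simp
        then have "k' = k" using next_leaf_unique kn by blast
        then obtain w h2 where w: "Suc (length s) \<le> h2" "h2 = g (Suc (length w))" "lev R h2 = front w"
          "window R (Suc (length s)) h2 = {}" "chi w = j" using key[OF R s(1)] s by metis
        have "\<not> (\<exists>i\<in>I. accepts (D i) h2 (cone T1 (front w)))"
          using w(5) None w(2) unfolding chi_def Yf by (auto split: if_splits)
        moreover have "front w \<noteq> {}" by (simp add: front_def)
        ultimately have "undecided I D h2 (cone T1 (front w))"
          using decg[OF front_subset] w(2) by blast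
        then have "undecided I D h2 R" using undecided_subset[of I D h2 "cone T1 (front w)" R] front_cone[OF pR R(2), of w] w(2,3) by simp
        then show ?thesis using undecided_down[OF _ pR w(1,4)] by blast
      qed
      then show ?thesis by blast
    next
      case (Some i)
      have iI: "i \<in> I"
      proof -
        define l where "l = (LEAST l. W l = Inr 0)"
        have "W l = Inr 0" unfolding l_def using W by (rule LeastI_ex)
        moreover have "W i \<noteq> Inr 0" if "i < l" for i using that not_less_Least unfolding l_def by blast
        moreover have "range (\<lambda>_::nat. \<lambda>_::node. False) \<subseteq> Lt" using inLt by auto
        ultimately have "chi (inst (\<lambda>_ _. False) (map W [0..<l])) = j" using mono by blast
        then show ?thesis using chi_Some Some by blast
      qed
      have "accepts (D i) h subtree" unfolding accepts_def
      proof (intro allI impI)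
        fix R h' assume R: "good_perfect R" "R \<subseteq> subtree" "lev R h = lev subtree h" "h \<le> h'"
        have pR: "perfect R" "level_good R" using R by (simp_all add: good_perfect_def)
        have kR: "next_leaf R h k" using next_leaf_cong[OF pR(1) T1(1)] R(3) lev_subtree_h kn by simp
        obtain s where s: "s \<in> Split R" "prefix k s" "\<And>t. t \<in> Split R \<Longrightarrow> h \<le> length t \<Longrightarrow> length s \<le> length t"
          using first_split[OF pR kR] by metis
        have "window R h (length s) = {}" using s(3) by (force simp: window_def)
        then obtain w h2 where w: "h2 = g (Suc (length w))" "lev R h2 = front w" "chi w = j"
          using key[OF R(1-3) s(1,2)] by metis
        have "accepts (D i) h2 (cone T1 (front w))" using chi_Some[of w i] w Some Yf by simp
        then have "accepts (D i) h2 R" using accepts_subset[of "D i" h2 "cone T1 (front w)" R] front_cone[OF pR(1) R(2), of w] w(1,2) by simp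
        then obtain R' h'' where R': "good_perfect R'" "R' \<subseteq> R" "max h' h2 \<le> h''" "lev R' (max h' h2) = lev R (max h' h2)" "D i h'' R'"
          using acceptsE[of "D i" h2 R R "max h' h2"] R(1) by auto
        have "lev R' h' = lev R h'"
          using lev_cong_le[OF _ pR(1) R'(4), of h'] R'(1) by (simp add: good_perfect_def)
        then show "\<exists>R' h''. good_perfect R' \<and> R' \<subseteq> R \<and> h' \<le> h'' \<and> lev R' h' = lev R h' \<and> D i h'' R'"
          using R' by (meson max.boundedE)
      qed
      then show ?thesis using iI by blast
    qed
  qed
qed

text \<open>If nothing were accepted, a fusion of \<open>one_step\<close> would yield a good tree all of whose good subtrees remain
undecided at every level of the fusion: there is a single splitting node between two levels, so the step from
one level to the next is exactly the one controlled by \<open>one_step\<close>. Density contradicts this.\<close>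

lemma pure_decision:
  fixes I :: "'i set"
  assumes I: "finite I" "I \<noteq> {}" and T: "perfect T"
    and opn: "\<And>i h h' R R'. i \<in> I \<Longrightarrow> D i h R \<Longrightarrow> good_perfect R \<Longrightarrow> good_perfect R' \<Longrightarrow> R' \<subseteq> R \<Longrightarrow> h \<le> h' \<Longrightarrow> lev R' h = lev R h \<Longrightarrow> D i h' R'"
    and dense: "\<And>R. good_perfect R \<Longrightarrow> R \<subseteq> T \<Longrightarrow> lev R m = lev T m \<Longrightarrow>
       \<exists>R' h' i. good_perfect R' \<and> R' \<subseteq> R \<and> m \<le> h' \<and> lev R' m = lev R m \<and> i \<in> I \<and> D i h' R'"
  obtains S i where "perfect S" "S \<subseteq> T" "lev S m = lev T m" "i \<in> I" "accepts (D i) m S"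
proof (cases "\<exists>U. good_perfect U \<and> lev U m = lev T m")
  case False
  obtain i where "i \<in> I" using I by blast
  moreover have "accepts (D i) m T" using False unfolding accepts_def by blast
  ultimately show ?thesis using that T by blast
next
  case True
  then obtain U where U: "good_perfect U" "lev U m = lev T m" by blast
  have lne: "lev T m \<noteq> {}" using lev_nonempty[of U m] U by (auto simp: good_perfect_def)
  then have ne: "T \<noteq> {}" by auto
  have "\<not> undecided I D m T"
  proof
    assume und: "undecided I D m T"
    define st where "st = (\<lambda>(c::nat) h S. (\<exists>i\<in>I. accepts (D i) h S) \<or>
     (\<forall>R k s. good_perfect R \<longrightarrow> R \<subseteq> S \<longrightarrow> lev R h = lev S h \<longrightarrow> next_leaf R h k \<longrightarrow> s \<in> Split R \<longrightarrow> prefix k s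
        \<longrightarrow> window R h (length s) = {} \<longrightarrow> undecided I D (Suc (length s)) R))"
    have her: "hereditary st" unfolding hereditary_def
    proof (intro allI impI)
      fix c h S S' assume S: "st c h S" "S' \<subseteq> S" "lev S' h = lev S h"
      show "st c h S'"
      proof (cases "\<exists>i\<in>I. accepts (D i) h S")
        case True then show ?thesis using accepts_subset S unfolding st_def by metis
      next
        case False
        then show ?thesis using S unfolding st_def by (metis subset_trans)
      qed
    qed
    have den: "\<exists>S'. perfect S' \<and> S' \<subseteq> S \<and> lev S' h = lev S h \<and> st c h S'" if "perfect S" "S \<noteq> {}" for S h and c :: nat
      using one_step[OF I(1) that, of h D] unfolding st_def by metis
    obtain L hs where L: "perfect L" "L \<subseteq> T" "hs 0 = m" "lev L m = lev T m" "windowed L hs"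
      and st: "\<And>a Z. Z \<subseteq> lev L (hs a) \<Longrightarrow> Z \<noteq> {} \<Longrightarrow> st (card (lev T m) + a) (hs a) (cone L Z)"
      using fusion[OF her T ne, of m] den by metis
    have "level_good L" using level_good_windowed[OF L(1,5), of U] L U by (simp add: good_perfect_def)
    moreover have "L \<noteq> {}" using lne L(4) by auto
    ultimately have gL: "good_perfect L" using L(1) by (simp add: good_perfect_def)
    have mono: "strict_mono hs" using L(5) by (simp add: windowed_def)
    have all_und: "undecided I D (hs a) R" if R: "good_perfect R" "R \<subseteq> L" "lev R m = lev T m" for R a
    proof (induction a)
      case 0
      have "undecided I D m R" by (rule undecided_subset[OF und]) (use R L in auto)
      then show ?case using L(3) by simp
    next
      case (Suc a)
      have pR: "perfect R" "level_good R" "R \<noteq> {}" using R by (simp_all add: good_perfect_def)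
      have le: "hs a \<le> hs (Suc a)" using mono by (simp add: strict_mono_less_eq)
      obtain k where k: "next_leaf R (hs a) k" using next_leaf_exists lev_nonempty[OF pR(1,3)] by blast
      obtain s where s: "s \<in> Split R" "prefix k s" "\<And>t. t \<in> Split R \<Longrightarrow> hs a \<le> length t \<Longrightarrow> length s \<le> length t"
        using first_split[OF pR(1,2) k] by metis
      have ws: "window R (hs a) (length s) = {}" using s(3) by (force simp: window_def)
      have hs_s: "hs a \<le> length s" using prefix_length_le[OF s(2)] k by (simp add: next_leaf_def)
      show ?case
      proof (cases "hs (Suc a) \<le> length s")
        case True
        then have "window R (hs a) (hs (Suc a)) = {}" using s(3) by (force simp: window_def)
        then show ?thesis using undecided_up[OF Suc pR(1) le] by blast
      next
        case False
        define Z where "Z = lev R (hs a)"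
        have Z: "Z \<subseteq> lev L (hs a)" "Z \<noteq> {}" using R(2) lev_mono lev_nonempty[OF pR(1,3)] by (auto simp: Z_def)
        have Rc: "R \<subseteq> cone L Z" using subset_cone[OF pR(1) R(2), of "hs a" Z] by (simp add: Z_def)
        have Rl: "lev R (hs a) = lev (cone L Z) (hs a)" using cone_perfect(2)[OF L(1) Z(1)] by (simp add: Z_def)
        have "\<not> (\<exists>i\<in>I. accepts (D i) (hs a) (cone L Z))"
          using Suc accepts_subset[OF _ Rc Rl] pR(1) unfolding undecided_def by blast
        then have und_s: "undecided I D (Suc (length s)) R"
          using st[OF Z] R(1) Rc Rl k s(1,2) ws unfolding st_def by blast
        obtain s0 where s0: "window L (hs a) (hs (Suc a)) = {s0}" using L(5) unfolding windowed_def by blast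
        have "s \<in> window R (hs a) (hs (Suc a))" using s(1) hs_s False by (simp add: window_def)
        then have "s = s0" using window_mono[OF R(2)] s0 by blast
        have "window R (Suc (length s)) (hs (Suc a)) = {}"
        proof (rule ccontr)
          assume "\<not> ?thesis"
          then obtain r where r: "r \<in> Split R" "length s < length r" "length r < hs (Suc a)" by (auto simp: window_def)
          then have "r \<in> window R (hs a) (hs (Suc a))" using hs_s by (simp add: window_def)
          then have "r = s0" using window_mono[OF R(2)] s0 by blast
          then show False using r \<open>s = s0\<close> by simp
        qed
        then show ?thesis using undecided_up[OF und_s pR(1)] False by simp
      qed
    qed
    obtain R h' i where R: "good_perfect R" "R \<subseteq> L" "m \<le> h'" "lev R m = lev L m" "i \<in> I" "D i h' R"
      using dense[OF gL L(2,4)] by blast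
    define a where "a = h'"
    have ha: "h' \<le> hs a" using strict_mono_imp_increasing[OF mono] by (simp add: a_def)
    have "accepts (D i) (hs a) R" unfolding accepts_def
    proof (intro allI impI)
      fix R1 h1 assume R1: "good_perfect R1" "R1 \<subseteq> R" "lev R1 (hs a) = lev R (hs a)" "hs a \<le> h1"
      have "lev R1 h' = lev R h'" using lev_cong_le[OF _ _ R1(3) ha] R R1 by (simp add: good_perfect_def)
      then have "D i h1 R1" using opn[OF R(5,6,1) R1(1,2)] ha R1(4) by simp
      then show "\<exists>R' h''. good_perfect R' \<and> R' \<subseteq> R1 \<and> h1 \<le> h'' \<and> lev R' h1 = lev R1 h1 \<and> D i h'' R'"
        using R1(1) by blast
    qed
    moreover have "undecided I D (hs a) R" using all_und[OF R(1,2)] R(4) L(4) by simp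
    ultimately show False using R(1,5) unfolding undecided_def good_perfect_def by blast
  qed
  then show ?thesis using that unfolding undecided_def by blast
qed

section \<open>Amoeba-Sacks forcing\<close>

definition truncate :: "node set \<Rightarrow> nat \<Rightarrow> node set" where
  "truncate T h = {t \<in> T. length t \<le> h}"

lemma truncate_init_seg:
  assumes T: "perfect T" shows "truncate T h \<sqsubseteq>\<^sub>e T"
  unfolding init_seg_def
proof (intro conjI ballI)
  show "finite (truncate T h)"
    by (rule finite_subset[OF _ finite_lists_length_le[of "UNIV :: bool set" h]]) (auto simp: truncate_def)
  show "is_tree (truncate T h)" unfolding is_tree_def
    using perfect_prefix[OF T] prefix_length_le by (fastforce simp: truncate_def)
  show "truncate T h \<subseteq> T" by (auto simp: truncate_def)
  fix t assume t: "t \<in> T - truncate T h"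
  have "take h t \<in> Term (truncate T h)" unfolding Term_def
  proof (intro CollectI conjI ballI notI)
    show "take h t \<in> truncate T h" using perfect_take[OF T] t by (simp add: truncate_def)
    fix s assume "s \<in> truncate T h" "strict_prefix (take h t) s"
    then show False using prefix_length_less[of "take h t" s] t by (auto simp: truncate_def)
  qed
  then show "\<exists>s\<in>Term (truncate T h). prefix s t" using take_is_prefix by blast
qed

lemma truncate_in_AS:
  assumes "good_perfect T" shows "(truncate T h, T) \<in> AS"
proof -
  have T: "perfect T" "T \<noteq> {}" "level_good T" using assms by (simp_all add: good_perfect_def)
  have "lev T (Suc h) \<noteq> {}" by (rule lev_nonempty[OF T(1,2)])
  then have "truncate T h \<noteq> T" by (force simp: truncate_def)
  then show ?thesis using T good_iff[OF T(1)] truncate_init_seg[OF T(1)] by (simp add: AS_def strict_init_seg_def)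
qed

lemma AS_good_perfect: "c \<in> AS \<Longrightarrow> good_perfect (snd c)"
  using good_iff by (auto simp: AS_def good_perfect_def)

lemma init_seg_trans:
  assumes "p \<sqsubseteq>\<^sub>e q" "q \<sqsubseteq>\<^sub>e r" shows "p \<sqsubseteq>\<^sub>e r"
  unfolding init_seg_def
proof (intro conjI ballI)
  show "finite p" "is_tree p" "p \<subseteq> r" using assms by (auto simp: init_seg_def)
  fix t assume t: "t \<in> r - p"
  show "\<exists>s\<in>Term p. prefix s t"
  proof (cases "t \<in> q")
    case True then show ?thesis using assms(1) t by (auto simp: init_seg_def)
  next
    case False
    then obtain s where s: "s \<in> Term q" "prefix s t" using assms(2) t by (auto simp: init_seg_def)
    show ?thesis
    proof (cases "s \<in> p")
      case True
      then have "s \<in> Term p" using s(1) assms(1) by (auto simp: Term_def init_seg_def)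
      then show ?thesis using s(2) by blast
    next
      case False
      then have "s \<in> q - p" using s(1) by (simp add: Term_def)
      then obtain u where "u \<in> Term p" "prefix u s" using assms(1) by (auto simp: init_seg_def)
      then show ?thesis using s(2) prefix_order.trans by blast
    qed
  qed
qed

lemma AS_le_trans: "AS_le c b \<Longrightarrow> AS_le b a \<Longrightarrow> AS_le c a"
  unfolding AS_le_def using init_seg_trans by blast

lemma AS_le_refl: "c \<in> AS \<Longrightarrow> AS_le c c"
  by (auto simp: AS_le_def AS_def strict_init_seg_def init_seg_def)

text \<open>The finite parts may be left out of consideration: the order between conditions of this form is described
by levels.\<close>

lemma truncate_le:
  assumes R: "perfect R" and R': "perfect R'" "R' \<subseteq> R" "lev R' h = lev R h" "h \<le> h'"
  shows "AS_le (truncate R' h', R') (truncate R h, R)"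
proof -
  have same: "t \<in> R' \<longleftrightarrow> t \<in> R" if "length t \<le> h" for t using below_cong[OF R'(1) R R'(3) that] .
  then have eq: "truncate R h = truncate R' h" by (auto simp: truncate_def)
  have i: "truncate R' h \<sqsubseteq>\<^sub>e R'" by (rule truncate_init_seg[OF R'(1)])
  have "truncate R' h \<subseteq> truncate R' h'" using R'(4) by (auto simp: truncate_def)
  moreover have "truncate R' h' \<subseteq> R'" by (auto simp: truncate_def)
  ultimately have "truncate R' h \<sqsubseteq>\<^sub>e truncate R' h'" using i unfolding init_seg_def by blast
  then show ?thesis using R'(2) eq by (simp add: AS_le_def)
qed

lemma below_truncate:
  assumes R: "perfect R" and c: "c \<in> AS" "AS_le c (truncate R h, R)"
  shows "lev (snd c) h = lev R h" "snd c \<subseteq> R"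
proof -
  show sub: "snd c \<subseteq> R" using c(2) by (simp add: AS_le_def)
  have "truncate R h \<subseteq> fst c" using c(2) by (simp add: AS_le_def init_seg_def)
  moreover have "fst c \<subseteq> snd c" using c(1) by (auto simp: AS_def strict_init_seg_def init_seg_def)
  ultimately have "truncate R h \<subseteq> snd c" by blast
  then show "lev (snd c) h = lev R h" using sub by (auto simp: truncate_def)
qed

lemma extend_to_truncate:
  assumes c: "c \<in> AS"
  obtains h where "n \<le> h" "(truncate (snd c) h, snd c) \<in> AS" "AS_le (truncate (snd c) h, snd c) c"
proof -
  have T: "good_perfect (snd c)" by (rule AS_good_perfect[OF c])
  have p: "finite (fst c)" "is_tree (fst c)" "fst c \<subseteq> snd c" "\<forall>t\<in>snd c - fst c. \<exists>s\<in>Term (fst c). prefix s t"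
    using c by (auto simp: AS_def strict_init_seg_def init_seg_def)
  obtain m where m: "\<forall>k\<in>length ` fst c. k \<le> m" using p(1) finite_nat_set_iff_bounded_le by blast
  define h where "h = max n m"
  have "fst c \<subseteq> truncate (snd c) h" using p(3) m by (auto simp: truncate_def h_def le_max_iff_disj)
  moreover have "truncate (snd c) h \<subseteq> snd c" by (auto simp: truncate_def)
  ultimately have "fst c \<sqsubseteq>\<^sub>e truncate (snd c) h" using p by (auto simp: init_seg_def)
  then show ?thesis using that[of h] truncate_in_AS[OF T] by (simp add: AS_le_def h_def)
qed

lemma forces_mono:
  assumes trans: "\<And>a b c. le c b \<Longrightarrow> le b a \<Longrightarrow> le c a"
  shows "forces P le p phi \<Longrightarrow> le q p \<Longrightarrow> forces P le q phi"
proof (induction phi arbitrary: p q)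
  case (Mem x t)
  have "le r p" if "le r q" for r using trans[OF that Mem.prems(2)] .
  then show ?case using Mem.prems(1) by simp
next
  case (Neg phi)
  have "le r p" if "le r q" for r using trans[OF that Neg.prems(2)] .
  then show ?case using Neg.prems(1) by simp
next
  case (All_nat Phi)
  show ?case unfolding forces.simps(5)
  proof
    fix n show "forces P le q (Phi n)" using All_nat.IH[OF rangeI[of Phi n], of p q] All_nat.prems by simp
  qed
next
  case (All_fun Psi)
  show ?case unfolding forces.simps(6)
  proof
    fix H show "forces P le q (Psi H)" using All_fun.IH[OF rangeI[of Psi H], of p q] All_fun.prems by simp
  qed
next
  case (Conj phi psi)
  show ?case using Conj.IH(1)[of p q] Conj.IH(2)[of p q] Conj.prems by simp
qed simp

abbreviation forces_AS :: "as_cond \<Rightarrow> as_cond sentence \<Rightarrow> bool" (infix "\<tturnstile>" 45) where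
  "c \<tturnstile> phi \<equiv> forces AS AS_le c phi"

lemma AS_mono: "c \<tturnstile> phi \<Longrightarrow> AS_le d c \<Longrightarrow> d \<tturnstile> phi"
  using forces_mono[of AS_le] AS_le_trans by blast

lemma forces_Imp_Ground:
  assumes "c \<in> AS"
  shows "c \<tturnstile> Imp phi (Ground b) \<longleftrightarrow> (\<forall>q\<in>AS. AS_le q c \<longrightarrow> q \<tturnstile> phi \<longrightarrow> b)"
  unfolding Imp_def using AS_le_refl by auto

lemma in_Baire_value:
  assumes "c \<tturnstile> in_Baire tau" "c \<in> AS"
  obtains r i where "r \<in> AS" "AS_le r c" "r \<tturnstile> Mem (n, i) tau"
proof -
  have "c \<tturnstile> Ex_nat (\<lambda>m. Mem (n, m) tau)" using assms(1) unfolding in_Baire_def by simp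
  then have "\<not> c \<tturnstile> All_nat (\<lambda>m. Neg (Mem (n, m) tau))" unfolding Ex_nat_def forces.simps(3) using AS_le_refl assms(2) by blast
  then show ?thesis unfolding forces.simps(3,5) using that by blast
qed

lemma in_Baire_unique:
  assumes "c \<tturnstile> in_Baire tau" "c \<in> AS" "r \<in> AS" "AS_le r c" "r \<tturnstile> Mem (n, i) tau" "r \<tturnstile> Mem (n, j) tau"
  shows "i = j"
proof -
  have "c \<tturnstile> Imp (Conj (Mem (n, i) tau) (Mem (n, j) tau)) (Ground (i = j))"
    using assms(1) unfolding in_Baire_def forces.simps(4,5) by blast
  then show ?thesis unfolding forces_Imp_Ground[OF assms(2)] forces.simps(4) using assms(3-6) by blast
qed

lemma bounded_by_value:
  assumes "c \<tturnstile> bounded_by tau g" "c \<in> AS" "r \<in> AS" "AS_le r c" "r \<tturnstile> Mem (n, i) tau"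
  shows "i \<le> g n"
proof -
  have "c \<tturnstile> Imp (Mem (n, i) tau) (Ground (i \<le> g n))"
    using assms(1) unfolding bounded_by_def forces.simps(5) by blast
  then show ?thesis unfolding forces_Imp_Ground[OF assms(2)] using assms(3-5) by blast
qed

definition decides :: "as_cond name \<Rightarrow> nat \<Rightarrow> nat \<Rightarrow> nat \<Rightarrow> node set \<Rightarrow> bool" where
  "decides tau n i h R \<longleftrightarrow> (truncate R h, R) \<tturnstile> Mem (n, i) tau"

text \<open>The hypothesis on \<open>c\<close> concerns only good trees with the same level \<open>h\<close> as \<open>S\<close>; so the lemma can be used for
cones, whose levels are proper subsets of the levels of the ambient tree.\<close>

lemma decide_value:
  assumes c: "c \<in> AS" "c \<tturnstile> in_Baire tau" "c \<tturnstile> bounded_by tau g"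
    and S: "perfect S" and below: "\<And>R. good_perfect R \<Longrightarrow> R \<subseteq> S \<Longrightarrow> lev R h = lev S h \<Longrightarrow> AS_le (truncate R h, R) c"
  obtains S' i where "perfect S'" "S' \<subseteq> S" "lev S' h = lev S h" "accepts (decides tau n i) h S'"
proof -
  have opn: "decides tau n i h' R'" if "decides tau n i h R" "good_perfect R" "good_perfect R'" "R' \<subseteq> R" "h \<le> h'" "lev R' h = lev R h"
    for i h h' R R'
    unfolding decides_def
    by (rule AS_mono[OF that(1)[unfolded decides_def]], rule truncate_le) (use that(2-6) in \<open>simp_all add: good_perfect_def\<close>)
  have dense: "\<exists>R' h' i. good_perfect R' \<and> R' \<subseteq> R \<and> h \<le> h' \<and> lev R' h = lev R h \<and> i \<in> {..g n} \<and> decides tau n i h' R'"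
    if R: "good_perfect R" "R \<subseteq> S" "lev R h = lev S h" for R
  proof -
    have pR: "perfect R" using R by (simp add: good_perfect_def)
    have d: "(truncate R h, R) \<in> AS" "AS_le (truncate R h, R) c" using truncate_in_AS[OF R(1)] below[OF R] by auto
    obtain r i where r: "r \<in> AS" "AS_le r (truncate R h, R)" "r \<tturnstile> Mem (n, i) tau"
      using in_Baire_value[OF AS_mono[OF c(2) d(2)] d(1)] by metis
    have "i \<le> g n" using bounded_by_value[OF c(3,1) r(1) AS_le_trans[OF r(2) d(2)] r(3)] .
    moreover obtain h' where "h \<le> h'" "AS_le (truncate (snd r) h', snd r) r" using extend_to_truncate[OF r(1)] by metis
    moreover from this have "decides tau n i h' (snd r)" using AS_mono[OF r(3)] unfolding decides_def by blast
    ultimately show ?thesis using AS_good_perfect[OF r(1)] below_truncate[OF pR r(1,2)] by blast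
  qed
  obtain S' i where "perfect S'" "S' \<subseteq> S" "lev S' h = lev S h" "accepts (decides tau n i) h S'"
    by (rule pure_decision[of "{..g n}" S "decides tau n" h, OF _ _ S opn dense]) (assumption | simp)+
  then show ?thesis using that by blast
qed

text \<open>A common extension of \<open>q\<close> and of the condition deciding \<open>i\<close> exists, and forces both values.\<close>

lemma accepted_value:
  assumes c: "c \<in> AS" "c \<tturnstile> in_Baire tau" and acc: "accepts (decides tau n i) h S"
    and q: "q \<in> AS" "AS_le q c" "snd q \<subseteq> S" "lev (snd q) h = lev S h" "q \<tturnstile> Mem (n, j) tau"
  shows "i = j"
proof -
  note gq = AS_good_perfect[OF q(1)]
  obtain h' where h': "h \<le> h'" "AS_le (truncate (snd q) h', snd q) q" using extend_to_truncate[OF q(1)] by metis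
  obtain R' h'' where R': "good_perfect R'" "R' \<subseteq> snd q" "h' \<le> h''" "lev R' h' = lev (snd q) h'" "decides tau n i h'' R'"
    using acceptsE[OF acc gq q(3,4) h'(1)] by metis
  have "AS_le (truncate R' h'', R') (truncate (snd q) h', snd q)"
    using truncate_le[of "snd q" R' h' h''] R' gq by (simp add: good_perfect_def)
  then have le: "AS_le (truncate R' h'', R') q" using AS_le_trans h'(2) by blast
  show ?thesis
    using in_Baire_unique[OF c(2,1) truncate_in_AS[OF R'(1)] AS_le_trans[OF le q(2)]] R'(5) AS_mono[OF q(5) le]
    unfolding decides_def by blast
qed

text \<open>A set \<open>Z\<close> of nodes of level \<open>hs a\<close> is the level of an extension of \<open>c\<close> only if every node of level \<open>m\<close> has
an extension in \<open>Z\<close>. This is the meaning of \<open>cover\<close> in the proof; decisions are required only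
for such \<open>Z\<close>.\<close>

lemma capture:
  assumes c: "c \<in> AS" "c \<tturnstile> in_Baire tau" "c \<tturnstile> bounded_by tau g"
  obtains d H where "d \<in> AS" "AS_le d c" "\<And>n. finite (H n) \<and> card (H n) \<le> 2 ^ n"
    "\<And>n i q. q \<in> AS \<Longrightarrow> AS_le q d \<Longrightarrow> q \<tturnstile> Mem (n, i) tau \<Longrightarrow> i \<in> H n"
proof -
  obtain m where m: "AS_le (truncate (snd c) m, snd c) c" using extend_to_truncate[OF c(1)] by metis
  define U where "U = snd c"
  have U: "good_perfect U" using AS_good_perfect[OF c(1)] by (simp add: U_def)
  then have pU: "perfect U" "U \<noteq> {}" "level_good U" by (simp_all add: good_perfect_def)
  have below: "AS_le (truncate R h, R) c" if "good_perfect R" "R \<subseteq> U" "lev R m = lev U m" "m \<le> h" for R h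
    using truncate_le[OF pU(1), of R m h] that m AS_le_trans unfolding U_def good_perfect_def by blast
  \<comment> \<open>Level \<open>hs a\<close> will have \<open>N + a\<close> nodes, so the values below \<open>N\<close> are decided first.\<close>
  define N where "N = card (lev U m)"
  have "\<exists>T. perfect T \<and> T \<subseteq> U \<and> lev T m = lev U m \<and> (\<forall>n<k. \<exists>i. accepts (decides tau n i) m T)" for k
  proof (induction k)
    case 0 then show ?case using pU by blast
  next
    case (Suc k)
    then obtain T where T: "perfect T" "T \<subseteq> U" "lev T m = lev U m" "\<forall>n<k. \<exists>i. accepts (decides tau n i) m T" by blast
    obtain T' i where T': "perfect T'" "T' \<subseteq> T" "lev T' m = lev T m" "accepts (decides tau k i) m T'"
      using decide_value[OF c T(1), of m k] below T(2,3) by (metis order_refl order_trans)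
    have "\<exists>i. accepts (decides tau n i) m T'" if "n < Suc k" for n
    proof (cases "n = k")
      case False
      then have "n < k" using that by simp
      then obtain i where "accepts (decides tau n i) m T" using T(4) by blast
      then show ?thesis using accepts_subset T'(2,3) by blast
    qed (use T'(4) in blast)
    then show ?case using T' T by (intro exI[of _ T']) auto
  qed
  then obtain T0 where T0: "perfect T0" "T0 \<subseteq> U" "lev T0 m = lev U m" "\<And>n. n < N \<Longrightarrow> \<exists>i. accepts (decides tau n i) m T0" by metis
  have ne: "lev U m \<noteq> {}" by (rule lev_nonempty[OF pU(1,2)])
  then have T0ne: "T0 \<noteq> {}" using T0(3) by auto
  define cover where "cover = (\<lambda>Y. \<forall>x\<in>lev U m. \<exists>y\<in>Y. prefix x y)"
  define Rq where "Rq = (\<lambda>n h S. m \<le> h \<and> cover (lev S h) \<longrightarrow> (\<exists>i. accepts (decides tau n i) h S))"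
  have her: "hereditary Rq" unfolding hereditary_def Rq_def using accepts_subset by metis
  have dense: "\<exists>S'. perfect S' \<and> S' \<subseteq> S \<and> lev S' h = lev S h \<and> Rq n h S'"
    if S: "perfect S" "S \<noteq> {}" "S \<subseteq> T0" for n h S
  proof (cases "m \<le> h \<and> cover (lev S h)")
    case False then show ?thesis using S unfolding Rq_def by blast
  next
    case True
    have "AS_le (truncate R h, R) c" if R: "good_perfect R" "R \<subseteq> S" "lev R h = lev S h" for R
    proof (rule below)
      have pR: "perfect R" using R by (simp add: good_perfect_def)
      show "R \<subseteq> U" using R(2) S(3) T0(2) by blast
      have "x \<in> R" if x: "x \<in> lev U m" for x
      proof -
        obtain y where "y \<in> lev R h" "prefix x y" using True x R(3) unfolding cover_def by metis
        then show ?thesis using perfect_prefix[OF pR, of y x] by simp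
      qed
      then show "lev R m = lev U m" using \<open>R \<subseteq> U\<close> by auto
    qed (use R True in auto)
    then obtain S' i where "perfect S'" "S' \<subseteq> S" "lev S' h = lev S h" "accepts (decides tau n i) h S'"
      using decide_value[OF c S(1), of h n] by metis
    then show ?thesis unfolding Rq_def by blast
  qed
  obtain L hs where L: "perfect L" "L \<subseteq> T0" "hs 0 = m" "lev L m = lev T0 m" "windowed L hs"
      "\<And>a. card (lev L (hs a)) = card (lev T0 m) + a"
    and RL: "\<And>a Z. Z \<subseteq> lev L (hs a) \<Longrightarrow> Z \<noteq> {} \<Longrightarrow> Rq (card (lev T0 m) + a) (hs a) (cone L Z)"
    using fusion[OF her T0(1) T0ne, of m] dense by metis
  have "level_good L" using level_good_windowed[OF L(1,5) pU(1,3)] L(3,4) T0(3) by simp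
  moreover have "L \<noteq> {}" using ne L(4) T0(3) by auto
  ultimately have gL: "good_perfect L" using L(1) by (simp add: good_perfect_def)
  define d where "d = (truncate L m, L)"
  have d: "d \<in> AS" "AS_le d c" using truncate_in_AS[OF gL] below[OF gL] L(2,4) T0(2,3) by (auto simp: d_def)
  have "\<exists>i. n < N \<longrightarrow> accepts (decides tau n i) m T0" for n using T0(4) by blast
  then obtain v0 where v0: "\<And>n. n < N \<Longrightarrow> accepts (decides tau n (v0 n)) m T0" by metis
  define v where "v = (\<lambda>n Z. SOME i. accepts (decides tau n i) (hs (n - N)) (cone L Z))"
  define H where "H = (\<lambda>n. if n < N then {v0 n} else v n ` Pow (lev L (hs (n - N))))"
  have "finite (H n) \<and> card (H n) \<le> 2 ^ n" for n
  proof (cases "n < N")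
    case True then show ?thesis by (simp add: H_def)
  next
    case False
    have "card (H n) \<le> card (Pow (lev L (hs (n - N))))"
      using False finite_lev by (simp add: H_def card_image_le)
    also have "\<dots> = 2 ^ n" using card_Pow[OF finite_lev, of L "hs (n - N)"] L(6)[of "n - N"] T0(3) False by (simp add: N_def)
    finally show ?thesis using False finite_lev by (simp add: H_def)
  qed
  moreover have "i \<in> H n" if q: "q \<in> AS" "AS_le q d" and f: "q \<tturnstile> Mem (n, i) tau" for n i q
  proof -
    have qc: "AS_le q c" using q(2) d(2) AS_le_trans by blast
    have ql: "lev (snd q) m = lev L m" "snd q \<subseteq> L" using below_truncate[OF L(1) q(1)] q(2) by (auto simp: d_def)
    have pq: "perfect (snd q)" "snd q \<noteq> {}" using AS_good_perfect[OF q(1)] by (simp_all add: good_perfect_def)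
    show ?thesis
    proof (cases "n < N")
      case True
      have "v0 n = i" using accepted_value[OF c(1,2) v0[OF True] q(1) qc] ql L(2,4) f by auto
      then show ?thesis using True by (simp add: H_def)
    next
      case False
      define a where "a = n - N"
      define Z where "Z = lev (snd q) (hs a)"
      have mh: "m \<le> hs a" using L(3,5) unfolding windowed_def by (metis le0 strict_mono_less_eq)
      have Z: "Z \<subseteq> lev L (hs a)" "Z \<noteq> {}" using ql(2) lev_mono lev_nonempty[OF pq] by (auto simp: Z_def)
      have lc: "lev (cone L Z) (hs a) = Z" using cone_perfect(2)[OF L(1) Z(1)] .
      have "cover Z" unfolding cover_def
      proof
        fix x assume "x \<in> lev U m"
        then have "x \<in> lev (snd q) m" using ql(1) L(4) T0(3) by simp
        then show "\<exists>y\<in>Z. prefix x y" using perfect_ext[OF pq(1), of x "hs a"] mh unfolding Z_def by auto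
      qed
      then have "\<exists>i. accepts (decides tau n i) (hs a) (cone L Z)"
        using RL[OF Z] mh lc T0(3) False unfolding Rq_def N_def a_def by simp
      then have "accepts (decides tau n (v n Z)) (hs a) (cone L Z)" unfolding v_def a_def by (rule someI_ex)
      then have "v n Z = i"
        using accepted_value[OF c(1,2) _ q(1) qc _ _ f] subset_cone[OF pq(1) ql(2), of "hs a" Z] lc Z_def by blast
      then show ?thesis using False Z(1) by (auto simp: H_def a_def)
    qed
  qed
  ultimately show ?thesis using that d by blast
qed

theorem mainTheorem3: "Laver_property AS AS_le"
  unfolding Laver_property_def
proof (intro allI impI ballI)
  fix g tau p assume "p \<in> AS"
  have "q \<tturnstile> captured tau" if q: "q \<in> AS" "q \<tturnstile> Conj (in_Baire tau) (bounded_by tau g)" for q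
    unfolding captured_def Ex_fun_def forces.simps(3)
  proof (intro ballI impI notI)
    fix c assume c: "c \<in> AS" "AS_le c q" and no: "c \<tturnstile> All_fun (\<lambda>H. Neg (Conj (Ground (\<forall>n. finite (H n) \<and> card (H n) \<le> 2 ^ n))
      (All_nat (\<lambda>n. All_nat (\<lambda>m. Imp (Mem (n, m) tau) (Ground (m \<in> H n)))))))"
    have "c \<tturnstile> in_Baire tau" "c \<tturnstile> bounded_by tau g" using AS_mono[OF q(2) c(2)] by simp_all
    then obtain d H where d: "d \<in> AS" "AS_le d c" "\<And>n. finite (H n) \<and> card (H n) \<le> 2 ^ n"
      "\<And>n i q. q \<in> AS \<Longrightarrow> AS_le q d \<Longrightarrow> q \<tturnstile> Mem (n, i) tau \<Longrightarrow> i \<in> H n"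
      using capture[OF c(1)] by metis
    have "d \<tturnstile> Imp (Mem (n, i) tau) (Ground (i \<in> H n))" for n i
      unfolding forces_Imp_Ground[OF d(1)] using d(4) by blast
    then have "d \<tturnstile> Conj (Ground (\<forall>n. finite (H n) \<and> card (H n) \<le> 2 ^ n))
      (All_nat (\<lambda>n. All_nat (\<lambda>m. Imp (Mem (n, m) tau) (Ground (m \<in> H n)))))" using d(3) by simp
    moreover have "c \<tturnstile> Neg (Conj (Ground (\<forall>n. finite (H n) \<and> card (H n) \<le> 2 ^ n))
      (All_nat (\<lambda>n. All_nat (\<lambda>m. Imp (Mem (n, m) tau) (Ground (m \<in> H n))))))" using no unfolding forces.simps(6) by (rule spec)
    ultimately show False using d(1,2) unfolding forces.simps(3) by blast
  qed
  then show "p \<tturnstile> Imp (Conj (in_Baire tau) (bounded_by tau g)) (captured tau)"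
    unfolding Imp_def forces.simps(3) forces.simps(4)[of _ _ _ _ "Neg _"] using AS_le_refl by blast
qed

end
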